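(* Let $d\ge1$ and for $1\le k\le d$ let $g^k\in L^2(\mathbb{R}^m)$ and $\Lambda_k$ a countable family of points of $\mathbb{R}^{2m}$ such that $\mathcal{G}(g^k,\Lambda_k)$ is a frame for $L^2(\mathbb{R}^m)$. Let $a_k:\Lambda_1\to\Lambda_k$, $2\le k\le d$, be bijections ($a_1$ the identity) such that $$\mathcal{F}=\{g^1_\lambda\oplus g^2_{a_2(\lambda)}\oplus\cdots\oplus g^d_{a_d(\lambda)}:\lambda\in\Lambda_1\}$$ is a frame for $L^2(\mathbb{R}^m)\oplus\cdots\oplus L^2(\mathbb{R}^m)$. Fix $O\in\mathbb{R}^{2m}$ and assume there are invertible matrices $M^1,\dots,M^d\in\mathbb{R}^{2m\times2m}$ such that for all $k$ $$\lim_n\frac{|a_k^{-1}(\Lambda_k\cap M^kQ_n(O))\cap M^1Q_n(O)|}{|\Lambda_1\cap M^1Q_n(O)|}=\lim_n\frac{|\Lambda_k\cap M^kQ_n(O)|}{|\Lambda_1\cap M^1Q_n(O)|}=1,$$ and a function $r:[0,\infty)\to[0,\infty)$ such that $\|a_k^{-1}(\sigma_1)-a_k^{-1}(\sigma_2)\|\le r(\|\sigma_1-\sigma_2\|)$ for all $k$ and all $\sigma_1,\sigma_2\in\Lambda_k$. Then the ultrafilter frame measure function of $\mathcal{F}$ (indexed by $\Lambda_1$ with $\Lambda_{1,n}=\Lambda_1\cap M^1Q_n(O)$) is $$\mu(\mathcal{F})(p)=\sum_{k=1}^d\frac{1}{D(\Lambda_k;p,M^k)},\qquad p\in\mathbb{N}^*,$$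 and in particular necessarily $\sum_{k=1}^d\frac{1}{D(\Lambda_k;p,M^k)}\le1$ for all $p\in\mathbb{N}^*$.
   Context: For $\lambda=(t,\omega)\in\mathbb{R}^m\times\mathbb{R}^m$ and phase $\varphi_\lambda$, $g_\lambda(x)=e^{i\varphi_\lambda}e^{2\pi i\langle\omega,x\rangle}g(x-t)$ and $\mathcal{G}(g,\Lambda)=\{g_\lambda\}_{\lambda\in\Lambda}$ (arbitrary fixed phases; $\Lambda$ may contain repetitions, counted with multiplicity). $Q_n(c)=\{\lambda\in\mathbb{R}^{2m}:\|\lambda-c\|_\infty\le n/2\}$. $\|\cdot\|$ is a fixed norm on $\mathbb{R}^{2m}$. $\mathbb{N}^*$: free ultrafilters on $\mathbb{N}$; $p\text{-}\lim$: limit of a bounded sequence along $p$. $D(\Lambda;p,M)=p\text{-}\lim_n\frac{|\Lambda\cap MQ_n(O)|}{\mathrm{vol}(MQ_n(O))}$. For a frame $\{h_\lambda\}_{\lambda\in\Lambda_1}$ with canonical dual $\{\tilde h_\lambda\}$, $\mu(\mathcal{F})(p)=p\text{-}\lim_n\frac{1}{|\Lambda_{1,n}|}\sum_{\lambda\in\Lambda_{1,n}}\langle h_\lambda,\tilde h_\lambda\rangle$. *)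

theory Defs
  imports "HOL-Analysis.Analysis"
begin

type_synonym ('m) tf = "(real^'m) \<times> (real^'m)"

definition L2 :: "(real^'m::finite \<Rightarrow> complex) \<Rightarrow> bool" where
  "L2 f \<longleftrightarrow> f \<in> borel_measurable lborel \<and> integrable lborel (\<lambda>x. (cmod (f x))^2)"

definition l2_inner :: "(real^'m::finite \<Rightarrow> complex) \<Rightarrow> (real^'m \<Rightarrow> complex) \<Rightarrow> complex" where
  "l2_inner f h = (LINT x|lborel. f x * cnj (h x))"

definition gabor_atom :: "(real^'m::finite \<Rightarrow> complex) \<Rightarrow> real \<Rightarrow> 'm tf \<Rightarrow> real^'m \<Rightarrow> complex" where
  "gabor_atom g ph lam x =
     exp (\<i> * complex_of_real ph) * exp (2 * pi * \<i> * complex_of_real (snd lam \<bullet> x)) * g (x - fst lam)"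

text \<open>Frame for a Hilbert space given by a carrier S and inner product ip, family h indexed by I
  (repetitions allowed since h need not be injective).\<close>
definition is_frame :: "'h set \<Rightarrow> ('h \<Rightarrow> 'h \<Rightarrow> complex) \<Rightarrow> 'i set \<Rightarrow> ('i \<Rightarrow> 'h) \<Rightarrow> bool" where
  "is_frame S ip I h \<longleftrightarrow> (\<forall>i\<in>I. h i \<in> S) \<and>
     (\<exists>A B. 0 < A \<and> A \<le> B \<and> (\<forall>f\<in>S.
        (\<lambda>i. (cmod (ip f (h i)))^2) summable_on I \<and>
        A * Re (ip f f) \<le> (\<Sum>\<^sub>\<infinity>i\<in>I. (cmod (ip f (h i)))^2) \<and>
        (\<Sum>\<^sub>\<infinity>i\<in>I. (cmod (ip f (h i)))^2) \<le> B * Re (ip f f)))"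

text \<open>Canonical dual frame element S^{-1} h_j, where S is the frame operator
  S u = sum_i <u,h_i> h_i (characterised weakly: <S u, v> = sum_i <u,h_i><h_i,v>).
  In L^2 represented by functions the element is only determined a.e., hence SOME;
  all inner products with it are independent of the choice.\<close>
definition canon_dual :: "'h set \<Rightarrow> ('h \<Rightarrow> 'h \<Rightarrow> complex) \<Rightarrow> 'i set \<Rightarrow> ('i \<Rightarrow> 'h) \<Rightarrow> 'i \<Rightarrow> 'h" where
  "canon_dual S ip I h j = (SOME u. u \<in> S \<and>
      (\<forall>v\<in>S. (\<Sum>\<^sub>\<infinity>i\<in>I. ip u (h i) * ip (h i) v) = ip (h j) v))"

definition L2_sum_space :: "nat \<Rightarrow> (nat \<Rightarrow> real^'m::finite \<Rightarrow> complex) set" where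
  "L2_sum_space d = {F. (\<forall>k\<in>{1..d}. L2 (F k)) \<and> (\<forall>k. k \<notin> {1..d} \<longrightarrow> F k = (\<lambda>x. 0))}"

definition L2_sum_inner :: "nat \<Rightarrow> (nat \<Rightarrow> real^'m::finite \<Rightarrow> complex) \<Rightarrow> (nat \<Rightarrow> real^'m \<Rightarrow> complex) \<Rightarrow> complex" where
  "L2_sum_inner d F H = (\<Sum>k=1..d. l2_inner (F k) (H k))"

definition cube :: "nat \<Rightarrow> 'm::finite tf \<Rightarrow> 'm tf set" where
  "cube n c = {x. \<forall>j. \<bar>fst x $ j - fst c $ j\<bar> \<le> real n / 2 \<and> \<bar>snd x $ j - snd c $ j\<bar> \<le> real n / 2}"

definition count_in :: "'i set \<Rightarrow> ('i \<Rightarrow> 'm::finite tf) \<Rightarrow> 'm tf set \<Rightarrow> nat" where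
  "count_in I Lam E = card {i\<in>I. Lam i \<in> E}"

definition free_ultrafilter :: "nat filter \<Rightarrow> bool" where
  "free_ultrafilter p \<longleftrightarrow> p \<noteq> bot \<and>
     (\<forall>A. eventually (\<lambda>n. n \<in> A) p \<or> eventually (\<lambda>n. n \<notin> A) p) \<and>
     (\<forall>A. finite A \<longrightarrow> eventually (\<lambda>n. n \<notin> A) p)"

definition plim :: "nat filter \<Rightarrow> (nat \<Rightarrow> 'a::t2_space) \<Rightarrow> 'a" where
  "plim p x = Lim p x"

definition udensity :: "'i set \<Rightarrow> ('i \<Rightarrow> 'm::finite tf) \<Rightarrow> nat filter \<Rightarrow> ('m tf \<Rightarrow> 'm tf) \<Rightarrow> 'm tf \<Rightarrow> real" where
  "udensity I Lam p M Ob = plim p (\<lambda>n. real (count_in I Lam (M ` cube n Ob)) / measure lborel (M ` cube n Ob))"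

definition frame_measure :: "'h set \<Rightarrow> ('h \<Rightarrow> 'h \<Rightarrow> complex) \<Rightarrow> 'i set \<Rightarrow> ('i \<Rightarrow> 'h)
     \<Rightarrow> ('i \<Rightarrow> ('m::finite) tf) \<Rightarrow> ('m tf \<Rightarrow> 'm tf) \<Rightarrow> 'm tf \<Rightarrow> nat filter \<Rightarrow> complex" where
  "frame_measure S ip I h Lam M Ob p = plim p (\<lambda>n.
     (1 / of_nat (card {i\<in>I. Lam i \<in> M ` cube n Ob})) *
     (\<Sum>i\<in>{i\<in>I. Lam i \<in> M ` cube n Ob}. ip (h i) (canon_dual S ip I h i)))"

definition is_norm :: "('a::real_vector \<Rightarrow> real) \<Rightarrow> bool" where
  "is_norm N \<longleftrightarrow> (\<forall>x. 0 \<le> N x) \<and> (\<forall>x. N x = 0 \<longleftrightarrow> x = 0) \<and>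
     (\<forall>c x. N (c *\<^sub>R x) = \<bar>c\<bar> * N x) \<and> (\<forall>x y. N (x + y) \<le> N x + N y)"

end

theory Submission
  imports Defs "HOL-Probability.Characteristic_Functions"
begin

text \<open>Write $h_i$ for the superframe vectors and $u_i$ for their canonical duals. Applying the frame
  expansion to vectors supported in the $k$-th summand shows that the $k$-th components
  $h_i^k$ (a Gabor system) and $u_i^k$ are a pair of dual Bessel families in $L^2$, so it suffices to
  average $\langle h_i^k, u_i^k \rangle$ for each $k$ separately. Expand this inner product over the
  continuous Gabor system $\gamma_z$ of a unit-cube window by Moyal's identity:
  $\langle h_i^k, u_i^k \rangle = \int \langle h_i^k, \gamma_z \rangle \langle \gamma_z, u_i^k \rangle \, dz$,
  whereas the sum over all $i$ of the integrand is 1 for every $z$. Hence the sum over the points in a large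
  parallelepiped differs from its volume only through pairs $(i, z)$ with exactly one of the $i$-th point and
  $z$ inside, and covariance of the Gabor system together with the Bessel bounds makes their
  contribution negligible. The result is 1 / density. Passing from the index set of the
  $k$-th cube to that of the first one affects only a vanishing fraction of bounded terms, and $0 \le \langle h_i, u_i \rangle \le 1$
  gives the final inequality.\<close>

section \<open>Frames in abstract Hilbert spaces\<close>

text \<open>The obstacle is an asymmetry between the two families: the squared transforms of the
  Gabor vectors are translates of one integrable profile, while nothing localises the duals, which
  are controlled only by a Bessel constant and a common norm bound. Each product is therefore split
  with a free weight \<open>s\<close> into \<open>s/2\<close> times the square of the covariant
  factor plus \<open>1/(2s)\<close> times the square of the dual factor. Over pairs crossing the
  boundary the first total is \<open>o(vol)\<close>, the second only \<open>O(vol)\<close>; a large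
  \<open>s\<close> is fixed before \<open>n\<close> grows. The first total is small by a boundary
  layer count, where the Bessel bound itself limits the number of points per unit volume. The window
  is bounded and square integrable of norm 1, so its products with L2 functions lie in both L1 and
  L2; Plancherel is needed only there and is reached by Gaussian regularisation. Functions equal
  almost everywhere are never identified: inner products are only assumed semidefinite, and the
  Hilbert space arguments run on a carrier with a seminorm.\<close>

lemma quadratic_discriminant_bound:
  fixes P Q b :: real
  assumes "\<And>s. 0 \<le> P + s\<^sup>2 * b * Q - 2 * s * b" "0 \<le> b" "0 \<le> Q"
  shows "b \<le> P * Q"
proof (cases "Q = 0")
  case True
  show ?thesis
  proof (rule ccontr)
    assume "\<not> b \<le> P * Q"
    with True have "b > 0" by simp
    \<comment> \<open>For \<open>Q = 0\<close> the hypothesis is affine in \<open>s\<close> with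
      slope \<open>-2b\<close>: \<open>s = 0\<close> gives \<open>P >= 0\<close>, and
      \<open>s = (P + 1) / b\<close> gives the value \<open>-P - 2\<close>.\<close>
    with assms(1)[of "(P + 1) / b"] assms(1)[of 0] True show False by simp
  qed
next
  case False
  with assms have "Q > 0" by simp
  with assms(1)[of "1 / Q"] show ?thesis by (simp add: field_simps power2_eq_square)
qed

text \<open>\<open>lc f c h\<close> stands for \<open>f + c h\<close> and is the only vector
  operation, constrained solely through the inner product. Nonzero vectors of seminorm zero are
  allowed, since functions that agree almost everywhere remain distinct elements.\<close>

locale pre_hilbert_carrier =
  fixes S :: "'h set" and ip :: "'h \<Rightarrow> 'h \<Rightarrow> complex" and lc :: "'h \<Rightarrow> complex \<Rightarrow> 'h \<Rightarrow> 'h"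
  assumes nonempty: "S \<noteq> {}"
    and lc_closed [simp]: "f \<in> S \<Longrightarrow> h \<in> S \<Longrightarrow> lc f c h \<in> S"
    and ip_lc: "f \<in> S \<Longrightarrow> h \<in> S \<Longrightarrow> v \<in> S \<Longrightarrow> ip (lc f c h) v = ip f v + c * ip h v"
    and ip_cnj: "f \<in> S \<Longrightarrow> v \<in> S \<Longrightarrow> ip v f = cnj (ip f v)"
    and ip_nonneg: "f \<in> S \<Longrightarrow> 0 \<le> Re (ip f f)"
begin

definition nsq :: "'h \<Rightarrow> real" where "nsq f = Re (ip f f)"

definition sub :: "'h \<Rightarrow> 'h \<Rightarrow> 'h" where "sub f h = lc f (-1) h"

lemma sub_closed [simp]: "f \<in> S \<Longrightarrow> h \<in> S \<Longrightarrow> sub f h \<in> S"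
  by (simp add: sub_def)

lemma ip_lc_right:
  assumes "f \<in> S" "h \<in> S" "v \<in> S"
  shows "ip v (lc f c h) = ip v f + cnj c * ip v h"
  using assms by (simp add: ip_cnj[of "lc f c h" v] ip_lc ip_cnj[of f v] ip_cnj[of h v])

lemma ip_self: "f \<in> S \<Longrightarrow> ip f f = of_real (nsq f)"
  using ip_cnj[of f f] by (simp add: nsq_def complex_eq_iff)

lemma nsq_nonneg: "f \<in> S \<Longrightarrow> 0 \<le> nsq f"
  by (simp add: nsq_def ip_nonneg)

lemma nsq_lc:
  assumes "f \<in> S" "h \<in> S"
  shows "nsq (lc f c h) = nsq f + (cmod c)\<^sup>2 * nsq h + 2 * Re (c * ip h f)"
proof -
  have "ip (lc f c h) (lc f c h) = ip f f + cnj c * ip f h + c * (ip h f + cnj c * ip h h)"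
    using assms by (simp add: ip_lc ip_lc_right algebra_simps)
  moreover have "ip f h = cnj (ip h f)" by (rule ip_cnj) (use assms in auto)
  moreover have "c * (cnj c * ip h h) = of_real ((cmod c)\<^sup>2 * nsq h)"
    using assms by (simp only: ip_self of_real_mult complex_norm_square mult.assoc)
  ultimately show ?thesis
    by (simp add: nsq_def algebra_simps)
qed

lemma nsq_sub:
  assumes "f \<in> S" "h \<in> S"
  shows "nsq (sub f h) = nsq f + nsq h - 2 * Re (ip h f)"
  using assms by (simp add: sub_def nsq_lc)

lemma cauchy_schwarz:
  assumes "f \<in> S" "h \<in> S"
  shows "(cmod (ip f h))\<^sup>2 \<le> nsq f * nsq h"
proof (rule quadratic_discriminant_bound)
  fix s :: real
  \<comment> \<open>The factor \<open>cnj (ip h f)\<close> makes the cross term a real multiple of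
    the squared modulus, so a quadratic in \<open>s\<close> of the shape required by
    \<open>quadratic_discriminant_bound\<close> results.\<close>
  have "0 \<le> nsq (lc f (- of_real s * cnj (ip h f)) h)"
    using assms by (intro nsq_nonneg) simp
  also have "\<dots> = nsq f + s\<^sup>2 * (cmod (ip h f))\<^sup>2 * nsq h
      + 2 * Re (- of_real s * (cnj (ip h f) * ip h f))"
    using assms by (simp add: nsq_lc norm_mult power_mult_distrib mult.assoc)
  also have "cnj (ip h f) * ip h f = of_real ((cmod (ip h f))\<^sup>2)"
    by (simp only: complex_norm_square mult.commute)
  finally show "0 \<le> nsq f + s\<^sup>2 * (cmod (ip f h))\<^sup>2 * nsq h - 2 * s * (cmod (ip f h))\<^sup>2"
    using assms by (simp add: ip_cnj[of h f])
qed (use assms nsq_nonneg in auto)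

text \<open>Convergence is asked for in the seminorm only, so limits need not be unique.\<close>

definition carrier_complete :: bool where
  "carrier_complete \<longleftrightarrow> (\<forall>X. (\<forall>n::nat. X n \<in> S) \<longrightarrow>
     (\<forall>e>0. \<exists>n0. \<forall>m\<ge>n0. \<forall>n\<ge>n0. nsq (sub (X m) (X n)) < e) \<longrightarrow>
     (\<exists>x\<in>S. (\<lambda>n. nsq (sub (X n) x)) \<longlonglongrightarrow> 0))"

text \<open>The representing vector minimises \<^term>\<open>nsq v - 2 * Re (L v)\<close>; minimising sequences are
  Cauchy by the parallelogram law.\<close>
lemma riesz_representation:
  assumes complete: carrier_complete
    and L: "\<And>f h c. f \<in> S \<Longrightarrow> h \<in> S \<Longrightarrow> L (lc f c h) = L f + c * L h"
    and bdd: "\<And>v. v \<in> S \<Longrightarrow> (cmod (L v))\<^sup>2 \<le> C * nsq v"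
  shows "\<exists>w\<in>S. \<forall>v\<in>S. L v = ip v w"
proof -
  define J where "J v = nsq v - 2 * Re (L v)" for v
  \<comment> \<open>The sign of \<open>C\<close> is unknown; truncation at 0 admits the
    arithmetic-geometric mean inequality, which gives \<open>2 |L v| <= C' + nsq v\<close> and so
    bounds \<open>J\<close> below.\<close>
  define C' where "C' = max C 0"
  have J_lower: "- C' \<le> J v" if "v \<in> S" for v
  proof -
    have nn: "0 \<le> nsq v" using that by (rule nsq_nonneg)
    have "(cmod (L v))\<^sup>2 \<le> C' * nsq v"
      using bdd[OF that] mult_right_mono[OF _ nn, of C C'] by (simp add: C'_def)
    then have "cmod (L v) \<le> sqrt (C' * nsq v)"
      by (simp add: real_le_rsqrt)
    also have "\<dots> \<le> (C' + nsq v) / 2"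
      by (rule arith_geo_mean_sqrt) (use nn in \<open>auto simp: C'_def\<close>)
    finally show ?thesis using complex_Re_le_cmod[of "L v"] by (simp add: J_def)
  qed
  define I0 where "I0 = Inf (J ` S)"
  have bdd': "bdd_below (J ` S)" using J_lower by (auto intro!: bdd_belowI[of _ "- C'"])
  have I0_le: "I0 \<le> J v" if "v \<in> S" for v
    unfolding I0_def using bdd' that by (auto intro: cInf_lower)
  have "\<exists>x\<in>S. J x < I0 + 1 / real (Suc n)" for n
  proof -
    have "I0 < I0 + 1 / real (Suc n)" by simp
    then obtain y where "y \<in> J ` S" "y < I0 + 1 / real (Suc n)"
      unfolding I0_def using cInf_lessD[of "J ` S"] nonempty by (metis image_is_empty)
    then show ?thesis by auto
  qed
  then obtain X where X: "\<And>n. X n \<in> S" "\<And>n. J (X n) < I0 + 1 / real (Suc n)" by metis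
  \<comment> \<open>\<open>lc y (1/2) (sub x y)\<close> is the midpoint of \<open>x\<close> and
    \<open>y\<close>, where \<open>J\<close> is still at least \<open>I0\<close>.\<close>
  have par: "nsq (sub x y) \<le> 2 * (J x - I0) + 2 * (J y - I0)" if "x \<in> S" "y \<in> S" for x y
  proof -
    have lower: "I0 \<le> J (lc y (1/2) (sub x y))" using that by (intro I0_le) simp
    have "nsq (lc y (1/2) (sub x y)) = nsq y + nsq (sub x y) / 4 + Re (ip (sub x y) y)"
      using that by (simp add: nsq_lc power2_eq_square)
    moreover have "Re (ip (sub x y) y) = Re (ip x y) - nsq y"
      using that by (simp add: sub_def ip_lc nsq_def)
    moreover have "Re (L (lc y (1/2) (sub x y))) = Re (L x) / 2 + Re (L y) / 2"
      using that by (simp add: L sub_def field_simps)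
    ultimately have "J (lc y (1/2) (sub x y)) = nsq y + nsq (sub x y) / 4 + (Re (ip x y) - nsq y)
       - Re (L x) - Re (L y)"
      by (simp add: J_def)
    with lower have "I0 \<le> nsq (sub x y) / 4 + Re (ip x y) - Re (L x) - Re (L y)" by simp
    moreover have "nsq (sub x y) = nsq x + nsq y - 2 * Re (ip x y)"
      using that by (simp add: nsq_sub ip_cnj[of y x])
    ultimately show ?thesis unfolding J_def by argo
  qed
  have "\<exists>n0. \<forall>m\<ge>n0. \<forall>n\<ge>n0. nsq (sub (X m) (X n)) < e" if "e > 0" for e
  proof -
    obtain n0 where n0: "1 / real (Suc n0) < e / 4"
      using nat_approx_posE[of "e / 4"] \<open>e > 0\<close> by auto
    have "nsq (sub (X m) (X n)) < e" if "m \<ge> n0" "n \<ge> n0" for m n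
    proof -
      have "1 / real (Suc m) \<le> 1 / real (Suc n0)" "1 / real (Suc n) \<le> 1 / real (Suc n0)"
        using that by (auto intro!: divide_left_mono)
      with par[OF X(1)[of m] X(1)[of n]] X(2)[of m] X(2)[of n] n0 show ?thesis by argo
    qed
    then show ?thesis by blast
  qed
  with complete X(1) obtain x where x: "x \<in> S" "(\<lambda>n. nsq (sub (X n) x)) \<longlonglongrightarrow> 0"
    unfolding carrier_complete_def by blast
  have small: "(\<lambda>n. Re (ip (sub (X n) x) x)) \<longlonglongrightarrow> 0" "(\<lambda>n. Re (L (sub (X n) x))) \<longlonglongrightarrow> 0"
  proof -
    have 1: "(\<lambda>n. sqrt (nsq (sub (X n) x) * nsq x)) \<longlonglongrightarrow> 0"
      using tendsto_real_sqrt[OF tendsto_mult_left_zero[OF x(2), of "nsq x"]] by simp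
    have 2: "(\<lambda>n. sqrt (C * nsq (sub (X n) x))) \<longlonglongrightarrow> 0"
      using tendsto_real_sqrt[OF tendsto_mult_right_zero[OF x(2), of C]] by simp
    have b1: "norm (Re (ip (sub (X n) x) x)) \<le> sqrt (nsq (sub (X n) x) * nsq x)" for n
    proof -
      have "cmod (ip (sub (X n) x) x) \<le> sqrt (nsq (sub (X n) x) * nsq x)"
        by (rule real_le_rsqrt) (rule cauchy_schwarz[OF sub_closed[OF X(1) x(1)] x(1)])
      then show ?thesis using abs_Re_le_cmod[of "ip (sub (X n) x) x"] by simp
    qed
    show "(\<lambda>n. Re (ip (sub (X n) x) x)) \<longlonglongrightarrow> 0"
      by (rule Lim_null_comparison[OF _ 1]) (simp add: b1[unfolded real_norm_def])
    have b2: "norm (Re (L (sub (X n) x))) \<le> sqrt (C * nsq (sub (X n) x))" for n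
    proof -
      have "cmod (L (sub (X n) x)) \<le> sqrt (C * nsq (sub (X n) x))"
        by (rule real_le_rsqrt) (rule bdd[OF sub_closed[OF X(1) x(1)]])
      then show ?thesis using abs_Re_le_cmod[of "L (sub (X n) x)"] by simp
    qed
    show "(\<lambda>n. Re (L (sub (X n) x))) \<longlonglongrightarrow> 0"
      by (rule Lim_null_comparison[OF _ 2]) (simp add: b2[unfolded real_norm_def])
  qed
  \<comment> \<open>An exact expansion around the limit replaces continuity of \<open>J\<close>:
    every correction term tends to 0 with the seminorm of \<open>sub (X n) x\<close>.\<close>
  have JX: "J (X n) = J x + nsq (sub (X n) x) + 2 * Re (ip (sub (X n) x) x) - 2 * Re (L (sub (X n) x))" for n
  proof -
    have "Re (ip x (X n)) = Re (ip (X n) x)"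
      by (subst ip_cnj[OF X(1) x(1)]) simp
    then have "nsq (sub (X n) x) = nsq (X n) + nsq x - 2 * Re (ip (X n) x)"
      by (simp only: nsq_sub[OF X(1) x(1)])
    moreover have "Re (ip (sub (X n) x) x) = Re (ip (X n) x) - nsq x"
      using X(1)[of n] x(1) by (simp add: sub_def ip_lc nsq_def)
    moreover have "Re (L (sub (X n) x)) = Re (L (X n)) - Re (L x)"
      using X(1)[of n] x(1) by (simp add: sub_def L)
    ultimately show ?thesis unfolding J_def by argo
  qed
  have "(\<lambda>n. J (X n)) \<longlonglongrightarrow> J x + 0 + 2 * 0 - 2 * 0"
    unfolding JX by (intro tendsto_intros x small)
  moreover have "(\<lambda>n. I0 + 1 / real (Suc n)) \<longlonglongrightarrow> I0 + 0"
    by (intro tendsto_intros LIMSEQ_Suc lim_1_over_n)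
  ultimately have "J x \<le> I0"
    using X(2) by (intro LIMSEQ_le[of "\<lambda>n. J (X n)" _ "\<lambda>n. I0 + 1 / real (Suc n)"]) (auto intro: less_imp_le)
  have "L v = ip v x" if v: "v \<in> S" for v
  proof -
    \<comment> \<open>First variation at the minimiser: a move from \<open>x\<close> along
      \<open>v\<close> by \<open>c = -s cnj \<delta>\<close> changes \<open>J\<close> by a
      nonnegative quadratic in \<open>s\<close> without constant term, so the discriminant bound
      with \<open>P = 0\<close> forces \<open>\<delta> = 0\<close>.\<close>
    define \<delta> where "\<delta> = ip v x - L v"
    have "(cmod \<delta>)\<^sup>2 \<le> 0 * nsq v"
    proof (rule quadratic_discriminant_bound)
      fix s :: real
      define c where "c = - of_real s * cnj \<delta>"
      have "0 \<le> J (lc x c v) - J x"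
        using I0_le[of "lc x c v"] \<open>J x \<le> I0\<close> x(1) v by simp
      also have "J (lc x c v) - J x = (cmod c)\<^sup>2 * nsq v + 2 * Re (c * \<delta>)"
        using x(1) v by (simp add: J_def nsq_lc L \<delta>_def algebra_simps)
      also have "c * \<delta> = - of_real (s * (cmod \<delta>)\<^sup>2)"
        unfolding of_real_mult complex_norm_square by (simp add: c_def mult.commute)
      also have "(cmod c)\<^sup>2 = s\<^sup>2 * (cmod \<delta>)\<^sup>2"
        by (simp add: c_def norm_mult power_mult_distrib)
      finally show "0 \<le> 0 + s\<^sup>2 * (cmod \<delta>)\<^sup>2 * nsq v - 2 * s * (cmod \<delta>)\<^sup>2" by simp
    qed (use v nsq_nonneg in auto)
    then show ?thesis by (simp add: \<delta>_def)
  qed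
  with x(1) show ?thesis by blast
qed

end


lemma summable_on_mult_of_squares:
  fixes x y :: "'i \<Rightarrow> complex"
  assumes "(\<lambda>i. (cmod (x i))\<^sup>2) summable_on I" "(\<lambda>i. (cmod (y i))\<^sup>2) summable_on I"
  shows "(\<lambda>i. norm (x i * y i)) summable_on I"
proof (rule summable_on_comparison_test)
  show "(\<lambda>i. (cmod (x i))\<^sup>2 + (cmod (y i))\<^sup>2) summable_on I"
    using assms by (rule summable_on_add)
  fix i
  have "2 * cmod (x i) * cmod (y i) \<le> (cmod (x i))\<^sup>2 + (cmod (y i))\<^sup>2"
    by (rule sum_squares_bound)
  moreover have "0 \<le> cmod (x i) * cmod (y i)" by simp
  ultimately show "norm (x i * y i) \<le> (cmod (x i))\<^sup>2 + (cmod (y i))\<^sup>2"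
    unfolding norm_mult by linarith
qed auto

section \<open>Frame operator, its inverse and the canonical dual\<close>

locale frame_carrier = pre_hilbert_carrier S ip lc
  for S :: "'h set" and ip :: "'h \<Rightarrow> 'h \<Rightarrow> complex" and lc :: "'h \<Rightarrow> complex \<Rightarrow> 'h \<Rightarrow> 'h" +
  fixes I :: "'i set" and h :: "'i \<Rightarrow> 'h" and A B :: real
  assumes complete: carrier_complete
    and h_in [simp]: "i \<in> I \<Longrightarrow> h i \<in> S"
    and A_pos: "A > 0"
    and summable_frame: "f \<in> S \<Longrightarrow> (\<lambda>i. (cmod (ip f (h i)))\<^sup>2) summable_on I"
    and lower_bound: "f \<in> S \<Longrightarrow> A * nsq f \<le> (\<Sum>\<^sub>\<infinity>i\<in>I. (cmod (ip f (h i)))\<^sup>2)"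
    and upper_bound: "f \<in> S \<Longrightarrow> (\<Sum>\<^sub>\<infinity>i\<in>I. (cmod (ip f (h i)))\<^sup>2) \<le> B * nsq f"
begin

text \<open>This is \<open><S u, v>\<close> for the frame operator \<open>S\<close>. Working with
  the form means that \<open>S u\<close> never has to be built as a vector of the carrier.\<close>

definition frame_form :: "'h \<Rightarrow> 'h \<Rightarrow> complex" where
  "frame_form u v = (\<Sum>\<^sub>\<infinity>i\<in>I. ip u (h i) * ip (h i) v)"

lemma cmod_ip_commute: "f \<in> S \<Longrightarrow> v \<in> S \<Longrightarrow> cmod (ip v f) = cmod (ip f v)"
  by (subst ip_cnj[of f v]) auto

lemma abs_summable_frame_form:
  assumes "u \<in> S" "v \<in> S"
  shows "(\<lambda>i. norm (ip u (h i) * ip (h i) v)) summable_on I"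
proof (rule summable_on_mult_of_squares)
  show "(\<lambda>i. (cmod (ip u (h i)))\<^sup>2) summable_on I"
    using assms by (simp add: summable_frame)
  have "(\<lambda>i. (cmod (ip (h i) v))\<^sup>2) summable_on I \<longleftrightarrow> (\<lambda>i. (cmod (ip v (h i)))\<^sup>2) summable_on I"
    using assms by (intro summable_on_cong) (simp add: cmod_ip_commute[of _ v])
  then show "(\<lambda>i. (cmod (ip (h i) v))\<^sup>2) summable_on I"
    using assms by (simp add: summable_frame)
qed

lemma summable_frame_form: "u \<in> S \<Longrightarrow> v \<in> S \<Longrightarrow> (\<lambda>i. ip u (h i) * ip (h i) v) summable_on I"
  using abs_summable_frame_form by (rule abs_summable_summable)

lemma frame_form_self:
  assumes "u \<in> S"
  shows "frame_form u u = of_real (\<Sum>\<^sub>\<infinity>i\<in>I. (cmod (ip u (h i)))\<^sup>2)"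
proof -
  have "ip u (h i) * ip (h i) u = of_real ((cmod (ip u (h i)))\<^sup>2)" if "i \<in> I" for i
    unfolding complex_norm_square using that assms by (subst ip_cnj[of u "h i"]) auto
  then have "frame_form u u = (\<Sum>\<^sub>\<infinity>i\<in>I. of_real ((cmod (ip u (h i)))\<^sup>2))"
    unfolding frame_form_def by (intro infsum_cong)
  also have "\<dots> = of_real (\<Sum>\<^sub>\<infinity>i\<in>I. (cmod (ip u (h i)))\<^sup>2)"
    by (intro infsumI) (simp only: has_sum_of_real_iff has_sum_infsum summable_frame assms)
  finally show ?thesis .
qed

lemma frame_form_lower: "u \<in> S \<Longrightarrow> A * nsq u \<le> Re (frame_form u u)"
  using lower_bound by (simp add: frame_form_self)

lemma frame_form_upper: "u \<in> S \<Longrightarrow> Re (frame_form u u) \<le> B * nsq u"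
  using upper_bound by (simp add: frame_form_self)

text \<open>The frame form serves as a second inner product on the same carrier; representing a
  functional with respect to it amounts to inverting the frame operator.\<close>

sublocale bform: pre_hilbert_carrier S frame_form lc
proof
  fix f v w c
  assume "f \<in> S" "v \<in> S" "w \<in> S"
  then have "frame_form (lc f c v) w = (\<Sum>\<^sub>\<infinity>i\<in>I. ip f (h i) * ip (h i) w + c * (ip v (h i) * ip (h i) w))"
    unfolding frame_form_def by (intro infsum_cong) (simp add: ip_lc algebra_simps)
  also have "\<dots> = frame_form f w + c * frame_form v w"
    unfolding frame_form_def using \<open>f \<in> S\<close> \<open>v \<in> S\<close> \<open>w \<in> S\<close>
    by (subst infsum_add) (auto intro!: summable_on_cmult_right summable_frame_form simp: infsum_cmult_right summable_frame_form)
  finally show "frame_form (lc f c v) w = frame_form f w + c * frame_form v w" .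
next
  fix f v
  assume "f \<in> S" "v \<in> S"
  have "frame_form v f = (\<Sum>\<^sub>\<infinity>i\<in>I. cnj (ip f (h i) * ip (h i) v))"
    unfolding frame_form_def
  proof (rule infsum_cong)
    fix i assume "i \<in> I"
    with \<open>f \<in> S\<close> \<open>v \<in> S\<close> have "ip v (h i) = cnj (ip (h i) v)" "ip (h i) f = cnj (ip f (h i))"
      by (auto intro: ip_cnj)
    then show "ip v (h i) * ip (h i) f = cnj (ip f (h i) * ip (h i) v)" by simp
  qed
  then show "frame_form v f = cnj (frame_form f v)" unfolding frame_form_def by (simp only: infsum_cnj)
next
  fix f assume "f \<in> S"
  then show "0 \<le> Re (frame_form f f)" by (simp add: frame_form_self infsum_nonneg)
qed (use nonempty in auto)

text \<open>The frame bounds place the new squared seminorm between \<open>A\<close> and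
  \<open>B\<close> times the old one, so both have the same Cauchy sequences and limits.\<close>

lemma bform_complete: "bform.carrier_complete"
  unfolding bform.carrier_complete_def
proof (intro allI impI)
  fix X :: "nat \<Rightarrow> 'h"
  assume X: "\<forall>n. X n \<in> S" and C: "\<forall>e>0. \<exists>n0. \<forall>m\<ge>n0. \<forall>n\<ge>n0. bform.nsq (bform.sub (X m) (X n)) < e"
  have "\<forall>e>0. \<exists>n0. \<forall>m\<ge>n0. \<forall>n\<ge>n0. nsq (sub (X m) (X n)) < e"
  proof (intro allI impI)
    fix e :: real assume "e > 0"
    then have "A * e > 0" using A_pos by simp
    with C obtain n0 where n0: "\<And>m n. m \<ge> n0 \<Longrightarrow> n \<ge> n0 \<Longrightarrow> bform.nsq (sub (X m) (X n)) < A * e"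
      unfolding bform.sub_def sub_def by blast
    have "nsq (sub (X m) (X n)) < e" if "m \<ge> n0" "n \<ge> n0" for m n
    proof -
      have "A * nsq (sub (X m) (X n)) < A * e"
        using frame_form_lower[of "sub (X m) (X n)"] n0[OF that] X by (simp add: bform.nsq_def)
      then show ?thesis using A_pos by simp
    qed
    then show "\<exists>n0. \<forall>m\<ge>n0. \<forall>n\<ge>n0. nsq (sub (X m) (X n)) < e" by blast
  qed
  with complete X obtain x where x: "x \<in> S" "(\<lambda>n. nsq (sub (X n) x)) \<longlonglongrightarrow> 0"
    unfolding carrier_complete_def by blast
  have "(\<lambda>n. bform.nsq (sub (X n) x)) \<longlonglongrightarrow> 0"
  proof (rule tendsto_sandwich[of "\<lambda>_. 0" _ _ "\<lambda>n. B * nsq (sub (X n) x)"])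
    show "(\<lambda>n. B * nsq (sub (X n) x)) \<longlonglongrightarrow> 0"
      using tendsto_mult_right_zero[OF x(2)] .
    show "\<forall>\<^sub>F n in sequentially. bform.nsq (sub (X n) x) \<le> B * nsq (sub (X n) x)"
      using X x(1) frame_form_upper by (simp add: bform.nsq_def)
    show "\<forall>\<^sub>F n in sequentially. 0 \<le> bform.nsq (sub (X n) x)"
      using X x(1) by (simp add: bform.nsq_nonneg)
  qed simp
  with x(1) show "\<exists>x\<in>S. (\<lambda>n. bform.nsq (bform.sub (X n) x)) \<longlonglongrightarrow> 0"
    unfolding bform.sub_def sub_def by blast
qed

text \<open>Riesz representation in the frame form, for the functional sending \<open>v\<close> to
  \<open>ip v f\<close>. The lower frame bound makes it bounded there, and Hermitian symmetry then
  swaps the arguments.\<close>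

lemma inverse_frame_operator:
  assumes f: "f \<in> S"
  shows "\<exists>w\<in>S. \<forall>v\<in>S. frame_form w v = ip f v"
proof -
  have "\<exists>w\<in>S. \<forall>v\<in>S. ip v f = frame_form v w"
  proof (rule bform.riesz_representation[OF bform_complete])
    fix v assume v: "v \<in> S"
    have "(cmod (ip v f))\<^sup>2 \<le> nsq v * nsq f" using v f by (rule cauchy_schwarz)
    also have "\<dots> \<le> (bform.nsq v / A) * nsq f"
      using frame_form_lower[OF v] A_pos f by (intro mult_right_mono nsq_nonneg) (auto simp: bform.nsq_def field_simps)
    finally show "(cmod (ip v f))\<^sup>2 \<le> nsq f / A * bform.nsq v" by (simp add: field_simps)
  qed (use f in \<open>simp add: ip_lc\<close>)
  then obtain w where w: "w \<in> S" "\<And>v. v \<in> S \<Longrightarrow> ip v f = frame_form v w" by blast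
  have "frame_form w v = ip f v" if "v \<in> S" for v
    using w(2)[OF that] bform.ip_cnj[OF that w(1)] ip_cnj[OF that f] by simp
  with w(1) show ?thesis by blast
qed

text \<open>Testing with \<open>v = w\<close> gives \<open>A * nsq w <= Re (ip f w)\<close>, and
  Cauchy-Schwarz closes the estimate. The first conclusion becomes the norm bound of the duals, the
  second their Bessel constant \<open>1 / A\<close>.\<close>

lemma inverse_frame_operator_bound:
  assumes f: "f \<in> S" and w: "w \<in> S" "\<And>v. v \<in> S \<Longrightarrow> frame_form w v = ip f v"
  shows "nsq w \<le> nsq f / A\<^sup>2" "Re (frame_form w w) \<le> nsq f / A"
proof -
  have 1: "A * nsq w \<le> Re (ip f w)" using frame_form_lower[OF w(1)] w by simp
  have "(Re (ip f w))\<^sup>2 \<le> (cmod (ip f w))\<^sup>2"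
    using abs_Re_le_cmod[of "ip f w"] by (metis abs_le_square_iff abs_norm_cancel)
  also have "\<dots> \<le> nsq f * nsq w" using f w(1) by (rule cauchy_schwarz)
  finally have 2: "(Re (ip f w))\<^sup>2 \<le> nsq f * nsq w" .
  have nn: "0 \<le> nsq w" "0 \<le> nsq f" using f w(1) by (auto intro: nsq_nonneg)
  have "(A * nsq w)\<^sup>2 \<le> (Re (ip f w))\<^sup>2" using 1 nn A_pos by (intro power_mono) auto
  with 2 have "A\<^sup>2 * nsq w * nsq w \<le> nsq f * nsq w" by (simp add: power2_eq_square mult.assoc mult.left_commute)
  then have 3: "A\<^sup>2 * nsq w \<le> nsq f" using nn by (cases "nsq w = 0") auto
  then show "nsq w \<le> nsq f / A\<^sup>2" using A_pos by (simp add: field_simps)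
  have "nsq f * nsq w \<le> nsq f * (nsq f / A\<^sup>2)"
    using 3 A_pos nn by (intro mult_left_mono) (auto simp: field_simps)
  with 2 have "(Re (ip f w))\<^sup>2 \<le> (nsq f / A)\<^sup>2" by (simp add: power2_eq_square)
  then have "Re (ip f w) \<le> nsq f / A"
    by (rule power2_le_imp_le) (use nn A_pos in auto)
  then show "Re (frame_form w w) \<le> nsq f / A" using w by simp
qed

definition dual :: "'i \<Rightarrow> 'h" where "dual = canon_dual S ip I h"

lemma dual:
  assumes "j \<in> I"
  shows "dual j \<in> S" "\<And>v. v \<in> S \<Longrightarrow> frame_form (dual j) v = ip (h j) v"
proof -
  \<comment> \<open>\<open>canon_dual\<close> is a \<open>SOME\<close>, so its defining property
    holds only once a witness is known; \<open>inverse_frame_operator\<close> supplies it.\<close>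
  have "\<exists>u. u \<in> S \<and> (\<forall>v\<in>S. (\<Sum>\<^sub>\<infinity>i\<in>I. ip u (h i) * ip (h i) v) = ip (h j) v)"
    using inverse_frame_operator[of "h j"] assms by (auto simp: frame_form_def)
  from someI_ex[OF this]
  have "dual j \<in> S \<and> (\<forall>v\<in>S. frame_form (dual j) v = ip (h j) v)"
    unfolding dual_def canon_dual_def frame_form_def .
  then show "dual j \<in> S" "\<And>v. v \<in> S \<Longrightarrow> frame_form (dual j) v = ip (h j) v" by auto
qed

lemma dual_bound: "j \<in> I \<Longrightarrow> nsq (dual j) \<le> nsq (h j) / A\<^sup>2"
  using inverse_frame_operator_bound(1)[of "h j" "dual j"] dual by simp

text \<open>Self-adjointness of the inverse frame operator, with \<open>w\<close> in the role of
  \<open>S^-1 f\<close> and \<open>dual j\<close> in that of \<open>S^-1 (h j)\<close>.\<close>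

lemma dual_ip:
  assumes "f \<in> S" "w \<in> S" "\<And>v. v \<in> S \<Longrightarrow> frame_form w v = ip f v" "j \<in> I"
  shows "ip (dual j) f = ip (h j) w"
proof -
  have "ip (dual j) f = cnj (frame_form w (dual j))"
    using assms dual(1)[of j] by (simp add: ip_cnj[of f "dual j"])
  also have "\<dots> = frame_form (dual j) w"
    using assms dual(1)[of j] by (intro bform.ip_cnj[symmetric])
  finally show ?thesis using dual(2)[OF \<open>j \<in> I\<close> \<open>w \<in> S\<close>] by simp
qed

text \<open>By \<open>dual_ip\<close> the coefficients of \<open>f\<close> against the duals have
  the moduli of the frame coefficients of \<open>w = S^-1 f\<close>, so their squares add up to
  \<open><S w, w>\<close>.\<close>

lemma dual_bessel:
  assumes f: "f \<in> S"
  shows "(\<lambda>j. (cmod (ip (dual j) f))\<^sup>2) summable_on I"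
    "(\<Sum>\<^sub>\<infinity>j\<in>I. (cmod (ip (dual j) f))\<^sup>2) \<le> nsq f / A"
proof -
  obtain w where w: "w \<in> S" "\<And>v. v \<in> S \<Longrightarrow> frame_form w v = ip f v"
    using inverse_frame_operator[OF f] by blast
  have eq: "(cmod (ip (dual j) f))\<^sup>2 = (cmod (ip w (h j)))\<^sup>2" if "j \<in> I" for j
    using dual_ip[OF f w that] w(1) that by (simp add: cmod_ip_commute[of w "h j"])
  show "(\<lambda>j. (cmod (ip (dual j) f))\<^sup>2) summable_on I"
    using summable_frame[OF w(1)] eq by (simp cong: summable_on_cong)
  have "(\<Sum>\<^sub>\<infinity>j\<in>I. (cmod (ip (dual j) f))\<^sup>2) = Re (frame_form w w)"
    using eq w(1) by (simp add: frame_form_self cong: infsum_cong)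
  also have "\<dots> \<le> nsq f / A" using inverse_frame_operator_bound(2)[OF f w] .
  finally show "(\<Sum>\<^sub>\<infinity>j\<in>I. (cmod (ip (dual j) f))\<^sup>2) \<le> nsq f / A" .
qed

text \<open>By \<open>dual_ip\<close> the series is the frame form of \<open>f\<close> and
  \<open>S^-1 f\<close>. This diagonal version of the frame expansion is the one evaluated later at
  normalised window atoms.\<close>

lemma dual_reproducing:
  assumes f: "f \<in> S"
  shows "((\<lambda>j. ip f (h j) * ip (dual j) f) has_sum ip f f) I"
proof -
  obtain w where w: "w \<in> S" "\<And>v. v \<in> S \<Longrightarrow> frame_form w v = ip f v"
    using inverse_frame_operator[OF f] by blast
  have "((\<lambda>j. ip f (h j) * ip (h j) w) has_sum frame_form f w) I"
    unfolding frame_form_def using summable_frame_form[OF f w(1)] by (rule has_sum_infsum)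
  also have "frame_form f w = ip f f"
    using bform.ip_cnj[OF w(1) f] w(2)[OF f] ip_self[OF f] by simp
  finally show ?thesis
    by (rule has_sum_cong[THEN iffD1, rotated]) (simp add: dual_ip[OF f w])
qed

text \<open>For \<open>t = <h j, dual j>\<close> the frame form at \<open>dual j\<close> gives
  \<open>t\<close> as the sum over \<open>i\<close> of \<open>|<dual j, h i>|^2\<close>, whose
  \<open>j\<close>-th term alone is at least \<open>t^2\<close>; hence
  \<open>t^2 <= t\<close>.\<close>

lemma dual_diagonal:
  assumes j: "j \<in> I"
  shows "0 \<le> Re (ip (h j) (dual j))" "Re (ip (h j) (dual j)) \<le> 1"
proof -
  define t where "t = Re (ip (h j) (dual j))"
  have t: "t = Re (frame_form (dual j) (dual j))" using dual[OF j] by (simp add: t_def)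
  show nn: "0 \<le> Re (ip (h j) (dual j))"
    using t bform.ip_nonneg[OF dual(1)[OF j]] by (simp add: t_def)
  have "t\<^sup>2 \<le> (cmod (ip (dual j) (h j)))\<^sup>2"
    unfolding t_def using nn complex_Re_le_cmod[of "ip (h j) (dual j)"] dual(1)[OF j] j
    by (intro power_mono) (auto simp: cmod_ip_commute[of "dual j" "h j"])
  also have "\<dots> = (\<Sum>i\<in>{j}. (cmod (ip (dual j) (h i)))\<^sup>2)" by simp
  also have "\<dots> \<le> (\<Sum>\<^sub>\<infinity>i\<in>I. (cmod (ip (dual j) (h i)))\<^sup>2)"
    using dual[OF j] j by (intro finite_sum_le_infsum summable_frame) auto
  also have "\<dots> = t" using t dual[OF j] by (simp add: frame_form_self)
  finally have "t * t \<le> t" by (simp add: power2_eq_square)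
  then show "Re (ip (h j) (dual j)) \<le> 1"
    using nn by (cases "t = 0") (auto simp: t_def)
qed

end

section \<open>The Hilbert spaces of square-integrable functions\<close>

lemma L2_iff_nn_integral:
  "L2 f \<longleftrightarrow> f \<in> borel_measurable lborel \<and> (\<integral>\<^sup>+x. ennreal ((cmod (f x))\<^sup>2) \<partial>lborel) < \<infinity>"
  unfolding L2_def by (auto simp: integrable_iff_bounded)

lemma L2_measurable: "L2 f \<Longrightarrow> f \<in> borel_measurable borel"
  by (simp add: L2_def)

lemma L2_integrable_sq: "L2 f \<Longrightarrow> integrable lborel (\<lambda>x. (cmod (f x))\<^sup>2)"
  by (simp add: L2_def)

lemma nn_integral_L2: "L2 f \<Longrightarrow> (\<integral>\<^sup>+x. ennreal ((cmod (f x))\<^sup>2) \<partial>lborel) = ennreal (LINT x|lborel. (cmod (f x))\<^sup>2)"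
  by (intro nn_integral_eq_integral L2_integrable_sq) auto

lemma cmod_add_sq_le: "(cmod (a + b))\<^sup>2 \<le> 2 * (cmod a)\<^sup>2 + 2 * (cmod b)\<^sup>2"
proof -
  have "(cmod (a + b))\<^sup>2 \<le> (cmod a + cmod b)\<^sup>2"
    by (intro power_mono norm_triangle_ineq) simp
  also have "\<dots> \<le> 2 * (cmod a)\<^sup>2 + 2 * (cmod b)\<^sup>2"
    using sum_squares_bound[of "cmod a" "cmod b"] by (simp add: power2_sum)
  finally show ?thesis .
qed

lemma L2_lincomb:
  assumes f: "L2 f" and h: "L2 h"
  shows "L2 (\<lambda>x. f x + c * h x)"
  unfolding L2_def
proof
  show "(\<lambda>x. f x + c * h x) \<in> borel_measurable lborel"
    using f h[THEN L2_measurable] f[THEN L2_measurable] by simp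
  show "integrable lborel (\<lambda>x. (cmod (f x + c * h x))\<^sup>2)"
  proof (rule Bochner_Integration.integrable_bound)
    show "integrable lborel (\<lambda>x. 2 * (cmod (f x))\<^sup>2 + 2 * ((cmod c)\<^sup>2 * (cmod (h x))\<^sup>2))"
      using f h by (auto simp: L2_def)
    show "AE x in lborel. norm ((cmod (f x + c * h x))\<^sup>2) \<le> norm (2 * (cmod (f x))\<^sup>2 + 2 * ((cmod c)\<^sup>2 * (cmod (h x))\<^sup>2))"
    proof (rule AE_I2)
      fix x
      show "norm ((cmod (f x + c * h x))\<^sup>2) \<le> norm (2 * (cmod (f x))\<^sup>2 + 2 * ((cmod c)\<^sup>2 * (cmod (h x))\<^sup>2))"
        using cmod_add_sq_le[of "f x" "c * h x"] by (simp add: norm_mult power_mult_distrib)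
    qed
  qed (use f[THEN L2_measurable] h[THEN L2_measurable] in simp)
qed

lemma L2_diff: "L2 f \<Longrightarrow> L2 h \<Longrightarrow> L2 (\<lambda>x. f x - h x)"
  using L2_lincomb[of f h "-1"] by simp

lemma L2_zero: "L2 (\<lambda>x. 0)"
  by (simp add: L2_def)

lemma borel_measurable_cnj [measurable]: "cnj \<in> borel_measurable borel"
  by (intro borel_measurable_continuous_onI continuous_intros)

lemma integrable_mult_cnj_sq:
  fixes f h :: "'a \<Rightarrow> complex"
  assumes [measurable]: "f \<in> borel_measurable M" "h \<in> borel_measurable M"
    and "integrable M (\<lambda>x. (cmod (f x))\<^sup>2)" "integrable M (\<lambda>x. (cmod (h x))\<^sup>2)"
  shows "integrable M (\<lambda>x. f x * cnj (h x))"
proof (rule Bochner_Integration.integrable_bound)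
  show "integrable M (\<lambda>x. (cmod (f x))\<^sup>2 + (cmod (h x))\<^sup>2)"
    using assms by simp
  show "AE x in M. norm (f x * cnj (h x)) \<le> norm ((cmod (f x))\<^sup>2 + (cmod (h x))\<^sup>2)"
  proof (rule AE_I2)
    fix x
    have "0 \<le> cmod (f x) * cmod (h x)" by simp
    then show "norm (f x * cnj (h x)) \<le> norm ((cmod (f x))\<^sup>2 + (cmod (h x))\<^sup>2)"
      using sum_squares_bound[of "cmod (f x)" "cmod (h x)"] unfolding norm_mult complex_mod_cnj real_norm_def
      by linarith
  qed
qed measurable

lemma L2_integrable_mult: "L2 f \<Longrightarrow> L2 h \<Longrightarrow> integrable lborel (\<lambda>x. f x * cnj (h x))"
  by (rule integrable_mult_cnj_sq) (simp_all add: L2_def)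

lemma l2_inner_lincomb:
  assumes "L2 f" "L2 h" "L2 v"
  shows "l2_inner (\<lambda>x. f x + c * h x) v = l2_inner f v + c * l2_inner h v"
proof -
  have "l2_inner (\<lambda>x. f x + c * h x) v = (LINT x|lborel. f x * cnj (v x) + c * (h x * cnj (v x)))"
    by (simp add: l2_inner_def algebra_simps)
  then show ?thesis
    using assms by (simp add: l2_inner_def L2_integrable_mult)
qed

lemma l2_inner_cnj: "l2_inner v f = cnj (l2_inner f v)"
proof -
  have "cnj (l2_inner f v) = (LINT x|lborel. cnj (f x * cnj (v x)))"
    unfolding l2_inner_def by (rule Bochner_Integration.integral_cnj[symmetric])
  then show ?thesis by (simp add: l2_inner_def mult.commute)
qed

lemma l2_inner_self: "l2_inner f f = of_real (LINT x|lborel. (cmod (f x))\<^sup>2)"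
proof -
  have "l2_inner f f = (LINT x|lborel. of_real ((cmod (f x))\<^sup>2))"
    unfolding l2_inner_def complex_norm_square ..
  then show ?thesis by (simp only: integral_complex_of_real)
qed

text \<open>Riesz--Fischer: along a rapidly converging subsequence \<^term>\<open>Y\<close> the series
  \<^term>\<open>\<Sum>k. 2 ^ k * (cmod (Y (Suc k) x - Y k x))\<^sup>2\<close> is finite almost everywhere.\<close>
lemma L2_complete:
  fixes X :: "nat \<Rightarrow> real^'m::finite \<Rightarrow> complex"
  assumes X: "\<And>n. L2 (X n)"
    and C: "\<And>e. e > 0 \<Longrightarrow> \<exists>n0. \<forall>m\<ge>n0. \<forall>n\<ge>n0. (LINT x|lborel. (cmod (X m x - X n x))\<^sup>2) < e"
  shows "\<exists>f. L2 f \<and> (\<lambda>n. LINT x|lborel. (cmod (X n x - f x))\<^sup>2) \<longlonglongrightarrow> 0"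
proof -
  have "\<exists>n0. \<forall>m\<ge>n0. \<forall>n\<ge>n0. (LINT x|lborel. (cmod (X m x - X n x))\<^sup>2) < (1/4)^k" for k :: nat
    by (rule C) simp
  then obtain N where N: "\<And>k m n. N k \<le> m \<Longrightarrow> N k \<le> n \<Longrightarrow> (LINT x|lborel. (cmod (X m x - X n x))\<^sup>2) < (1/4)^k"
    by metis
  have N': "(\<integral>\<^sup>+x. ennreal ((cmod (X m x - X n x))\<^sup>2) \<partial>lborel) \<le> ennreal ((1/4)^k)"
    if "N k \<le> m" "N k \<le> n" for k m n
    using N[OF that] nn_integral_L2[OF L2_diff[OF X X], of m n] by (simp add: ennreal_leI)
  \<comment> \<open>Summing the thresholds yields indices that dominate \<open>N j\<close> for all
    \<open>j <= k\<close>, as both neighbours \<open>Y k\<close> and \<open>Y (Suc k)\<close>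
    must.\<close>
  define r where "r k = (\<Sum>j\<le>k. N j)" for k
  have r: "N j \<le> r k" if "j \<le> k" for j k
    unfolding r_def using that by (intro member_le_sum) auto
  define Y where "Y k = X (r k)" for k
  let ?d = "\<lambda>k x. 2^k * (cmod (Y (Suc k) x - Y k x))\<^sup>2"
  have Y_meas [measurable]: "Y k \<in> borel_measurable borel" for k
    using X unfolding Y_def by (rule L2_measurable)
  have X_meas [measurable]: "X k \<in> borel_measurable borel" for k
    using X by (rule L2_measurable)
  have "(\<integral>\<^sup>+x. (\<Sum>k. ennreal (?d k x)) \<partial>lborel)
      = (\<Sum>k. \<integral>\<^sup>+x. ennreal (?d k x) \<partial>lborel)"
    by (rule nn_integral_suminf) simp
  also have "\<dots> \<le> (\<Sum>k. ennreal ((1/2)^k))"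
  proof (intro suminf_le summableI)
    fix k
    have "(\<integral>\<^sup>+x. ennreal (?d k x) \<partial>lborel)
        = ennreal (2^k) * (\<integral>\<^sup>+x. ennreal ((cmod (Y (Suc k) x - Y k x))\<^sup>2) \<partial>lborel)"
      by (simp add: ennreal_mult nn_integral_cmult)
    also have "\<dots> \<le> ennreal (2^k) * ennreal ((1/4)^k)"
      unfolding Y_def by (intro mult_left_mono N' r) auto
    also have "\<dots> = ennreal ((1/2)^k)"
      by (simp add: ennreal_mult[symmetric] power_mult_distrib[symmetric])
    finally show "(\<integral>\<^sup>+x. ennreal (?d k x) \<partial>lborel) \<le> ennreal ((1/2)^k)" .
  qed
  also have "\<dots> = ennreal (\<Sum>k. (1/2)^k)"
    by (rule suminf_ennreal2) auto
  also have "\<dots> < \<infinity>" by simp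
  finally have "AE x in lborel. (\<Sum>k. ennreal (?d k x)) \<noteq> \<infinity>"
    by (intro nn_integral_PInf_AE) auto
  moreover have "convergent (\<lambda>k. Y k x)"
    if fin: "(\<Sum>k. ennreal (?d k x)) \<noteq> \<infinity>" for x
  proof -
    define c where "c = enn2real (\<Sum>k. ennreal (?d k x))"
    \<comment> \<open>The weight \<open>2^k\<close> turns finiteness of the series into geometric
      decay with ratio \<open>1 / sqrt 2\<close>; the rate \<open>4^-k\<close> built into
      \<open>N\<close> leaves room for that weight.\<close>
    have bound: "norm (Y (Suc k) x - Y k x) \<le> sqrt c * (1 / sqrt 2)^k" for k
    proof -
      have "(\<Sum>k\<in>{k}. ennreal (?d k x))
          \<le> (\<Sum>k. ennreal (?d k x))"
        by (rule sum_le_suminf) auto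
      also have "\<dots> = ennreal c"
        unfolding c_def using fin by (intro ennreal_enn2real[symmetric]) (simp add: less_top)
      finally have "ennreal (?d k x) \<le> ennreal c" by simp
      then have "?d k x \<le> c"
        by (subst (asm) ennreal_le_iff) (simp_all add: c_def)
      then have "sqrt (?d k x) \<le> sqrt c" by simp
      then show ?thesis by (simp add: real_sqrt_mult real_sqrt_power field_simps)
    qed
    have geo: "summable (\<lambda>k. sqrt c * (1 / sqrt 2)^k)"
      by (intro summable_mult summable_geometric) simp
    have "summable (\<lambda>k. Y (Suc k) x - Y k x)"
      using summable_comparison_test'[OF geo, of 0 "\<lambda>k. Y (Suc k) x - Y k x"] bound by simp
    then have "convergent (\<lambda>n. \<Sum>k<n. Y (Suc k) x - Y k x)"
      by (rule summable_iff_convergent[THEN iffD1])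
    then have "convergent (\<lambda>n. Y n x - Y 0 x)"
      unfolding sum_lessThan_telescope[of "\<lambda>k. Y k x"] .
    then show ?thesis by (rule convergent_diff_const_right_iff[THEN iffD1])
  qed
  ultimately have AE_conv: "AE x in lborel. convergent (\<lambda>k. Y k x)" by (rule eventually_mono)
  define f where "f x = lim (\<lambda>k. Y k x)" for x
  have f_meas [measurable]: "f \<in> borel_measurable borel"
    unfolding f_def by measurable
  have AE_lim: "AE x in lborel. (\<lambda>k. Y k x) \<longlonglongrightarrow> f x"
    using AE_conv by (rule eventually_mono) (simp only: f_def convergent_LIMSEQ_iff)
  \<comment> \<open>Fatou's lemma along the subsequence carries the Cauchy estimate over to the
    pointwise limit.\<close>
  have est: "(\<integral>\<^sup>+x. ennreal ((cmod (X n x - f x))\<^sup>2) \<partial>lborel) \<le> ennreal ((1/4)^j)" if n: "N j \<le> n" for n j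
  proof -
    have "(\<integral>\<^sup>+x. ennreal ((cmod (X n x - f x))\<^sup>2) \<partial>lborel)
        = (\<integral>\<^sup>+x. liminf (\<lambda>k. ennreal ((cmod (X n x - Y k x))\<^sup>2)) \<partial>lborel)"
    proof (rule nn_integral_cong_AE, rule AE_mp[OF AE_lim], rule AE_I2, rule impI)
      fix x assume "(\<lambda>k. Y k x) \<longlonglongrightarrow> f x"
      then have "(\<lambda>k. ennreal ((cmod (X n x - Y k x))\<^sup>2)) \<longlonglongrightarrow> ennreal ((cmod (X n x - f x))\<^sup>2)"
        by (intro tendsto_intros)
      then show "ennreal ((cmod (X n x - f x))\<^sup>2) = liminf (\<lambda>k. ennreal ((cmod (X n x - Y k x))\<^sup>2))"
        by (intro lim_imp_Liminf[symmetric]) simp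
    qed
    also have "\<dots> \<le> liminf (\<lambda>k. \<integral>\<^sup>+x. ennreal ((cmod (X n x - Y k x))\<^sup>2) \<partial>lborel)"
      by (rule nn_integral_liminf) simp
    also have "\<dots> \<le> liminf (\<lambda>k. ennreal ((1/4)^j))"
    proof (rule Liminf_mono)
      show "\<forall>\<^sub>F k in sequentially. (\<integral>\<^sup>+x. ennreal ((cmod (X n x - Y k x))\<^sup>2) \<partial>lborel) \<le> ennreal ((1/4)^j)"
        using eventually_ge_at_top[of j] by eventually_elim (unfold Y_def, intro N' n r)
    qed
    also have "\<dots> = ennreal ((1/4)^j)" by (simp add: Liminf_const)
    finally show ?thesis .
  qed
  have L2d: "L2 (\<lambda>x. X n x - f x)" if "N 0 \<le> n" for n
    unfolding L2_iff_nn_integral using est[OF that] by (auto intro: le_less_trans)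
  have "L2 (\<lambda>x. X (N 0) x - (X (N 0) x - f x))"
    by (intro L2_diff X L2d) simp
  then have f: "L2 f" by simp
  have "(\<lambda>n. LINT x|lborel. (cmod (X n x - f x))\<^sup>2) \<longlonglongrightarrow> 0"
  proof (rule LIMSEQ_I)
    fix e :: real assume "e > 0"
    then obtain j where j: "(1/4)^j < e" using real_arch_pow_inv[of e "1/4"] by auto
    have "norm ((LINT x|lborel. (cmod (X n x - f x))\<^sup>2) - 0) < e" if "n \<ge> N j" for n
    proof -
      have "ennreal (LINT x|lborel. (cmod (X n x - f x))\<^sup>2) \<le> ennreal ((1/4)^j)"
        using est[OF that] nn_integral_L2[OF L2_diff[OF X f], of n] by simp
      then have "(LINT x|lborel. (cmod (X n x - f x))\<^sup>2) \<le> (1/4)^j"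
        by (subst (asm) ennreal_le_iff) simp_all
      moreover have "0 \<le> (LINT x|lborel. (cmod (X n x - f x))\<^sup>2)" by simp
      ultimately show ?thesis using j by simp
    qed
    then show "\<exists>n0. \<forall>n\<ge>n0. norm ((LINT x|lborel. (cmod (X n x - f x))\<^sup>2) - 0) < e" by blast
  qed
  with f show ?thesis by blast
qed

interpretation L2: pre_hilbert_carrier "{f :: real^'m::finite \<Rightarrow> complex. L2 f}" l2_inner "\<lambda>f c h x. f x + c * h x"
proof
  show "{f :: real^'m \<Rightarrow> complex. L2 f} \<noteq> {}" using L2_zero by blast
  show "0 \<le> Re (l2_inner f f)" for f :: "real^'m \<Rightarrow> complex" by (simp add: l2_inner_self)
qed (simp_all add: L2_lincomb l2_inner_lincomb l2_inner_cnj[symmetric])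

lemma L2_nsq: "L2.nsq f = (LINT x|lborel. (cmod (f x))\<^sup>2)"
  by (simp add: L2.nsq_def l2_inner_self)

section \<open>Finite direct sums of L2 spaces\<close>

definition L2_sum_lincomb :: "(nat \<Rightarrow> real^'m::finite \<Rightarrow> complex) \<Rightarrow> complex \<Rightarrow> (nat \<Rightarrow> real^'m \<Rightarrow> complex)
    \<Rightarrow> nat \<Rightarrow> real^'m \<Rightarrow> complex" where
  "L2_sum_lincomb F c H = (\<lambda>k x. F k x + c * H k x)"

lemma L2_sum_inner_self:
  "L2_sum_inner d F F = of_real (\<Sum>k=1..d. LINT x|lborel. (cmod (F k x))\<^sup>2)"
  by (simp add: L2_sum_inner_def l2_inner_self)

interpretation L2sum: pre_hilbert_carrier "L2_sum_space d" "L2_sum_inner d" L2_sum_lincomb for d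
proof
  show "L2_sum_space d \<noteq> {}"
    by (auto simp: L2_sum_space_def intro!: exI[of _ "\<lambda>k x. 0"] L2_zero)
next
  fix F H :: "nat \<Rightarrow> real^'m \<Rightarrow> complex" and c
  assume "F \<in> L2_sum_space d" "H \<in> L2_sum_space d"
  then show "L2_sum_lincomb F c H \<in> L2_sum_space d"
    by (auto simp: L2_sum_space_def L2_sum_lincomb_def intro: L2_lincomb)
next
  fix F H V :: "nat \<Rightarrow> real^'m \<Rightarrow> complex" and c
  assume *: "F \<in> L2_sum_space d" "H \<in> L2_sum_space d" "V \<in> L2_sum_space d"
  have "L2_sum_inner d (L2_sum_lincomb F c H) V = (\<Sum>k=1..d. l2_inner (F k) (V k) + c * l2_inner (H k) (V k))"
    unfolding L2_sum_inner_def L2_sum_lincomb_def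
    by (intro sum.cong refl l2_inner_lincomb) (use * in \<open>auto simp: L2_sum_space_def\<close>)
  then show "L2_sum_inner d (L2_sum_lincomb F c H) V = L2_sum_inner d F V + c * L2_sum_inner d H V"
    by (simp add: L2_sum_inner_def sum.distrib sum_distrib_left)
next
  fix F V :: "nat \<Rightarrow> real^'m \<Rightarrow> complex"
  show "L2_sum_inner d V F = cnj (L2_sum_inner d F V)"
    unfolding L2_sum_inner_def cnj_sum by (intro sum.cong refl) (rule l2_inner_cnj)
next
  fix F :: "nat \<Rightarrow> real^'m \<Rightarrow> complex"
  show "0 \<le> Re (L2_sum_inner d F F)"
    by (simp only: L2_sum_inner_self Re_complex_of_real) (intro sum_nonneg; simp)
qed

lemma L2_sum_complete: "pre_hilbert_carrier.carrier_complete (L2_sum_space d :: (nat \<Rightarrow> real^'m::finite \<Rightarrow> complex) set)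
    (L2_sum_inner d) L2_sum_lincomb"
  unfolding L2sum.carrier_complete_def
proof (intro allI impI)
  fix X :: "nat \<Rightarrow> nat \<Rightarrow> real^'m \<Rightarrow> complex"
  assume X: "\<forall>n. X n \<in> L2_sum_space d"
    and C: "\<forall>e>0. \<exists>n0. \<forall>m\<ge>n0. \<forall>n\<ge>n0. L2sum.nsq d (L2sum.sub (X m) (X n)) < e"
  have nsq: "L2sum.nsq d (L2sum.sub F H) = (\<Sum>k=1..d. LINT x|lborel. (cmod (F k x - H k x))\<^sup>2)"
    for F H :: "nat \<Rightarrow> real^'m \<Rightarrow> complex"
    by (simp add: L2sum.nsq_def L2sum.sub_def L2_sum_inner_self L2_sum_lincomb_def)
  have "\<exists>f. L2 f \<and> (\<lambda>n. LINT x|lborel. (cmod (X n k x - f x))\<^sup>2) \<longlonglongrightarrow> 0" if k: "k \<in> {1..d}" for k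
  proof (rule L2_complete)
    show "L2 (X n k)" for n using X k by (auto simp: L2_sum_space_def)
    fix e :: real assume "e > 0"
    with C obtain n0 where n0: "\<And>m n. m \<ge> n0 \<Longrightarrow> n \<ge> n0 \<Longrightarrow> L2sum.nsq d (L2sum.sub (X m) (X n)) < e"
      by blast
    have "(LINT x|lborel. (cmod (X m k x - X n k x))\<^sup>2) < e" if "m \<ge> n0" "n \<ge> n0" for m n
    proof -
      have "(LINT x|lborel. (cmod (X m k x - X n k x))\<^sup>2) \<le> (\<Sum>k=1..d. LINT x|lborel. (cmod (X m k x - X n k x))\<^sup>2)"
        by (rule member_le_sum[OF k]) auto
      also have "\<dots> < e" using n0[OF that] by (simp only: nsq)
      finally show ?thesis .
    qed
    then show "\<exists>n0. \<forall>m\<ge>n0. \<forall>n\<ge>n0. (LINT x|lborel. (cmod (X m k x - X n k x))\<^sup>2) < e" by blast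
  qed
  then have "\<forall>k\<in>{1..d}. \<exists>f. L2 f \<and> (\<lambda>n. LINT x|lborel. (cmod (X n k x - f x))\<^sup>2) \<longlonglongrightarrow> 0"
    by (rule ballI)
  from bchoice[OF this] obtain f where
    f': "\<forall>k\<in>{1..d}. L2 (f k) \<and> (\<lambda>n. LINT x|lborel. (cmod (X n k x - f k x))\<^sup>2) \<longlonglongrightarrow> 0" ..
  note f = f'[THEN bspec, THEN conjunct1] f'[THEN bspec, THEN conjunct2]
  \<comment> \<open>Membership in the direct sum demands the zero function outside
    \<open>{1..d}\<close>, where the choice of \<open>f\<close> is unconstrained.\<close>
  define F where "F k = (if k \<in> {1..d} then f k else (\<lambda>x. 0))" for k
  have "F \<in> L2_sum_space d" using f(1) by (auto simp: L2_sum_space_def F_def)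
  moreover have "(\<lambda>n. L2sum.nsq d (L2sum.sub (X n) F)) \<longlonglongrightarrow> 0"
    unfolding nsq by (rule tendsto_null_sum) (use f(2) in \<open>simp add: F_def\<close>)
  ultimately show "\<exists>x\<in>L2_sum_space d. (\<lambda>n. L2sum.nsq d (L2sum.sub (X n) x)) \<longlonglongrightarrow> 0" by blast
qed

section \<open>Translations\<close>

lemma lborel_integral_affine:
  fixes f :: "'a::euclidean_space \<Rightarrow> 'b::{banach, second_countable_topology}"
  assumes "c \<noteq> 0" and [measurable]: "f \<in> borel_measurable borel"
  shows "integral\<^sup>L lborel f = \<bar>c\<bar> ^ DIM('a) *\<^sub>R (LINT x|lborel. f (t + c *\<^sub>R x))"
proof -
  have "integral\<^sup>L lborel f = integral\<^sup>L (density (distr lborel borel (\<lambda>x. t + c *\<^sub>R x)) (\<lambda>_. \<bar>c\<bar> ^ DIM('a))) f"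
    by (subst lborel_affine[OF \<open>c \<noteq> 0\<close>, of t]) simp
  also have "\<dots> = (LINT x|distr lborel borel (\<lambda>x. t + c *\<^sub>R x). \<bar>c\<bar> ^ DIM('a) *\<^sub>R f x)"
    by (rule integral_density) auto
  also have "\<dots> = (LINT x|lborel. \<bar>c\<bar> ^ DIM('a) *\<^sub>R f (t + c *\<^sub>R x))"
    by (rule integral_distr) measurable
  finally show ?thesis by simp
qed

lemma nn_integral_lborel_affine:
  fixes f :: "'a::euclidean_space \<Rightarrow> ennreal"
  assumes "c \<noteq> 0" and [measurable]: "f \<in> borel_measurable borel"
  shows "(\<integral>\<^sup>+x. f x \<partial>lborel) = ennreal (\<bar>c\<bar> ^ DIM('a)) * (\<integral>\<^sup>+x. f (t + c *\<^sub>R x) \<partial>lborel)"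
proof -
  have "(\<integral>\<^sup>+x. f x \<partial>lborel) = integral\<^sup>N (density (distr lborel borel (\<lambda>x. t + c *\<^sub>R x)) (\<lambda>_. \<bar>c\<bar> ^ DIM('a))) f"
    by (subst lborel_affine[OF \<open>c \<noteq> 0\<close>, of t]) simp
  also have "\<dots> = (\<integral>\<^sup>+x. ennreal (\<bar>c\<bar> ^ DIM('a)) * f x \<partial>distr lborel borel (\<lambda>x. t + c *\<^sub>R x))"
    by (rule nn_integral_density) auto
  also have "\<dots> = (\<integral>\<^sup>+x. ennreal (\<bar>c\<bar> ^ DIM('a)) * f (t + c *\<^sub>R x) \<partial>lborel)"
    by (rule nn_integral_distr) measurable
  also have "\<dots> = ennreal (\<bar>c\<bar> ^ DIM('a)) * (\<integral>\<^sup>+x. f (t + c *\<^sub>R x) \<partial>lborel)"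
    by (rule nn_integral_cmult) measurable
  finally show ?thesis .
qed

lemma nn_integral_lborel_translate:
  fixes f :: "'a::euclidean_space \<Rightarrow> ennreal"
  assumes "f \<in> borel_measurable borel"
  shows "(\<integral>\<^sup>+x. f (x - y) \<partial>lborel) = (\<integral>\<^sup>+x. f x \<partial>lborel)"
  using nn_integral_lborel_affine[of 1 f "- y"] assms by simp

lemma nn_integral_lborel_reflect:
  fixes f :: "'a::euclidean_space \<Rightarrow> ennreal"
  assumes "f \<in> borel_measurable borel"
  shows "(\<integral>\<^sup>+x. f (y - x) \<partial>lborel) = (\<integral>\<^sup>+x. f x \<partial>lborel)"
  using nn_integral_lborel_affine[of "-1" f y] assms by simp

lemma lborel_integral_translate:
  fixes f :: "'a::euclidean_space \<Rightarrow> 'b::{banach, second_countable_topology}"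
  assumes "f \<in> borel_measurable borel"
  shows "(LINT x|lborel. f (x - y)) = integral\<^sup>L lborel f"
  using lborel_integral_affine[of 1 f "- y"] assms by simp

lemma lborel_integral_reflect:
  fixes f :: "'a::euclidean_space \<Rightarrow> 'b::{banach, second_countable_topology}"
  assumes "f \<in> borel_measurable borel"
  shows "(LINT x|lborel. f (y - x)) = integral\<^sup>L lborel f"
  using lborel_integral_affine[of "-1" f y] assms by simp

lemma integrable_lborel_translate:
  fixes f :: "'a::euclidean_space \<Rightarrow> 'b::{banach, second_countable_topology}"
  assumes f: "integrable lborel f"
  shows "integrable lborel (\<lambda>x. f (x - y))"
proof (rule integrableI_bounded)
  have [measurable]: "f \<in> borel_measurable borel" using borel_measurable_integrable[OF f] by simp
  show "(\<lambda>x. f (x - y)) \<in> borel_measurable lborel" by measurable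
  have "(\<integral>\<^sup>+x. ennreal (norm (f (x - y))) \<partial>lborel) = (\<integral>\<^sup>+x. ennreal (norm (f x)) \<partial>lborel)"
    by (rule nn_integral_lborel_translate[of "\<lambda>x. ennreal (norm (f x))"]) measurable
  then show "(\<integral>\<^sup>+x. ennreal (norm (f (x - y))) \<partial>lborel) < \<infinity>"
    using f by (simp add: integrable_iff_bounded)
qed

section \<open>Continuity of translations in L1\<close>

definition translation_continuous :: "('a::euclidean_space \<Rightarrow> real) \<Rightarrow> bool" where
  "translation_continuous f \<longleftrightarrow>
    (\<forall>y. y \<longlonglongrightarrow> 0 \<longrightarrow> (\<lambda>n. LINT x|lborel. \<bar>f (x - y n) - f x\<bar>) \<longlonglongrightarrow> 0)"

lemma integral_translate_diff_le:
  fixes f g :: "'a::euclidean_space \<Rightarrow> real"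
  assumes f: "integrable lborel f" and g: "integrable lborel g"
  shows "(LINT x|lborel. \<bar>f (x - y) - f x\<bar>)
    \<le> 2 * (LINT x|lborel. \<bar>f x - g x\<bar>) + (LINT x|lborel. \<bar>g (x - y) - g x\<bar>)"
proof -
  note [simp] = f g integrable_lborel_translate[OF f] integrable_lborel_translate[OF g]
  have fg: "integrable lborel (\<lambda>x. \<bar>f x - g x\<bar>)" by simp
  have "(LINT x|lborel. \<bar>f (x - y) - f x\<bar>)
      \<le> (LINT x|lborel. \<bar>f (x - y) - g (x - y)\<bar> + (\<bar>f x - g x\<bar> + \<bar>g (x - y) - g x\<bar>))"
    by (rule integral_mono) (simp, simp, linarith)
  also have "\<dots> = (LINT x|lborel. \<bar>f (x - y) - g (x - y)\<bar>)
      + ((LINT x|lborel. \<bar>f x - g x\<bar>) + (LINT x|lborel. \<bar>g (x - y) - g x\<bar>))"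
    by simp
  also have "(LINT x|lborel. \<bar>f (x - y) - g (x - y)\<bar>) = (LINT x|lborel. \<bar>f x - g x\<bar>)"
    using lborel_integral_translate[of "\<lambda>x. \<bar>f x - g x\<bar>" y] borel_measurable_integrable[OF fg] by simp
  finally show ?thesis by simp
qed

text \<open>Inserting \<open>g\<close> costs its L1 distance to \<open>f\<close> twice, since
  translation preserves that distance; hence the shares \<open>e / 4\<close> for the distance and
  \<open>e / 2\<close> for the displacement of \<open>g\<close>.\<close>

lemma translation_continuous_L1_limit:
  fixes f :: "'a::euclidean_space \<Rightarrow> real"
  assumes f: "integrable lborel f"
    and approx: "\<And>e. e > 0 \<Longrightarrow> \<exists>g. integrable lborel g \<and> translation_continuous g \<and> (LINT x|lborel. \<bar>f x - g x\<bar>) < e"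
  shows "translation_continuous f"
  unfolding translation_continuous_def
proof (intro allI impI LIMSEQ_I)
  fix y :: "nat \<Rightarrow> 'a" and e :: real
  assume y: "y \<longlonglongrightarrow> 0" and "e > 0"
  then have "e / 4 > 0" by simp
  from approx[OF this] obtain g where
    g: "integrable lborel g" "translation_continuous g" "(LINT x|lborel. \<bar>f x - g x\<bar>) < e / 4"
    by (elim exE conjE)
  have "(\<lambda>n. LINT x|lborel. \<bar>g (x - y n) - g x\<bar>) \<longlonglongrightarrow> 0"
    using g(2) y unfolding translation_continuous_def by (elim allE impE)
  from LIMSEQ_D[OF this, of "e / 2"] \<open>e > 0\<close> obtain n0 where
    n0: "\<And>n. n \<ge> n0 \<Longrightarrow> norm ((LINT x|lborel. \<bar>g (x - y n) - g x\<bar>) - 0) < e / 2"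
    by auto
  have "norm ((LINT x|lborel. \<bar>f (x - y n) - f x\<bar>) - 0) < e" if "n \<ge> n0" for n
  proof -
    have "0 \<le> (LINT x|lborel. \<bar>f (x - y n) - f x\<bar>)" by (rule Bochner_Integration.integral_nonneg) simp
    then show ?thesis
      using n0[OF that] g(3) integral_translate_diff_le[OF f g(1), of "y n"] unfolding real_norm_def by linarith
  qed
  then show "\<exists>n0. \<forall>n\<ge>n0. norm ((LINT x|lborel. \<bar>f (x - y n) - f x\<bar>) - 0) < e" by blast
qed

lemma translation_continuous_cmult:
  assumes "translation_continuous f"
  shows "translation_continuous (\<lambda>x. c * f x)"
  unfolding translation_continuous_def
proof (intro allI impI)
  fix y :: "nat \<Rightarrow> 'a"
  assume "y \<longlonglongrightarrow> 0"
  then have "(\<lambda>n. \<bar>c\<bar> * (LINT x|lborel. \<bar>f (x - y n) - f x\<bar>)) \<longlonglongrightarrow> \<bar>c\<bar> * 0"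
    using assms unfolding translation_continuous_def by (intro tendsto_mult_left) blast
  then show "(\<lambda>n. LINT x|lborel. \<bar>c * f (x - y n) - c * f x\<bar>) \<longlonglongrightarrow> 0"
    by (simp add: right_diff_distrib[symmetric] abs_mult)
qed

lemma translation_continuous_add:
  assumes f: "integrable lborel f" "translation_continuous f"
    and g: "integrable lborel g" "translation_continuous g"
  shows "translation_continuous (\<lambda>x. f x + g x)"
  unfolding translation_continuous_def
proof (intro allI impI)
  fix y :: "nat \<Rightarrow> 'a"
  assume y: "y \<longlonglongrightarrow> 0"
  note [simp] = f(1) g(1) integrable_lborel_translate[OF f(1)] integrable_lborel_translate[OF g(1)]
  have lim: "(\<lambda>n. (LINT x|lborel. \<bar>f (x - y n) - f x\<bar>) + (LINT x|lborel. \<bar>g (x - y n) - g x\<bar>)) \<longlonglongrightarrow> 0 + 0"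
    using f(2) g(2) y unfolding translation_continuous_def by (intro tendsto_add) blast+
  have "norm (LINT x|lborel. \<bar>f (x - y n) + g (x - y n) - (f x + g x)\<bar>)
      \<le> (LINT x|lborel. \<bar>f (x - y n) - f x\<bar>) + (LINT x|lborel. \<bar>g (x - y n) - g x\<bar>)" for n
  proof -
    have "(LINT x|lborel. \<bar>f (x - y n) + g (x - y n) - (f x + g x)\<bar>)
      \<le> (LINT x|lborel. \<bar>f (x - y n) - f x\<bar> + \<bar>g (x - y n) - g x\<bar>)"
      by (rule integral_mono) (simp, simp, linarith)
    then show ?thesis by simp
  qed
  then show "(\<lambda>n. LINT x|lborel. \<bar>f (x - y n) + g (x - y n) - (f x + g x)\<bar>) \<longlonglongrightarrow> 0"
    by (intro Lim_null_comparison[OF always_eventually[OF allI] lim[unfolded add_0_right]])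
qed

text \<open>The positive part of \<^term>\<open>indicator U x - indicator U (x - y)\<close> is dominated by
  \<^term>\<open>indicator U x\<close> and tends to 0 pointwise because \<^term>\<open>U\<close> is open; the negative part has the
  same integral.\<close>
lemma translation_continuous_indicator_open:
  fixes U :: "'a::euclidean_space set"
  assumes U: "open U" "emeasure lborel U < \<infinity>"
  shows "translation_continuous (indicator U)"
  unfolding translation_continuous_def
proof (intro allI impI)
  fix y :: "nat \<Rightarrow> 'a"
  assume y: "y \<longlonglongrightarrow> 0"
  let ?i = "indicator U :: 'a \<Rightarrow> real"
  have [measurable]: "U \<in> sets borel" using U(1) by simp
  have int [simp]: "integrable lborel ?i" using U by (simp add: integrable_indicator_iff)
  note int' [simp] = integrable_lborel_translate[OF int]
  have "(\<lambda>n. LINT x|lborel. max 0 (?i x - ?i (x - y n))) \<longlonglongrightarrow> (LINT x::'a|lborel. (0::real))"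
  proof (rule integral_dominated_convergence[where w = "indicator U"])
    show "AE x in lborel. (\<lambda>n. max 0 (?i x - ?i (x - y n))) \<longlonglongrightarrow> 0"
    proof (rule AE_I2)
      fix x
      have "eventually (\<lambda>n. max 0 (?i x - ?i (x - y n)) = 0) sequentially"
      proof (cases "x \<in> U")
        case True
        have "(\<lambda>n. x - y n) \<longlonglongrightarrow> x - 0" using y by (intro tendsto_intros)
        then have "eventually (\<lambda>n. x - y n \<in> U) sequentially"
          using U(1) True by (simp add: topological_tendstoD)
        then show ?thesis by eventually_elim (simp add: True)
      qed simp
      then show "(\<lambda>n. max 0 (?i x - ?i (x - y n))) \<longlonglongrightarrow> 0" by (rule tendsto_eventually)
    qed
    show "AE x in lborel. norm (max 0 (?i x - ?i (x - y n))) \<le> ?i x" for n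
      by (rule AE_I2) (simp add: indicator_def)
  qed (auto simp: int)
  then have lim: "(\<lambda>n. 2 * (LINT x|lborel. max 0 (?i x - ?i (x - y n)))) \<longlonglongrightarrow> 0"
    by (simp add: tendsto_mult_right_zero)
  have "(LINT x|lborel. \<bar>?i (x - y n) - ?i x\<bar>) = 2 * (LINT x|lborel. max 0 (?i x - ?i (x - y n)))" for n
  proof -
    have m: "integrable lborel (\<lambda>x. max 0 (?i x - ?i (x - y n)))"
      by (intro integrable_max) simp_all
    have "(LINT x|lborel. \<bar>?i (x - y n) - ?i x\<bar>)
        = (LINT x|lborel. 2 * max 0 (?i x - ?i (x - y n)) + (?i (x - y n) - ?i x))"
      by (intro Bochner_Integration.integral_cong refl) (simp add: max_def abs_if)
    also have "\<dots> = 2 * (LINT x|lborel. max 0 (?i x - ?i (x - y n)))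
        + ((LINT x|lborel. ?i (x - y n)) - (LINT x|lborel. ?i x))"
      using m by simp
    also have "(LINT x|lborel. ?i (x - y n)) = (LINT x|lborel. ?i x)"
      by (rule lborel_integral_translate) simp
    finally show ?thesis by simp
  qed
  with lim show "(\<lambda>n. LINT x|lborel. \<bar>?i (x - y n) - ?i x\<bar>) \<longlonglongrightarrow> 0" by simp
qed

text \<open>Outer regularity encloses \<open>A\<close> in an open set exceeding it by measure less
  than \<open>e\<close>, which is an L1 approximation by indicators of open sets.\<close>

lemma translation_continuous_indicator:
  fixes A :: "'a::euclidean_space set"
  assumes A [measurable]: "A \<in> sets borel" and fin: "emeasure lborel A < \<infinity>"
  shows "translation_continuous (indicator A)"
proof (rule translation_continuous_L1_limit)
  show intA: "integrable lborel (indicator A :: 'a \<Rightarrow> real)"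
    using fin by (simp add: integrable_indicator_iff)
  fix e :: real assume e: "e > 0"
  have "A \<in> sets lebesgue" by simp
  from sets_lebesgue_outer_open[OF this e] obtain T where
    T: "open T" "A \<subseteq> T" "emeasure lebesgue (T - A) < ennreal e" by metis
  have [measurable]: "T \<in> sets borel" using T(1) by simp
  have TA: "emeasure lborel (T - A) < ennreal e" using T(3) by simp
  have "emeasure lborel T \<le> emeasure lborel A + emeasure lborel (T - A)"
    using emeasure_subadditive[of A lborel "T - A"] T(2) by (simp add: Un_absorb1)
  also have "\<dots> < \<infinity>"
    using fin TA by (simp add: ennreal_add_less_top less_trans[OF TA])
  finally have finT: "emeasure lborel T < \<infinity>" .
  have "(LINT x|lborel. \<bar>indicator A x - indicator T x\<bar>) = (LINT x|lborel. indicator (T - A) x :: real)"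
    using T(2) by (intro Bochner_Integration.integral_cong refl) (auto simp: indicator_def)
  also have "\<dots> = measure lborel (T - A)" by simp
  also have "\<dots> < e"
  proof -
    have "emeasure lborel (T - A) = ennreal (measure lborel (T - A))"
      using TA by (intro emeasure_eq_ennreal_measure) auto
    with TA e show ?thesis by (simp add: ennreal_less_iff)
  qed
  finally have "(LINT x|lborel. \<bar>indicator A x - indicator T x\<bar>) < e" .
  moreover have "integrable lborel (indicator T :: 'a \<Rightarrow> real)" using finT by (simp add: integrable_indicator_iff)
  moreover have "translation_continuous (indicator T)"
    using T(1) finT by (rule translation_continuous_indicator_open)
  ultimately show "\<exists>g. integrable lborel g \<and> translation_continuous g \<and> (LINT x|lborel. \<bar>indicator A x - g x\<bar>) < e"
    by (intro exI[of _ "indicator T"] conjI)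
qed

lemma integrable_translation_continuous:
  fixes f :: "'a::euclidean_space \<Rightarrow> real"
  assumes "integrable lborel f"
  shows "translation_continuous f"
  using assms
proof (induction rule: integrable_induct)
  case (base A c)
  have "translation_continuous (\<lambda>x. c * indicator A x)"
    using base by (intro translation_continuous_cmult translation_continuous_indicator) auto
  then show ?case by (simp add: mult.commute)
next
  case (add f g)
  then show ?case by (intro translation_continuous_add)
next
  case (lim f s)
  show ?case
  proof (rule translation_continuous_L1_limit[OF lim(4)])
    fix e :: real assume "e > 0"
    have "(\<lambda>i. LINT x|lborel. \<bar>f x - s i x\<bar>) \<longlonglongrightarrow> (LINT x::'a|lborel. (0::real))"
    \<comment> \<open>The induction rule provides approximants with
      \<open>|s i x| <= 2 |f x|\<close>, whence the factor 3.\<close>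
    proof (rule integral_dominated_convergence[where w = "\<lambda>x. 3 * \<bar>f x\<bar>"])
      show "AE x in lborel. (\<lambda>i. \<bar>f x - s i x\<bar>) \<longlonglongrightarrow> 0"
      proof (rule AE_I2)
        fix x :: 'a
        have "(\<lambda>i. \<bar>f x - s i x\<bar>) \<longlonglongrightarrow> \<bar>f x - f x\<bar>" using lim(2)[of x] by (intro tendsto_intros) simp
        then show "(\<lambda>i. \<bar>f x - s i x\<bar>) \<longlonglongrightarrow> 0" by simp
      qed
      show "AE x in lborel. norm \<bar>f x - s i x\<bar> \<le> 3 * \<bar>f x\<bar>" for i
      proof (rule AE_I2)
        fix x :: 'a
        show "norm \<bar>f x - s i x\<bar> \<le> 3 * \<bar>f x\<bar>" using lim(3)[of x i] unfolding real_norm_def space_lborel by simp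
      qed
      show "integrable lborel (\<lambda>x. 3 * \<bar>f x\<bar>)" using lim(4) by simp
      show "(\<lambda>x. \<bar>f x - s i x\<bar>) \<in> borel_measurable lborel" for i
        using lim(1)[of i] lim(4) by (intro borel_measurable_integrable) simp
    qed simp
    from LIMSEQ_D[OF this \<open>e > 0\<close>] obtain i where "norm ((LINT x|lborel. \<bar>f x - s i x\<bar>) - (LINT x::'a|lborel. (0::real))) < e"
      by auto
    then have "(LINT x|lborel. \<bar>f x - s i x\<bar>) < e" by simp
    then show "\<exists>g. integrable lborel g \<and> translation_continuous g \<and> (LINT x|lborel. \<bar>f x - g x\<bar>) < e"
      using lim(1,5) by (intro exI[of _ "s i"] conjI)
  qed
qed

section \<open>Gaussians\<close>

text \<open>Lebesgue measure is the image of the product measure over the coordinates in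
  \<open>Basis\<close>, which reduces the claim to the finite product form of Fubini.\<close>

lemma integral_prod_Basis:
  fixes f :: "'a::euclidean_space \<Rightarrow> real \<Rightarrow> complex"
  assumes f: "\<And>b. b \<in> Basis \<Longrightarrow> integrable lborel (f b)"
  shows "(LINT x|lborel. (\<Prod>b\<in>Basis. f b (x \<bullet> b))) = (\<Prod>b\<in>Basis. LINT x|lborel. f b x)"
proof -
  interpret product_sigma_finite "\<lambda>b::'a. lborel :: real measure" ..
  have [measurable]: "f b \<in> borel_measurable borel" if "b \<in> Basis" for b
    using borel_measurable_integrable[OF f[OF that]] by simp
  have "(LINT x|lborel. (\<Prod>b\<in>Basis. f b (x \<bullet> b)))
      = (LINT x|distr (\<Pi>\<^sub>M b\<in>(Basis::'a set). lborel) borel (\<lambda>g. \<Sum>b\<in>Basis. g b *\<^sub>R b). (\<Prod>b\<in>Basis. f b (x \<bullet> b)))"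
    by (simp only: lborel_eq[symmetric])
  also have "\<dots> = (LINT g|(\<Pi>\<^sub>M b\<in>(Basis::'a set). lborel). (\<Prod>b\<in>Basis. f b ((\<Sum>b\<in>Basis. g b *\<^sub>R b) \<bullet> b)))"
    by (rule integral_distr) measurable
  also have "\<dots> = (LINT g|(\<Pi>\<^sub>M b\<in>(Basis::'a set). lborel). (\<Prod>b\<in>Basis. f b (g b)))"
    by (intro Bochner_Integration.integral_cong prod.cong refl) simp
  also have "\<dots> = (\<Prod>b\<in>Basis. LINT x|lborel. f b x)"
    by (rule product_integral_prod) (use f in auto)
  finally show ?thesis .
qed

definition gaussian :: "'a::euclidean_space \<Rightarrow> real" where
  "gaussian x = exp (- (norm x)\<^sup>2 / 2)"

lemma gaussian_measurable [measurable]: "gaussian \<in> borel_measurable borel"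
  unfolding gaussian_def by measurable

lemma gaussian_pos: "0 < gaussian x"
  by (simp add: gaussian_def)

lemma gaussian_prod: "gaussian x = (\<Prod>b\<in>Basis. exp (- (x \<bullet> b)\<^sup>2 / 2))"
  unfolding gaussian_def norm_eq_sqrt_inner euclidean_inner[of x x]
  by (simp add: exp_sum[symmetric] sum_nonneg sum_divide_distrib sum_negf power2_eq_square)

text \<open>The value is read off from the characteristic function of the standard normal
  distribution after undoing the normalisation \<open>sqrt (2 * pi)\<close>.\<close>

lemma gaussian_fourier_real:
  "integrable lborel (\<lambda>x. complex_of_real (exp (- x\<^sup>2 / 2)) * exp (\<i> * complex_of_real (t * x)))"
  "(LINT x|lborel. complex_of_real (exp (- x\<^sup>2 / 2)) * exp (\<i> * complex_of_real (t * x)))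
    = complex_of_real (sqrt (2 * pi) * exp (- t\<^sup>2 / 2))"
proof -
  have e: "exp (- x\<^sup>2 / 2) = sqrt (2 * pi) * std_normal_density x" for x
    by (simp add: std_normal_density_def)
  have "integrable lborel std_normal_density"
    using integrable_normal_moment[of 1 0 0] by simp
  then have "integrable lborel (\<lambda>x::real. exp (- x\<^sup>2 / 2))"
    unfolding e by simp
  then show int: "integrable lborel (\<lambda>x. complex_of_real (exp (- x\<^sup>2 / 2)) * exp (\<i> * complex_of_real (t * x)))"
    by (rule Bochner_Integration.integrable_bound) (auto simp: norm_mult)
  have "complex_of_real (exp (- t\<^sup>2 / 2)) = (LINT x|density lborel std_normal_density. exp (\<i> * complex_of_real (t * x)))"
    using fun_cong[OF char_std_normal_distribution, of t] by (simp add: char_def)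
  also have "\<dots> = (LINT x|lborel. std_normal_density x *\<^sub>R exp (\<i> * complex_of_real (t * x)))"
    by (rule integral_density) auto
  finally have "complex_of_real (sqrt (2 * pi)) * complex_of_real (exp (- t\<^sup>2 / 2))
      = (LINT x|lborel. complex_of_real (sqrt (2 * pi)) * (std_normal_density x *\<^sub>R exp (\<i> * complex_of_real (t * x))))"
    by (simp only: integral_mult_right_zero)
  also have "\<dots> = (LINT x|lborel. complex_of_real (exp (- x\<^sup>2 / 2)) * exp (\<i> * complex_of_real (t * x)))"
    unfolding e by (intro Bochner_Integration.integral_cong refl) (simp add: scaleR_conv_of_real mult.assoc)
  finally show "(LINT x|lborel. complex_of_real (exp (- x\<^sup>2 / 2)) * exp (\<i> * complex_of_real (t * x)))
    = complex_of_real (sqrt (2 * pi) * exp (- t\<^sup>2 / 2))"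
    by simp
qed

lemma gaussian_integrable: "integrable lborel (gaussian :: 'a::euclidean_space \<Rightarrow> real)"
proof (rule integrableI_bounded)
  have "(\<integral>\<^sup>+x. ennreal (norm (gaussian (x::'a))) \<partial>lborel)
      = (\<integral>\<^sup>+x. (\<Prod>b\<in>Basis. ennreal (exp (- ((x::'a) \<bullet> b)\<^sup>2 / 2))) \<partial>lborel)"
    using gaussian_pos by (intro nn_integral_cong) (simp add: less_imp_le prod_ennreal gaussian_prod prod_nonneg)
  also have "\<dots> = (\<Prod>b\<in>(Basis::'a set). \<integral>\<^sup>+x. ennreal (exp (- x\<^sup>2 / 2)) \<partial>lborel)"
    by (rule nn_integral_lborel_prod) auto
  also have "(\<integral>\<^sup>+x. ennreal (exp (- x\<^sup>2 / 2)) \<partial>lborel) < \<infinity>"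
  proof -
    have "integrable lborel (\<lambda>x. norm (complex_of_real (exp (- x\<^sup>2 / 2)) * exp (\<i> * complex_of_real (0 * x))))"
      by (intro integrable_norm gaussian_fourier_real(1))
    then have "integrable lborel (\<lambda>x::real. exp (- x\<^sup>2 / 2))" by simp
    then show ?thesis by (simp add: integrable_iff_bounded)
  qed
  then have "(\<Prod>b\<in>(Basis::'a set). \<integral>\<^sup>+x. ennreal (exp (- x\<^sup>2 / 2)) \<partial>lborel) < \<infinity>"
    by (simp add: power_less_top_ennreal)
  finally show "(\<integral>\<^sup>+x. ennreal (norm (gaussian (x::'a))) \<partial>lborel) < \<infinity>" .
qed simp

lemma gaussian_fourier:
  fixes \<xi> :: "'a::euclidean_space"
  shows "(LINT x|lborel. complex_of_real (gaussian x) * exp (\<i> * complex_of_real (\<xi> \<bullet> x)))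
    = complex_of_real (sqrt (2 * pi) ^ DIM('a) * gaussian \<xi>)"
proof -
  have "(LINT x|lborel. complex_of_real (gaussian x) * exp (\<i> * complex_of_real (\<xi> \<bullet> x)))
      = (LINT x|lborel. (\<Prod>b\<in>Basis. complex_of_real (exp (- (x \<bullet> b)\<^sup>2 / 2)) * exp (\<i> * complex_of_real ((\<xi> \<bullet> b) * (x \<bullet> b)))))"
  proof (intro Bochner_Integration.integral_cong refl)
    fix x :: 'a
    have "exp (\<i> * complex_of_real (\<xi> \<bullet> x)) = (\<Prod>b\<in>Basis. exp (\<i> * complex_of_real ((\<xi> \<bullet> b) * (x \<bullet> b))))"
      unfolding euclidean_inner[of \<xi> x] of_real_sum sum_distrib_left by (rule exp_sum) simp
    then show "complex_of_real (gaussian x) * exp (\<i> * complex_of_real (\<xi> \<bullet> x))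
      = (\<Prod>b\<in>Basis. complex_of_real (exp (- (x \<bullet> b)\<^sup>2 / 2)) * exp (\<i> * complex_of_real ((\<xi> \<bullet> b) * (x \<bullet> b))))"
      by (simp only: gaussian_prod of_real_prod prod.distrib)
  qed
  also have "\<dots> = (\<Prod>b\<in>Basis. LINT x|lborel. complex_of_real (exp (- x\<^sup>2 / 2)) * exp (\<i> * complex_of_real ((\<xi> \<bullet> b) * x)))"
    by (rule integral_prod_Basis) (rule gaussian_fourier_real(1))
  also have "\<dots> = (\<Prod>b\<in>(Basis::'a set). complex_of_real (sqrt (2 * pi) * exp (- (\<xi> \<bullet> b)\<^sup>2 / 2)))"
    by (simp only: gaussian_fourier_real(2))
  also have "\<dots> = complex_of_real (sqrt (2 * pi) ^ DIM('a) * gaussian \<xi>)"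
    by (simp only: of_real_prod[symmetric] prod.distrib prod_constant gaussian_prod)
  finally show ?thesis .
qed

lemma integral_gaussian: "(LINT x|lborel. gaussian (x::'a::euclidean_space)) = sqrt (2 * pi) ^ DIM('a)"
proof -
  have "complex_of_real (LINT x|lborel. gaussian (x::'a)) = (LINT x|lborel. complex_of_real (gaussian (x::'a)))"
    by (rule integral_complex_of_real[symmetric])
  also have "\<dots> = complex_of_real (sqrt (2 * pi) ^ DIM('a))"
    using gaussian_fourier[of "0::'a"] by (simp add: gaussian_def)
  finally show ?thesis by (simp only: of_real_eq_iff)
qed

section \<open>Continuity of translations in L2\<close>

lemma power2_diff_le_abs_diff_power2:
  fixes a b :: real
  assumes "0 \<le> a" "0 \<le> b"
  shows "(a - b)\<^sup>2 \<le> \<bar>a\<^sup>2 - b\<^sup>2\<bar>"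
proof -
  have "(a - b)\<^sup>2 = \<bar>a - b\<bar> * \<bar>a - b\<bar>" by (simp add: power2_eq_square)
  also have "\<dots> \<le> \<bar>a - b\<bar> * (a + b)" using assms by (intro mult_left_mono) auto
  also have "\<dots> = \<bar>a\<^sup>2 - b\<^sup>2\<bar>" using assms by (simp add: power2_eq_square square_diff_square_factored abs_mult mult.commute)
  finally show ?thesis .
qed

text \<open>For nonnegative reals \<open>(a - b)^2 <= |a^2 - b^2|\<close>, so L1 continuity of
  translation for the square of \<open>p\<close> yields L2 continuity for \<open>p\<close>, with no
  density argument in L2.\<close>

lemma square_integrable_translate_nonneg:
  fixes p :: "'a::euclidean_space \<Rightarrow> real"
  assumes [measurable]: "p \<in> borel_measurable borel" and nonneg: "\<And>x. 0 \<le> p x"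
    and int: "integrable lborel (\<lambda>x. (p x)\<^sup>2)"
  shows "integrable lborel (\<lambda>x. (p (x - y) - p x)\<^sup>2)"
    "z \<longlonglongrightarrow> 0 \<Longrightarrow> (\<lambda>n. LINT x|lborel. (p (x - z n) - p x)\<^sup>2) \<longlonglongrightarrow> 0"
proof -
  have D: "integrable lborel (\<lambda>x. \<bar>(p (x - y))\<^sup>2 - (p x)\<^sup>2\<bar>)" for y
    using integrable_lborel_translate[OF int, of y] int by simp
  show int': "integrable lborel (\<lambda>x. (p (x - y) - p x)\<^sup>2)" for y
  proof (rule Bochner_Integration.integrable_bound[OF D])
    show "AE x in lborel. norm ((p (x - y) - p x)\<^sup>2) \<le> norm \<bar>(p (x - y))\<^sup>2 - (p x)\<^sup>2\<bar>"
      by (rule AE_I2) (simp add: power2_diff_le_abs_diff_power2 nonneg)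
  qed measurable
  assume "z \<longlonglongrightarrow> 0"
  with integrable_translation_continuous[OF int]
  have lim: "(\<lambda>n. LINT x|lborel. \<bar>(p (x - z n))\<^sup>2 - (p x)\<^sup>2\<bar>) \<longlonglongrightarrow> 0"
    unfolding translation_continuous_def by (elim allE impE)
  have "(LINT x|lborel. (p (x - z n) - p x)\<^sup>2) \<le> (LINT x|lborel. \<bar>(p (x - z n))\<^sup>2 - (p x)\<^sup>2\<bar>)" for n
    by (rule integral_mono[OF int' D]) (rule power2_diff_le_abs_diff_power2[OF nonneg nonneg])
  then have "norm (LINT x|lborel. (p (x - z n) - p x)\<^sup>2) \<le> (LINT x|lborel. \<bar>(p (x - z n))\<^sup>2 - (p x)\<^sup>2\<bar>)" for n
    by simp
  then show "(\<lambda>n. LINT x|lborel. (p (x - z n) - p x)\<^sup>2) \<longlonglongrightarrow> 0"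
    by (intro Lim_null_comparison[OF always_eventually[OF allI] lim])
qed

lemma L2_translate: "L2 F \<Longrightarrow> L2 (\<lambda>x. F (x - y))"
  unfolding L2_def
proof (elim conjE, intro conjI)
  assume [measurable]: "F \<in> borel_measurable lborel"
  show "(\<lambda>x. F (x - y)) \<in> borel_measurable lborel" by measurable
  assume "integrable lborel (\<lambda>x. (cmod (F x))\<^sup>2)"
  from integrable_lborel_translate[OF this] show "integrable lborel (\<lambda>x. (cmod (F (x - y)))\<^sup>2)" .
qed

lemma integral_norm_sq_translate:
  assumes F: "L2 F"
  shows "(LINT x|lborel. (cmod (F (x - y)))\<^sup>2) = (LINT x|lborel. (cmod (F x))\<^sup>2)"
  using lborel_integral_translate[of "\<lambda>x. (cmod (F x))\<^sup>2" y] borel_measurable_integrable[OF L2_integrable_sq[OF F]]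
  by simp

text \<open>The comparison of squares needs nonnegative functions, so \<open>F\<close> is split into
  the positive and negative parts of its real and imaginary parts.\<close>

lemma L2_translation_continuous:
  fixes F :: "real^'m::finite \<Rightarrow> complex"
  assumes F: "L2 F" and y: "y \<longlonglongrightarrow> 0"
  shows "(\<lambda>n. LINT x|lborel. (cmod (F (x - y n) - F x))\<^sup>2) \<longlonglongrightarrow> 0"
proof -
  have [measurable]: "F \<in> borel_measurable borel" using F by (rule L2_measurable)
  define p :: "nat \<Rightarrow> complex \<Rightarrow> real" where
    "p k z = (if k = 0 then max 0 (Re z) else if k = 1 then max 0 (- Re z)
      else if k = 2 then max 0 (Im z) else max 0 (- Im z))" for k z
  have p_meas [measurable]: "(\<lambda>x. p k (F x)) \<in> borel_measurable borel" for k
    unfolding p_def by measurable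
  have p_nonneg: "0 \<le> p k z" for k z by (simp add: p_def)
  have p_le: "p k z \<le> cmod z" for k z
    using abs_Re_le_cmod[of z] abs_Im_le_cmod[of z] by (auto simp: p_def)
  have p_int: "integrable lborel (\<lambda>x. (p k (F x))\<^sup>2)" for k
  proof (rule Bochner_Integration.integrable_bound[OF L2_integrable_sq[OF F]])
    show "AE x in lborel. norm ((p k (F x))\<^sup>2) \<le> norm ((cmod (F x))\<^sup>2)"
      by (rule AE_I2) (simp add: p_le p_nonneg power_mono)
  qed measurable
  note tr = square_integrable_translate_nonneg[OF p_meas p_nonneg p_int]
  have sq: "(cmod (w - z))\<^sup>2 \<le> 2 * (\<Sum>k<4. (p k w - p k z)\<^sup>2)" for w z
  proof -
    have 1: "(a - b)\<^sup>2 \<le> 2 * ((max 0 a - max 0 b)\<^sup>2 + (max 0 (-a) - max 0 (-b))\<^sup>2)" for a b :: real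
    proof -
      have "a - b = (max 0 a - max 0 b) - (max 0 (-a) - max 0 (-b))" by (simp add: max_def)
      moreover have "(u - v)\<^sup>2 \<le> 2 * (u\<^sup>2 + v\<^sup>2)" for u v :: real
        using sum_squares_bound[of u "- v"] by (simp add: power2_diff)
      ultimately show ?thesis by metis
    qed
    have "(cmod (w - z))\<^sup>2 = (Re w - Re z)\<^sup>2 + (Im w - Im z)\<^sup>2" by (simp add: cmod_power2)
    also have "\<dots> \<le> 2 * ((max 0 (Re w) - max 0 (Re z))\<^sup>2 + (max 0 (- Re w) - max 0 (- Re z))\<^sup>2)
        + 2 * ((max 0 (Im w) - max 0 (Im z))\<^sup>2 + (max 0 (- Im w) - max 0 (- Im z))\<^sup>2)"
      using 1 by (intro add_mono)
    also have "\<dots> = 2 * (\<Sum>k<4. (p k w - p k z)\<^sup>2)"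
      by (simp add: p_def eval_nat_numeral lessThan_Suc algebra_simps)
    finally show ?thesis .
  qed
  have int: "integrable lborel (\<lambda>x. 2 * (\<Sum>k<4. (p k (F (x - y n)) - p k (F x))\<^sup>2))" for n
    by (intro integrable_mult_right Bochner_Integration.integrable_sum tr(1))
  have lim: "(\<lambda>n. 2 * (\<Sum>k<4. LINT x|lborel. (p k (F (x - y n)) - p k (F x))\<^sup>2)) \<longlonglongrightarrow> 0"
    by (intro tendsto_mult_right_zero tendsto_null_sum tr(2) y)
  have "(LINT x|lborel. (cmod (F (x - y n) - F x))\<^sup>2) \<le> 2 * (\<Sum>k<4. LINT x|lborel. (p k (F (x - y n)) - p k (F x))\<^sup>2)" for n
  proof -
    have "(LINT x|lborel. (cmod (F (x - y n) - F x))\<^sup>2) \<le> (LINT x|lborel. 2 * (\<Sum>k<4. (p k (F (x - y n)) - p k (F x))\<^sup>2))"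
      by (rule integral_mono[OF L2_integrable_sq[OF L2_diff[OF L2_translate[OF F] F]] int]) (rule sq)
    also have "\<dots> = 2 * (\<Sum>k<4. LINT x|lborel. (p k (F (x - y n)) - p k (F x))\<^sup>2)"
      by (simp only: integral_mult_right_zero Bochner_Integration.integral_sum tr(1))
    finally show ?thesis .
  qed
  then have "norm (LINT x|lborel. (cmod (F (x - y n) - F x))\<^sup>2)
      \<le> 2 * (\<Sum>k<4. LINT x|lborel. (p k (F (x - y n)) - p k (F x))\<^sup>2)" for n
    by simp
  then show ?thesis
    by (intro Lim_null_comparison[OF always_eventually[OF allI] lim])
qed

section \<open>Plancherel and Moyal identities\<close>

definition character :: "'a::euclidean_space \<Rightarrow> 'a \<Rightarrow> complex" where
  "character \<omega> x = exp (2 * pi * \<i> * complex_of_real (\<omega> \<bullet> x))"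

definition fourier :: "('a::euclidean_space \<Rightarrow> complex) \<Rightarrow> 'a \<Rightarrow> complex" where
  "fourier F \<omega> = (LINT x|lborel. F x * cnj (character \<omega> x))"

lemma character_measurable [measurable]:
  "(\<lambda>z. character (fst z) (snd z)) \<in> borel_measurable (borel :: ('a::euclidean_space \<times> 'a) measure)"
  unfolding character_def by (intro borel_measurable_continuous_onI continuous_intros)

lemma character_measurable_pair [measurable (raw)]:
  assumes [measurable]: "f \<in> M \<rightarrow>\<^sub>M borel" "g \<in> M \<rightarrow>\<^sub>M borel"
  shows "(\<lambda>z. character (f z) (g z)) \<in> borel_measurable M"
proof -
  have "(\<lambda>z. (f z, g z)) \<in> M \<rightarrow>\<^sub>M borel" by measurable
  from measurable_compose[OF this character_measurable] show ?thesis by simp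
qed

lemma norm_character [simp]: "cmod (character \<omega> x) = 1"
  by (simp add: character_def norm_exp_eq_Re)

lemma character_diff: "character \<omega> (x - y) = character \<omega> x * cnj (character \<omega> y)"
proof -
  have "cnj (character \<omega> y) = exp (- (2 * pi * \<i> * complex_of_real (\<omega> \<bullet> y)))"
    by (simp add: character_def exp_cnj)
  then show ?thesis
    by (simp add: character_def exp_add[symmetric] inner_diff_right algebra_simps)
qed

lemma character_cnj_mult: "cnj (character \<omega> x) * character \<omega> x = 1"
  using complex_norm_square[of "character \<omega> x"] by (simp add: mult.commute)

lemma fourier_measurable [measurable]:
  assumes [measurable]: "F \<in> borel_measurable borel"
  shows "fourier F \<in> borel_measurable borel"
  unfolding fourier_def by measurable

text \<open>The convolution of \<open>F\<close> with its conjugate reflection. Its transform is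
  \<open>|fourier F|^2\<close> and its value at 0 the squared L2 norm, the two sides of Plancherel's
  identity.\<close>

definition autocorrelation :: "('a::euclidean_space \<Rightarrow> complex) \<Rightarrow> 'a \<Rightarrow> complex" where
  "autocorrelation F y = (LINT x|lborel. F x * cnj (F (x - y)))"

lemma integrable_lborel_reflect:
  fixes f :: "'a::euclidean_space \<Rightarrow> complex"
  assumes f: "integrable lborel f"
  shows "integrable lborel (\<lambda>x. f (y - x))"
proof (rule integrableI_bounded)
  have [measurable]: "f \<in> borel_measurable borel" using borel_measurable_integrable[OF f] by simp
  show "(\<lambda>x. f (y - x)) \<in> borel_measurable lborel" by measurable
  have "(\<integral>\<^sup>+x. ennreal (norm (f (y - x))) \<partial>lborel) = (\<integral>\<^sup>+x. ennreal (norm (f x)) \<partial>lborel)"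
    by (rule nn_integral_lborel_reflect[of "\<lambda>x. ennreal (norm (f x))"]) measurable
  then show "(\<integral>\<^sup>+x. ennreal (norm (f (y - x))) \<partial>lborel) < \<infinity>"
    using f by (simp add: integrable_iff_bounded)
qed

text \<open>The unimodular factor \<open>c\<close> serves two applications of Fubini:
  \<open>c = 1\<close> for integrability of the autocorrelation and a conjugate character for its
  transform.\<close>

lemma integrable_autocorrelation_kernel:
  fixes F :: "'a::euclidean_space \<Rightarrow> complex"
  assumes F: "integrable lborel F"
    and [measurable]: "c \<in> borel_measurable borel" and c: "\<And>y. cmod (c y) = 1"
  shows "integrable (lborel \<Otimes>\<^sub>M lborel) (\<lambda>(x, y). c y * (F x * cnj (F (x - y))))"
proof (rule lborel_pair.Fubini_integrable)
  have [measurable]: "F \<in> borel_measurable borel" using borel_measurable_integrable[OF F] by simp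
  show "(\<lambda>(x, y). c y * (F x * cnj (F (x - y)))) \<in> borel_measurable (lborel \<Otimes>\<^sub>M lborel)"
    by measurable
  have "(LINT y|lborel. norm (c y * (F x * cnj (F (x - y))))) = cmod (F x) * (LINT y|lborel. cmod (F y))" for x
  proof -
    have "(LINT y|lborel. norm (c y * (F x * cnj (F (x - y))))) = (LINT y|lborel. cmod (F x) * cmod (F (x - y)))"
      by (simp only: norm_mult c complex_mod_cnj mult_1)
    also have "\<dots> = cmod (F x) * (LINT y|lborel. cmod (F (x - y)))"
      by (rule integral_mult_right_zero)
    also have "(LINT y|lborel. cmod (F (x - y))) = (LINT y|lborel. cmod (F y))"
      by (rule lborel_integral_reflect[of "\<lambda>y. cmod (F y)"]) measurable
    finally show ?thesis .
  qed
  then show "integrable lborel (\<lambda>x. LINT y|lborel. norm (case (x, y) of (x, y) \<Rightarrow> c y * (F x * cnj (F (x - y)))))"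
    using F by simp
  have "integrable lborel (\<lambda>y. c y * (F x * cnj (F (x - y))))" for x
  proof (rule Bochner_Integration.integrable_bound)
    show "integrable lborel (\<lambda>y. F x * F (x - y))"
      by (intro integrable_mult_right integrable_lborel_reflect F)
    show "AE y in lborel. norm (c y * (F x * cnj (F (x - y)))) \<le> norm (F x * F (x - y))"
      by (rule AE_I2) (simp add: norm_mult c)
  qed measurable
  then show "AE x in lborel. integrable lborel (\<lambda>y. case (x, y) of (x, y) \<Rightarrow> c y * (F x * cnj (F (x - y))))"
    by simp
qed

lemma integrable_autocorrelation:
  assumes F: "integrable lborel F"
  shows "integrable lborel (autocorrelation F)"
proof -
  have "integrable (lborel \<Otimes>\<^sub>M lborel) (\<lambda>(x, y). F x * cnj (F (x - y)))"
    using integrable_autocorrelation_kernel[OF F, of "\<lambda>_. 1"] by simp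
  from lborel_pair.integrable_snd[OF this] show ?thesis
    by (simp add: autocorrelation_def[abs_def])
qed

lemma fourier_autocorrelation:
  assumes F: "integrable lborel F"
  shows "(LINT y|lborel. cnj (character \<omega> y) * autocorrelation F y) = of_real ((cmod (fourier F \<omega>))\<^sup>2)"
proof -
  have [measurable]: "F \<in> borel_measurable borel" using borel_measurable_integrable[OF F] by simp
  have ker: "integrable (lborel \<Otimes>\<^sub>M lborel) (\<lambda>(x, y). cnj (character \<omega> y) * (F x * cnj (F (x - y))))"
  proof (rule integrable_autocorrelation_kernel[OF F])
    show "(\<lambda>y. cnj (character \<omega> y)) \<in> borel_measurable borel" by measurable
  qed simp
  have cf: "cnj (fourier F \<omega>) = (LINT y|lborel. cnj (F (x - y)) * character \<omega> (x - y))" for x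
  proof -
    have "cnj (fourier F \<omega>) = (LINT y|lborel. cnj (F y * cnj (character \<omega> y)))"
      unfolding fourier_def by (rule Bochner_Integration.integral_cnj[symmetric])
    also have "\<dots> = (LINT y|lborel. cnj (F y) * character \<omega> y)" by simp
    also have "\<dots> = (LINT y|lborel. cnj (F (x - y)) * character \<omega> (x - y))"
      by (rule lborel_integral_reflect[symmetric, of "\<lambda>y. cnj (F y) * character \<omega> y"]) measurable
    finally show ?thesis .
  qed
  \<comment> \<open>After \<open>y\<close> is replaced by \<open>x - y\<close> in the conjugate
    transform, the characters at \<open>x\<close> cancel and only the one at \<open>y\<close>
    survives.\<close>
  have pt: "F x * cnj (character \<omega> x) * (cnj (F (x - y)) * character \<omega> (x - y))
      = cnj (character \<omega> y) * (F x * cnj (F (x - y)))" for x y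
  proof -
    have "F x * cnj (character \<omega> x) * (cnj (F (x - y)) * character \<omega> (x - y))
      = (cnj (character \<omega> x) * character \<omega> x) * (cnj (character \<omega> y) * (F x * cnj (F (x - y))))"
      by (simp only: character_diff ac_simps)
    then show ?thesis by (simp add: character_cnj_mult)
  qed
  have "of_real ((cmod (fourier F \<omega>))\<^sup>2) = fourier F \<omega> * cnj (fourier F \<omega>)"
    by (rule complex_norm_square)
  also have "\<dots> = (LINT x|lborel. F x * cnj (character \<omega> x) * cnj (fourier F \<omega>))"
    unfolding fourier_def[of F \<omega>] by (rule integral_mult_left_zero[symmetric])
  also have "\<dots> = (LINT x|lborel. LINT y|lborel. cnj (character \<omega> y) * (F x * cnj (F (x - y))))"
  proof (intro Bochner_Integration.integral_cong refl)
    fix x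
    show "F x * cnj (character \<omega> x) * cnj (fourier F \<omega>) = (LINT y|lborel. cnj (character \<omega> y) * (F x * cnj (F (x - y))))"
      unfolding cf[of x] pt[symmetric] by (rule integral_mult_right_zero[symmetric])
  qed
  also have "\<dots> = (LINT y|lborel. LINT x|lborel. cnj (character \<omega> y) * (F x * cnj (F (x - y))))"
    by (rule lborel_pair.Fubini_integral[OF ker, symmetric])
  also have "\<dots> = (LINT y|lborel. cnj (character \<omega> y) * autocorrelation F y)"
    unfolding autocorrelation_def by (intro Bochner_Integration.integral_cong refl integral_mult_right_zero)
  finally show ?thesis ..
qed

text \<open>Substituting \<open>c \<omega>\<close> for the variable brings in the Jacobian
  \<open>c ^ DIM('a)\<close> and divides the frequency \<open>2 pi y\<close> of the character by
  \<open>c\<close>.\<close>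

lemma gaussian_fourier_scaled:
  fixes y :: "'a::euclidean_space"
  assumes "c > 0"
  shows "(LINT \<omega>|lborel. complex_of_real (gaussian (c *\<^sub>R \<omega>)) * cnj (character \<omega> y))
    = complex_of_real ((sqrt (2 * pi) / c) ^ DIM('a) * gaussian ((2 * pi / c) *\<^sub>R y))"
proof -
  define f :: "'a \<Rightarrow> complex" where
    "f w = complex_of_real (gaussian w) * exp (\<i> * complex_of_real ((- (2 * pi / c) *\<^sub>R y) \<bullet> w))" for w
  have [measurable]: "f \<in> borel_measurable borel"
    unfolding f_def gaussian_def by (intro borel_measurable_continuous_onI continuous_intros) auto
  have f: "f (0 + c *\<^sub>R \<omega>) = complex_of_real (gaussian (c *\<^sub>R \<omega>)) * cnj (character \<omega> y)" for \<omega>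
  proof -
    have "cnj (character \<omega> y) = exp (\<i> * complex_of_real ((- (2 * pi / c) *\<^sub>R y) \<bullet> (c *\<^sub>R \<omega>)))"
      using assms by (simp add: character_def exp_cnj inner_commute mult_ac)
    then show ?thesis by (simp add: f_def)
  qed
  have "complex_of_real (sqrt (2 * pi) ^ DIM('a) * gaussian ((2 * pi / c) *\<^sub>R y)) = integral\<^sup>L lborel f"
    unfolding f_def[abs_def] gaussian_fourier by (simp add: gaussian_def)
  also have "\<dots> = \<bar>c\<bar> ^ DIM('a) *\<^sub>R (LINT \<omega>|lborel. f (0 + c *\<^sub>R \<omega>))"
    using assms by (intro lborel_integral_affine) auto
  finally have "complex_of_real (sqrt (2 * pi) ^ DIM('a) * gaussian ((2 * pi / c) *\<^sub>R y))
      = complex_of_real (c ^ DIM('a)) * (LINT \<omega>|lborel. complex_of_real (gaussian (c *\<^sub>R \<omega>)) * cnj (character \<omega> y))"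
    unfolding f using assms by (simp add: scaleR_conv_of_real)
  then show ?thesis using assms by (simp add: field_simps power_divide)
qed

lemma integrable_gaussian_scaled:
  assumes "c > 0"
  shows "integrable lborel (\<lambda>\<omega>::'a::euclidean_space. gaussian (c *\<^sub>R \<omega>))"
proof (rule integrableI_bounded)
  have "(\<integral>\<^sup>+\<omega>. ennreal (norm (gaussian (\<omega>::'a))) \<partial>lborel)
      = ennreal (\<bar>c\<bar> ^ DIM('a)) * (\<integral>\<^sup>+\<omega>. ennreal (norm (gaussian (0 + c *\<^sub>R (\<omega>::'a)))) \<partial>lborel)"
    using assms by (intro nn_integral_lborel_affine) auto
  moreover have "(\<integral>\<^sup>+\<omega>. ennreal (norm (gaussian (\<omega>::'a))) \<partial>lborel) < \<infinity>"
    using gaussian_integrable by (simp add: integrable_iff_bounded)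
  ultimately show "(\<integral>\<^sup>+\<omega>. ennreal (norm (gaussian (c *\<^sub>R (\<omega>::'a)))) \<partial>lborel) < \<infinity>"
    using assms by (auto simp: ennreal_mult_less_top)
qed measurable

text \<open>Fubini moves the transform from the autocorrelation to the Gaussian, which stays
  Gaussian; the substitution \<open>y = c u\<close> then leaves a mean of the dilated
  autocorrelation against a fixed Gaussian.\<close>

lemma gaussian_weighted_fourier:
  fixes F :: "'a::euclidean_space \<Rightarrow> complex"
  assumes F: "integrable lborel F" and c: "c > 0"
  shows "(LINT \<omega>|lborel. complex_of_real (gaussian ((2 * pi * c) *\<^sub>R \<omega>) * (cmod (fourier F \<omega>))\<^sup>2))
    = complex_of_real (1 / sqrt (2 * pi) ^ DIM('a)) * (LINT u|lborel. autocorrelation F (c *\<^sub>R u) * complex_of_real (gaussian u))"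
proof -
  let ?\<Phi> = "autocorrelation F"
  have [measurable]: "F \<in> borel_measurable borel" using borel_measurable_integrable[OF F] by simp
  have \<Phi>: "integrable lborel ?\<Phi>" by (rule integrable_autocorrelation[OF F])
  have [measurable]: "?\<Phi> \<in> borel_measurable borel" using borel_measurable_integrable[OF \<Phi>] by simp
  \<comment> \<open>With this choice the transformed Gaussian has scale
    \<open>2 pi / e = 1 / c\<close>, exactly what the substitution \<open>y = c u\<close>
    removes.\<close>
  define e where "e = 2 * pi * c"
  have e: "e > 0" using c by (simp add: e_def)
  let ?k = "\<lambda>\<omega> y. complex_of_real (gaussian (e *\<^sub>R \<omega>)) * (cnj (character \<omega> y) * ?\<Phi> y)"
  have ker: "integrable (lborel \<Otimes>\<^sub>M lborel) (\<lambda>(\<omega>, y). ?k \<omega> y)"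
  proof (rule lborel_pair.Fubini_integrable)
    show "(\<lambda>(\<omega>, y). ?k \<omega> y) \<in> borel_measurable (lborel \<Otimes>\<^sub>M lborel)"
      by measurable
    have "(LINT y|lborel. norm (?k \<omega> y))
        = gaussian (e *\<^sub>R \<omega>) * (LINT y|lborel. cmod (?\<Phi> y))" for \<omega>
      by (simp add: norm_mult gaussian_pos less_imp_le)
    then show "integrable lborel (\<lambda>\<omega>. LINT y|lborel. norm (case (\<omega>, y) of (\<omega>, y) \<Rightarrow> ?k \<omega> y))"
      by (simp add: integrable_gaussian_scaled[OF e])
    have "integrable lborel (\<lambda>y. ?k \<omega> y)" for \<omega>
    proof (rule Bochner_Integration.integrable_bound)
      show "integrable lborel (\<lambda>y. complex_of_real (gaussian (e *\<^sub>R \<omega>)) * ?\<Phi> y)"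
        by (intro integrable_mult_right \<Phi>)
      show "AE y in lborel. norm (?k \<omega> y) \<le> norm (complex_of_real (gaussian (e *\<^sub>R \<omega>)) * ?\<Phi> y)"
        by (rule AE_I2) (simp add: norm_mult)
    qed measurable
    then show "AE \<omega> in lborel. integrable lborel (\<lambda>y. case (\<omega>, y) of (\<omega>, y) \<Rightarrow> ?k \<omega> y)"
      by simp
  qed
  have "(LINT \<omega>|lborel. complex_of_real (gaussian (e *\<^sub>R \<omega>) * (cmod (fourier F \<omega>))\<^sup>2))
      = (LINT \<omega>|lborel. LINT y|lborel. ?k \<omega> y)"
  proof (intro Bochner_Integration.integral_cong refl)
    fix \<omega>
    show "complex_of_real (gaussian (e *\<^sub>R \<omega>) * (cmod (fourier F \<omega>))\<^sup>2)
        = (LINT y|lborel. ?k \<omega> y)"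
      unfolding of_real_mult fourier_autocorrelation[OF F, symmetric]
      by (rule integral_mult_right_zero[symmetric])
  qed
  also have "\<dots> = (LINT y|lborel. LINT \<omega>|lborel. ?k \<omega> y)"
    by (rule lborel_pair.Fubini_integral[OF ker, symmetric])
  also have "\<dots> = (LINT y|lborel. complex_of_real ((sqrt (2 * pi) / e) ^ DIM('a)) * (?\<Phi> y * complex_of_real (gaussian ((1 / c) *\<^sub>R y))))"
  proof (intro Bochner_Integration.integral_cong refl)
    fix y
    have "(LINT \<omega>|lborel. ?k \<omega> y)
        = (LINT \<omega>|lborel. complex_of_real (gaussian (e *\<^sub>R \<omega>)) * cnj (character \<omega> y)) * ?\<Phi> y"
      unfolding mult.assoc[symmetric] by (rule integral_mult_left_zero)
    also have "\<dots> = complex_of_real ((sqrt (2 * pi) / e) ^ DIM('a) * gaussian ((2 * pi / e) *\<^sub>R y)) * ?\<Phi> y"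
      by (simp only: gaussian_fourier_scaled[OF e])
    also have "2 * pi / e = 1 / c" using c by (simp add: e_def)
    finally show "(LINT \<omega>|lborel. ?k \<omega> y)
        = complex_of_real ((sqrt (2 * pi) / e) ^ DIM('a)) * (?\<Phi> y * complex_of_real (gaussian ((1 / c) *\<^sub>R y)))"
      by (simp only: of_real_mult ac_simps)
  qed
  also have "\<dots> = complex_of_real ((sqrt (2 * pi) / e) ^ DIM('a)) * (LINT y|lborel. ?\<Phi> y * complex_of_real (gaussian ((1 / c) *\<^sub>R y)))"
    by (rule integral_mult_right_zero)
  also have "(LINT y|lborel. ?\<Phi> y * complex_of_real (gaussian ((1 / c) *\<^sub>R y)))
      = \<bar>c\<bar> ^ DIM('a) *\<^sub>R (LINT u|lborel. ?\<Phi> (0 + c *\<^sub>R u) * complex_of_real (gaussian ((1 / c) *\<^sub>R (0 + c *\<^sub>R u))))"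
    using c by (intro lborel_integral_affine) auto
  also have "\<dots> = complex_of_real (c ^ DIM('a)) * (LINT u|lborel. ?\<Phi> (c *\<^sub>R u) * complex_of_real (gaussian u))"
    using c by (simp add: scaleR_conv_of_real)
  also have "complex_of_real ((sqrt (2 * pi) / e) ^ DIM('a)) * (complex_of_real (c ^ DIM('a)) * (LINT u|lborel. ?\<Phi> (c *\<^sub>R u) * complex_of_real (gaussian u)))
      = complex_of_real ((sqrt (2 * pi) / e * c) ^ DIM('a)) * (LINT u|lborel. ?\<Phi> (c *\<^sub>R u) * complex_of_real (gaussian u))"
    by (simp only: power_mult_distrib of_real_mult mult.assoc)
  also have "sqrt (2 * pi) / e * c = 1 / sqrt (2 * pi)"
  proof -
    define s where "s = sqrt (2 * pi)"
    have "s > 0" "e = s * s * c" by (simp_all add: s_def e_def)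
    then show ?thesis using c by (simp add: s_def[symmetric])
  qed
  finally show ?thesis unfolding e_def power_one_over .
qed

lemma L2_cauchy_schwarz:
  assumes "L2 f" "L2 h"
  shows "cmod (l2_inner f h) \<le> sqrt (LINT x|lborel. (cmod (f x))\<^sup>2) * sqrt (LINT x|lborel. (cmod (h x))\<^sup>2)"
  using L2.cauchy_schwarz[of f h] assms
  by (simp add: L2_nsq real_sqrt_mult[symmetric] real_le_rsqrt)

lemma autocorrelation_inner:
  fixes F :: "real^'m::finite \<Rightarrow> complex"
  shows "autocorrelation F y = l2_inner F (\<lambda>x. F (x - y))"
  by (simp add: autocorrelation_def l2_inner_def)

lemma autocorrelation_zero:
  fixes F :: "real^'m::finite \<Rightarrow> complex"
  shows "autocorrelation F 0 = of_real (LINT x|lborel. (cmod (F x))\<^sup>2)"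
  using l2_inner_self[of F] by (simp add: autocorrelation_inner)

lemma norm_autocorrelation_le:
  assumes F: "L2 F"
  shows "cmod (autocorrelation F y) \<le> (LINT x|lborel. (cmod (F x))\<^sup>2)"
  using L2_cauchy_schwarz[OF F L2_translate[OF F], of y]
  by (simp add: autocorrelation_inner integral_norm_sq_translate[OF F] real_sqrt_mult[symmetric])

text \<open>Cauchy-Schwarz bounds the increment by the norm of \<open>F\<close> times the L2
  distance between \<open>F\<close> and its translate.\<close>

lemma autocorrelation_tendsto:
  assumes F: "L2 F" and y: "y \<longlonglongrightarrow> 0"
  shows "(\<lambda>n. autocorrelation F (y n)) \<longlonglongrightarrow> autocorrelation F 0"
proof -
  let ?n = "\<lambda>h. LINT x|lborel. (cmod (h x))\<^sup>2"
  have lim: "(\<lambda>n. sqrt (?n F) * sqrt (?n (\<lambda>x. F (x - y n) - F x))) \<longlonglongrightarrow> 0"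
    by (rule tendsto_mult_right_zero) (use tendsto_real_sqrt[OF L2_translation_continuous[OF F y]] in simp)
  have "autocorrelation F (y n) - autocorrelation F 0 = l2_inner F (\<lambda>x. F (x - y n) - F x)" for n
  proof -
    have "l2_inner F (\<lambda>x. F (x - y n) - F x) = cnj (l2_inner (\<lambda>x. F (x - y n) + (-1) * F x) F)"
      by (subst l2_inner_cnj) simp
    also have "\<dots> = cnj (l2_inner (\<lambda>x. F (x - y n)) F) + (-1) * cnj (l2_inner F F)"
      by (subst l2_inner_lincomb[OF L2_translate[OF F] F F]) simp
    also have "\<dots> = autocorrelation F (y n) - autocorrelation F 0"
      by (simp add: autocorrelation_inner l2_inner_cnj[symmetric])
    finally show ?thesis ..
  qed
  then have "norm (autocorrelation F (y n) - autocorrelation F 0) \<le> sqrt (?n F) * sqrt (?n (\<lambda>x. F (x - y n) - F x))" for n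
    using L2_cauchy_schwarz[OF F L2_diff[OF L2_translate[OF F] F]] by simp
  then have "(\<lambda>n. autocorrelation F (y n) - autocorrelation F 0) \<longlonglongrightarrow> 0"
    by (intro Lim_null_comparison[OF always_eventually[OF allI] lim])
  then show ?thesis by (simp only: LIM_zero_iff)
qed

text \<open>Let \<open>c\<close> tend to 0 in \<open>gaussian_weighted_fourier\<close>. The weights
  increase to 1, so the left side converges monotonically; on the right the autocorrelation is
  continuous at 0 and bounded by its value there, so dominated convergence applies.\<close>

theorem plancherel:
  fixes F :: "real^'m::finite \<Rightarrow> complex"
  assumes F1: "integrable lborel F" and F2: "L2 F"
  shows "(\<integral>\<^sup>+\<omega>. ennreal ((cmod (fourier F \<omega>))\<^sup>2) \<partial>lborel) = ennreal (LINT x|lborel. (cmod (F x))\<^sup>2)"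
proof -
  let ?K = "LINT x|lborel. (cmod (F x))\<^sup>2"
  let ?D = "sqrt (2 * pi) ^ DIM(real^'m)"
  have [measurable]: "F \<in> borel_measurable borel" using F2 by (rule L2_measurable)
  have [measurable]: "autocorrelation F \<in> borel_measurable borel"
    using borel_measurable_integrable[OF integrable_autocorrelation[OF F1]] by simp
  \<comment> \<open>Decreasing scales make the weights increase in \<open>n\<close>, as monotone
    convergence requires; the limit integral is not yet known to be finite.\<close>
  define c where "c n = 1 / real (Suc n)" for n
  have c_pos: "c n > 0" for n by (simp add: c_def)
  have c_lim: "c \<longlonglongrightarrow> 0" unfolding c_def by (intro LIMSEQ_Suc lim_1_over_n)
  define G where "G n \<omega> = gaussian ((2 * pi * c n) *\<^sub>R \<omega>) * (cmod (fourier F \<omega>))\<^sup>2" for n and \<omega> :: "real^'m"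
  have G_meas [measurable]: "G n \<in> borel_measurable borel" for n unfolding G_def by measurable
  have G_nonneg: "0 \<le> G n \<omega>" for n \<omega> by (simp add: G_def gaussian_pos less_imp_le)
  have fb: "cmod (fourier F \<omega>) \<le> (LINT x|lborel. cmod (F x))" for \<omega>
    unfolding fourier_def using integral_norm_bound[of lborel "\<lambda>x. F x * cnj (character \<omega> x)"]
    by (simp add: norm_mult)
  have G_int: "integrable lborel (G n)" for n
  proof (rule Bochner_Integration.integrable_bound)
    show "integrable lborel (\<lambda>\<omega>::real^'m. gaussian ((2 * pi * c n) *\<^sub>R \<omega>) * (LINT x|lborel. cmod (F x))\<^sup>2)"
      by (intro integrable_mult_left integrable_gaussian_scaled) (simp add: c_pos)
    show "AE \<omega> in lborel. norm (G n \<omega>) \<le> norm (gaussian ((2 * pi * c n) *\<^sub>R \<omega>) * (LINT x|lborel. cmod (F x))\<^sup>2)"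
      by (rule AE_I2) (simp add: G_def abs_mult mult_left_mono power_mono fb)
  qed measurable
  have G_eq: "(LINT \<omega>|lborel. G n \<omega>) = Re (complex_of_real (1 / ?D) * (LINT u|lborel. autocorrelation F (c n *\<^sub>R u) * complex_of_real (gaussian u)))" for n
  proof -
    have "complex_of_real (LINT \<omega>|lborel. G n \<omega>) = (LINT \<omega>|lborel. complex_of_real (G n \<omega>))"
      by (rule integral_complex_of_real[symmetric])
    also have "\<dots> = complex_of_real (1 / ?D) * (LINT u|lborel. autocorrelation F (c n *\<^sub>R u) * complex_of_real (gaussian u))"
      unfolding G_def by (rule gaussian_weighted_fourier[OF F1 c_pos])
    finally show ?thesis by (metis Re_complex_of_real)
  qed
  have "(\<lambda>n. LINT u|lborel. autocorrelation F (c n *\<^sub>R u) * complex_of_real (gaussian u))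
      \<longlonglongrightarrow> (LINT u::real^'m|lborel. autocorrelation F 0 * complex_of_real (gaussian u))"
  proof (rule integral_dominated_convergence)
    show "integrable lborel (\<lambda>u::real^'m. ?K * gaussian u)"
      by (intro integrable_mult_right gaussian_integrable)
    show "AE u in lborel. (\<lambda>n. autocorrelation F (c n *\<^sub>R u) * complex_of_real (gaussian u)) \<longlonglongrightarrow> autocorrelation F 0 * complex_of_real (gaussian u)"
    proof (rule AE_I2)
      fix u :: "real^'m"
      have "(\<lambda>n. c n *\<^sub>R u) \<longlonglongrightarrow> 0 *\<^sub>R u" by (intro tendsto_intros c_lim)
      then have "(\<lambda>n. c n *\<^sub>R u) \<longlonglongrightarrow> 0" by simp
      from autocorrelation_tendsto[OF F2 this]
      show "(\<lambda>n. autocorrelation F (c n *\<^sub>R u) * complex_of_real (gaussian u)) \<longlonglongrightarrow> autocorrelation F 0 * complex_of_real (gaussian u)"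
        by (intro tendsto_intros)
    qed
    show "AE u in lborel. norm (autocorrelation F (c n *\<^sub>R u) * complex_of_real (gaussian u)) \<le> ?K * gaussian u" for n
      by (rule AE_I2) (simp add: norm_mult gaussian_pos less_imp_le mult_right_mono norm_autocorrelation_le[OF F2])
  qed measurable
  also have "(LINT u::real^'m|lborel. autocorrelation F 0 * complex_of_real (gaussian u)) = complex_of_real (?K * ?D)"
    unfolding integral_mult_right_zero integral_complex_of_real integral_gaussian autocorrelation_zero
    by (simp only: of_real_mult)
  finally have "(\<lambda>n. Re (complex_of_real (1 / ?D) * (LINT u|lborel. autocorrelation F (c n *\<^sub>R u) * complex_of_real (gaussian u))))
      \<longlonglongrightarrow> Re (complex_of_real (1 / ?D) * complex_of_real (?K * ?D))"
    by (intro tendsto_intros)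
  also have "Re (complex_of_real (1 / ?D) * complex_of_real (?K * ?D)) = ?K"
    unfolding of_real_mult[symmetric] Re_complex_of_real by simp
  finally have "(\<lambda>n. LINT \<omega>|lborel. G n \<omega>) \<longlonglongrightarrow> ?K" unfolding G_eq .
  then have "(\<lambda>n. ennreal (LINT \<omega>|lborel. G n \<omega>)) \<longlonglongrightarrow> ennreal ?K" by (rule tendsto_ennrealI)
  moreover have "(\<lambda>n. ennreal (LINT \<omega>|lborel. G n \<omega>)) \<longlonglongrightarrow> (\<integral>\<^sup>+\<omega>. ennreal ((cmod (fourier F \<omega>))\<^sup>2) \<partial>lborel)"
  proof -
    have "(\<lambda>n. \<integral>\<^sup>+\<omega>. ennreal (G n \<omega>) \<partial>lborel) \<longlonglongrightarrow> (\<integral>\<^sup>+\<omega>. ennreal ((cmod (fourier F \<omega>))\<^sup>2) \<partial>lborel)"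
    proof (rule nn_integral_LIMSEQ)
      show "incseq (\<lambda>n \<omega>. ennreal (G n \<omega>))"
      proof (rule incseq_SucI, rule le_funI, rule ennreal_leI)
        fix n and \<omega> :: "real^'m"
        have "c (Suc n) \<le> c n" by (simp add: c_def field_simps)
        then have "(norm ((2 * pi * c (Suc n)) *\<^sub>R \<omega>))\<^sup>2 \<le> (norm ((2 * pi * c n) *\<^sub>R \<omega>))\<^sup>2"
          using c_pos[of n] c_pos[of "Suc n"] by (intro power_mono) (auto intro!: mult_right_mono mult_left_mono)
        then have "gaussian ((2 * pi * c n) *\<^sub>R \<omega>) \<le> gaussian ((2 * pi * c (Suc n)) *\<^sub>R \<omega>)"
          unfolding gaussian_def by simp
        then show "G n \<omega> \<le> G (Suc n) \<omega>" unfolding G_def by (rule mult_right_mono) simp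
      qed
      show "(\<lambda>n. ennreal (G n \<omega>)) \<longlonglongrightarrow> ennreal ((cmod (fourier F \<omega>))\<^sup>2)" for \<omega> :: "real^'m"
      proof -
        have "(\<lambda>n. G n \<omega>) \<longlonglongrightarrow> exp (- (norm ((2 * pi * 0) *\<^sub>R \<omega>))\<^sup>2 / 2) * (cmod (fourier F \<omega>))\<^sup>2"
          unfolding G_def gaussian_def by (intro tendsto_intros c_lim) simp
        then show ?thesis by (intro tendsto_ennrealI) simp
      qed
    qed measurable
    moreover have "(\<integral>\<^sup>+\<omega>. ennreal (G n \<omega>) \<partial>lborel) = ennreal (LINT \<omega>|lborel. G n \<omega>)" for n
      using G_int by (rule nn_integral_eq_integral) (simp add: G_nonneg)
    ultimately show ?thesis by simp
  qed
  ultimately show ?thesis using LIMSEQ_unique by blast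
qed

text \<open>Since \<open>q f\<close> and \<open>q h\<close> are subtracted, the values at
  \<open>f + h\<close> and \<open>f + i h\<close> already determine real and imaginary part. Applied
  on both sides of Moyal's identity it lifts equality of norms to equality of inner products;
  \<open>1 * h x\<close> keeps the shape of \<open>L2_lincomb\<close>.\<close>

lemma integral_polarization:
  fixes f h :: "'a \<Rightarrow> complex"
  assumes meas [measurable]: "f \<in> borel_measurable M" "h \<in> borel_measurable M"
    and int: "integrable M (\<lambda>x. (cmod (f x))\<^sup>2)" "integrable M (\<lambda>x. (cmod (h x))\<^sup>2)"
  defines "q u \<equiv> LINT x|M. (cmod (u x))\<^sup>2"
  shows "(LINT x|M. f x * cnj (h x))
    = Complex ((q (\<lambda>x. f x + 1 * h x) - q f - q h) / 2) ((q (\<lambda>x. f x + \<i> * h x) - q f - q h) / 2)"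
proof -
  have I: "integrable M (\<lambda>x. f x * cnj (h x))"
    using meas int by (rule integrable_mult_cnj_sq)
  have 1: "(cmod (a + 1 * b))\<^sup>2 = (cmod a)\<^sup>2 + (cmod b)\<^sup>2 + 2 * Re (a * cnj b)" for a b
    unfolding cmod_power2 by (simp add: power2_eq_square algebra_simps)
  have 2: "(cmod (a + \<i> * b))\<^sup>2 = (cmod a)\<^sup>2 + (cmod b)\<^sup>2 + 2 * Im (a * cnj b)" for a b
    unfolding cmod_power2 by (simp add: power2_eq_square algebra_simps)
  have "q (\<lambda>x. f x + 1 * h x) = q f + q h + 2 * Re (LINT x|M. f x * cnj (h x))"
    unfolding q_def 1 integral_Re[OF I, symmetric] using int integrable_Re[OF I]
    by (simp only: Bochner_Integration.integral_add integral_mult_right_zero Bochner_Integration.integrable_add integrable_mult_right)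
  moreover have "q (\<lambda>x. f x + \<i> * h x) = q f + q h + 2 * Im (LINT x|M. f x * cnj (h x))"
    unfolding q_def 2 integral_Im[OF I, symmetric] using int integrable_Im[OF I]
    by (simp only: Bochner_Integration.integral_add integral_mult_right_zero Bochner_Integration.integrable_add integrable_mult_right)
  ultimately show ?thesis by (simp add: complex_eq_iff)
qed

section \<open>Gabor atoms, the short-time Fourier transform and Moyal's identity\<close>

lemma gabor_atom_character:
  "gabor_atom g ph lam x = exp (\<i> * complex_of_real ph) * (character (snd lam) x * g (x - fst lam))"
  by (simp add: gabor_atom_def character_def mult.assoc)

lemma cmod_gabor_atom: "cmod (gabor_atom g ph lam x) = cmod (g (x - fst lam))"
  by (simp add: gabor_atom_character norm_mult)

lemma L2_gabor_atom:
  assumes g: "L2 g"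
  shows "L2 (gabor_atom g ph lam)"
  unfolding L2_def
proof
  have [measurable]: "g \<in> borel_measurable borel" using g by (rule L2_measurable)
  show "gabor_atom g ph lam \<in> borel_measurable lborel"
    unfolding gabor_atom_character[abs_def] by measurable
  show "integrable lborel (\<lambda>x. (cmod (gabor_atom g ph lam x))\<^sup>2)"
    unfolding cmod_gabor_atom by (rule L2_integrable_sq[OF L2_translate[OF g]])
qed

lemma integral_norm_sq_gabor_atom:
  assumes g: "L2 g"
  shows "(LINT x|lborel. (cmod (gabor_atom g ph lam x))\<^sup>2) = (LINT x|lborel. (cmod (g x))\<^sup>2)"
  unfolding cmod_gabor_atom by (rule integral_norm_sq_translate[OF g])

text \<open>Norm 1 makes the constants in Moyal's identity and in the reproducing sum equal to 1.
  Square integrability puts windowed L2 functions into L1, and values in \<open>{0, 1}\<close> keep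
  them in L2.\<close>

definition window :: "real^'m::finite \<Rightarrow> complex" where
  "window = indicator (cbox 0 One)"

lemma window_measurable [measurable]: "window \<in> borel_measurable borel"
  unfolding window_def by measurable

lemma nn_integral_window: "(\<integral>\<^sup>+x. ennreal ((cmod (window (x :: real^'m::finite)))\<^sup>2) \<partial>lborel) = 1"
proof -
  have "(\<integral>\<^sup>+x. ennreal ((cmod (window (x :: real^'m)))\<^sup>2) \<partial>lborel) = (\<integral>\<^sup>+x. indicator (cbox 0 (One :: real^'m)) x \<partial>lborel)"
    by (intro nn_integral_cong) (simp add: window_def indicator_def)
  also have "\<dots> = emeasure lborel (cbox 0 (One :: real^'m))" by simp
  also have "\<dots> = 1" by (subst emeasure_lborel_cbox) (auto simp: inner_sum_left_Basis)
  finally show ?thesis .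
qed

lemma L2_window: "L2 (window :: real^'m::finite \<Rightarrow> complex)"
  by (simp add: L2_iff_nn_integral nn_integral_window)

lemma integral_window: "(LINT x|lborel. (cmod (window (x :: real^'m::finite)))\<^sup>2) = 1"
  using nn_integral_L2[OF L2_window, where 'a = 'm] by (simp add: nn_integral_window)

text \<open>The short-time Fourier transform with the cube window, at the time-frequency point
  \<open>z\<close>.\<close>

definition stft :: "(real^'m::finite \<Rightarrow> complex) \<Rightarrow> 'm tf \<Rightarrow> complex" where
  "stft f z = l2_inner f (gabor_atom window 0 z)"

lemma stft_eq: "stft f z = (LINT x|lborel. f x * cnj (character (snd z) x * window (x - fst z)))"
  by (simp add: stft_def l2_inner_def gabor_atom_character)

lemma stft_fourier: "stft f z = fourier (\<lambda>x. f x * cnj (window (x - fst z))) (snd z)"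
  unfolding stft_eq fourier_def by (intro Bochner_Integration.integral_cong refl) simp

lemma stft_measurable:
  assumes "L2 f"
  shows "stft f \<in> borel_measurable borel"
proof -
  have [measurable]: "f \<in> borel_measurable borel" using assms by (rule L2_measurable)
  have "stft f \<in> borel_measurable (borel \<Otimes>\<^sub>M borel)"
    unfolding stft_eq[abs_def] by measurable
  then show ?thesis by (simp only: borel_prod)
qed

lemma stft_lincomb: "L2 f \<Longrightarrow> L2 h \<Longrightarrow> stft (\<lambda>x. f x + c * h x) z = stft f z + c * stft h z"
  unfolding stft_def by (intro l2_inner_lincomb L2_gabor_atom L2_window)

text \<open>For a fixed time the transform is an ordinary Fourier transform in frequency, so
  Plancherel applies to each slice; Tonelli then integrates the translated windows over time to the
  constant 1.\<close>

lemma moyal_nn_integral: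
  fixes f :: "real^'m::finite \<Rightarrow> complex"
  assumes f: "L2 f"
  shows "(\<integral>\<^sup>+z. ennreal ((cmod (stft f z))\<^sup>2) \<partial>lborel) = ennreal (LINT x|lborel. (cmod (f x))\<^sup>2)"
proof -
  have [measurable]: "f \<in> borel_measurable borel" using f by (rule L2_measurable)
  have slice: "(\<integral>\<^sup>+\<omega>. ennreal ((cmod (stft f (t, \<omega>)))\<^sup>2) \<partial>lborel)
      = (\<integral>\<^sup>+x. ennreal ((cmod (f x))\<^sup>2) * ennreal ((cmod (window (x - t)))\<^sup>2) \<partial>lborel)" for t
  proof -
    define F where "F x = f x * cnj (window (x - t))" for x
    have F1: "integrable lborel F"
      unfolding F_def by (rule L2_integrable_mult[OF f L2_translate[OF L2_window]])
    have F2: "L2 F"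
      unfolding L2_def
    proof
      have [measurable]: "F \<in> borel_measurable borel" unfolding F_def by measurable
      show "F \<in> borel_measurable lborel" by measurable
      show "integrable lborel (\<lambda>x. (cmod (F x))\<^sup>2)"
      proof (rule Bochner_Integration.integrable_bound[OF L2_integrable_sq[OF f]])
        show "AE x in lborel. norm ((cmod (F x))\<^sup>2) \<le> norm ((cmod (f x))\<^sup>2)"
          by (rule AE_I2) (simp add: F_def window_def indicator_def)
      qed measurable
    qed
    have "(\<integral>\<^sup>+\<omega>. ennreal ((cmod (stft f (t, \<omega>)))\<^sup>2) \<partial>lborel) = ennreal (LINT x|lborel. (cmod (F x))\<^sup>2)"
      unfolding stft_fourier fst_conv snd_conv F_def[abs_def, symmetric] by (rule plancherel[OF F1 F2])
    also have "\<dots> = (\<integral>\<^sup>+x. ennreal ((cmod (F x))\<^sup>2) \<partial>lborel)"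
      by (rule nn_integral_L2[OF F2, symmetric])
    also have "\<dots> = (\<integral>\<^sup>+x. ennreal ((cmod (f x))\<^sup>2) * ennreal ((cmod (window (x - t)))\<^sup>2) \<partial>lborel)"
      by (simp only: F_def norm_mult complex_mod_cnj power_mult_distrib ennreal_mult zero_le_power2)
    finally show ?thesis .
  qed
  have m: "(\<lambda>z. ennreal ((cmod (stft f z))\<^sup>2)) \<in> borel_measurable (lborel \<Otimes>\<^sub>M lborel)"
  proof -
    have "(\<lambda>w. ennreal ((cmod w)\<^sup>2)) \<in> borel_measurable borel" by measurable
    from measurable_compose[OF stft_measurable[OF f] this] show ?thesis
      unfolding lborel_prod measurable_lborel2 .
  qed
  have "(\<integral>\<^sup>+z. ennreal ((cmod (stft f z))\<^sup>2) \<partial>lborel)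
      = (\<integral>\<^sup>+z. ennreal ((cmod (stft f z))\<^sup>2) \<partial>(lborel \<Otimes>\<^sub>M lborel))"
    unfolding lborel_prod ..
  also have "\<dots> = (\<integral>\<^sup>+t. \<integral>\<^sup>+\<omega>. ennreal ((cmod (stft f (t, \<omega>)))\<^sup>2) \<partial>lborel \<partial>lborel)"
    by (rule lborel.nn_integral_fst[OF m, symmetric])
  also have "\<dots> = (\<integral>\<^sup>+t. \<integral>\<^sup>+x. ennreal ((cmod (f x))\<^sup>2) * ennreal ((cmod (window (x - t)))\<^sup>2) \<partial>lborel \<partial>lborel)"
    by (simp only: slice)
  also have "\<dots> = (\<integral>\<^sup>+x. \<integral>\<^sup>+t. ennreal ((cmod (f x))\<^sup>2) * ennreal ((cmod (window (x - t)))\<^sup>2) \<partial>lborel \<partial>lborel)"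
    by (rule lborel_pair.Fubini') measurable
  also have "\<dots> = (\<integral>\<^sup>+x. ennreal ((cmod (f x))\<^sup>2) \<partial>lborel)"
  proof (rule nn_integral_cong)
    fix x
    have "(\<integral>\<^sup>+t. ennreal ((cmod (f x))\<^sup>2) * ennreal ((cmod (window (x - t)))\<^sup>2) \<partial>lborel)
        = ennreal ((cmod (f x))\<^sup>2) * (\<integral>\<^sup>+t. ennreal ((cmod (window (x - t)))\<^sup>2) \<partial>lborel)"
      by (rule nn_integral_cmult) measurable
    also have "(\<integral>\<^sup>+t. ennreal ((cmod (window (x - t)))\<^sup>2) \<partial>lborel) = (\<integral>\<^sup>+t. ennreal ((cmod (window (t::real^'m)))\<^sup>2) \<partial>lborel)"
      by (rule nn_integral_lborel_reflect[of "\<lambda>t::real^'m. ennreal ((cmod (window t))\<^sup>2)"]) measurable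
    also have "\<dots> = 1" by (rule nn_integral_window)
    finally show "(\<integral>\<^sup>+t. ennreal ((cmod (f x))\<^sup>2) * ennreal ((cmod (window (x - t)))\<^sup>2) \<partial>lborel) = ennreal ((cmod (f x))\<^sup>2)"
      by simp
  qed
  also have "\<dots> = ennreal (LINT x|lborel. (cmod (f x))\<^sup>2)" by (rule nn_integral_L2[OF f])
  finally show ?thesis .
qed

lemma moyal_norm:
  assumes f: "L2 f"
  shows "integrable lborel (\<lambda>z. (cmod (stft f z))\<^sup>2)"
    "(LINT z|lborel. (cmod (stft f z))\<^sup>2) = (LINT x|lborel. (cmod (f x))\<^sup>2)"
proof -
  note [measurable] = stft_measurable[OF f]
  show int: "integrable lborel (\<lambda>z. (cmod (stft f z))\<^sup>2)"
    using moyal_nn_integral[OF f] by (simp add: integrable_iff_bounded)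
  have "ennreal (LINT z|lborel. (cmod (stft f z))\<^sup>2) = ennreal (LINT x|lborel. (cmod (f x))\<^sup>2)"
    using moyal_nn_integral[OF f] nn_integral_eq_integral[OF int] by simp
  then show "(LINT z|lborel. (cmod (stft f z))\<^sup>2) = (LINT x|lborel. (cmod (f x))\<^sup>2)"
    by (subst (asm) ennreal_inj) simp_all
qed

lemma moyal:
  assumes f: "L2 f" and h: "L2 h"
  shows "(LINT z|lborel. stft f z * cnj (stft h z)) = l2_inner f h"
proof -
  note lc = stft_lincomb[OF f h, symmetric]
  have "(LINT z|lborel. stft f z * cnj (stft h z)) = Complex
      (((LINT z|lborel. (cmod (stft (\<lambda>x. f x + 1 * h x) z))\<^sup>2) - (LINT z|lborel. (cmod (stft f z))\<^sup>2) - (LINT z|lborel. (cmod (stft h z))\<^sup>2)) / 2)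
      (((LINT z|lborel. (cmod (stft (\<lambda>x. f x + \<i> * h x) z))\<^sup>2) - (LINT z|lborel. (cmod (stft f z))\<^sup>2) - (LINT z|lborel. (cmod (stft h z))\<^sup>2)) / 2)"
    unfolding stft_lincomb[OF f h]
    by (rule integral_polarization) (use f h in \<open>simp_all add: stft_measurable moyal_norm(1)\<close>)
  also have "\<dots> = l2_inner f h"
    unfolding moyal_norm(2)[OF L2_lincomb[OF f h]] moyal_norm(2)[OF f] moyal_norm(2)[OF h] l2_inner_def
    by (rule integral_polarization[symmetric])
       (use f h in \<open>simp_all add: L2_measurable L2_integrable_sq\<close>)
  finally show ?thesis .
qed

text \<open>Moving the variable by \<open>fst lam\<close> shifts the transform by \<open>lam\<close>
  up to the unimodular factor \<open>?u\<close>; taking moduli discards that factor, the arbitrary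
  phase \<open>ph\<close> included.\<close>

lemma stft_gabor_atom:
  assumes g: "L2 g"
  shows "cmod (stft (gabor_atom g ph lam) z) = cmod (stft g (z - lam))"
proof -
  have [measurable]: "g \<in> borel_measurable borel" using g by (rule L2_measurable)
  let ?t = "fst lam" and ?w = "snd lam"
  let ?u = "exp (\<i> * complex_of_real ph) * (character ?w ?t * cnj (character (snd z) ?t))"
  have shift: "character \<omega> (x + t) = character \<omega> x * character \<omega> t" for \<omega> x t :: "real^'a"
    by (simp add: character_def inner_add_right exp_add[symmetric] algebra_simps)
  have sub: "character (snd z - ?w) x = character (snd z) x * cnj (character ?w x)" for x
    by (simp add: character_def exp_cnj inner_diff_left exp_add[symmetric] algebra_simps)
  have pt: "gabor_atom g ph lam (x + ?t) * cnj (character (snd z) (x + ?t) * window (x + ?t - fst z))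
      = ?u * (g x * cnj (character (snd (z - lam)) x * window (x - fst (z - lam))))" for x
    unfolding gabor_atom_character by (simp add: shift sub) (simp add: algebra_simps)
  have "stft (gabor_atom g ph lam) z
      = (LINT x|lborel. gabor_atom g ph lam (x + ?t) * cnj (character (snd z) (x + ?t) * window (x + ?t - fst z)))"
  proof -
    define Q where "Q x = gabor_atom g ph lam x * cnj (character (snd z) x * window (x - fst z))" for x
    have [measurable]: "gabor_atom g ph lam \<in> borel_measurable borel"
      using g by (intro L2_measurable L2_gabor_atom)
    have "Q \<in> borel_measurable borel" unfolding Q_def by measurable
    from lborel_integral_translate[OF this, of "- ?t"] show ?thesis
      unfolding stft_eq Q_def[symmetric] diff_minus_eq_add ..
  qed
  also have "\<dots> = ?u * stft g (z - lam)"
    unfolding pt stft_eq by (rule integral_mult_right_zero)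
  finally show ?thesis by (simp add: norm_mult)
qed

section \<open>Comparison of a dual pair with the continuous Gabor system\<close>

text \<open>The bound lives in \<open>ennreal\<close>, where it remains meaningful if the right side
  is infinite and can be integrated in a parameter afterwards.\<close>

lemma norm_has_sum_le_nn_integral:
  fixes f :: "'i \<Rightarrow> complex"
  assumes "(f has_sum a) A"
  shows "ennreal (norm a) \<le> (\<integral>\<^sup>+j. ennreal (norm (f j)) \<partial>count_space A)"
proof (rule tendsto_upperbound)
  show "((\<lambda>F. ennreal (norm (sum f F))) \<longlongrightarrow> ennreal (norm a)) (finite_subsets_at_top A)"
    using assms unfolding has_sum_def by (intro tendsto_ennrealI tendsto_norm)
  show "\<forall>\<^sub>F F in finite_subsets_at_top A. ennreal (norm (sum f F)) \<le> (\<integral>\<^sup>+j. ennreal (norm (f j)) \<partial>count_space A)"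
  proof (rule eventually_finite_subsets_at_top_weakI)
    fix F assume F: "finite F" "F \<subseteq> A"
    have "ennreal (norm (sum f F)) \<le> ennreal (\<Sum>j\<in>F. norm (f j))"
      by (intro ennreal_leI norm_sum)
    also have "\<dots> = (\<Sum>j\<in>F. ennreal (norm (f j)) * indicator F j)"
      by (simp add: sum_ennreal)
    also have "\<dots> = (\<integral>\<^sup>+j. ennreal (norm (f j)) * indicator F j \<partial>count_space A)"
      using F by (intro nn_integral_count_space'[symmetric]) auto
    also have "\<dots> \<le> (\<integral>\<^sup>+j. ennreal (norm (f j)) \<partial>count_space A)"
      by (intro nn_integral_mono) (auto simp: indicator_def)
    finally show "ennreal (norm (sum f F)) \<le> (\<integral>\<^sup>+j. ennreal (norm (f j)) \<partial>count_space A)" .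
  qed
qed simp

text \<open>In the intended instance \<open>H j\<close> and \<open>U j\<close> are the transforms of
  a Gabor vector and of its dual, \<open>v\<close> is the squared modulus of the generator's
  transform, and \<open>p\<close> is the norm whose balls are the parallelepipeds. Only
  \<open>H\<close> is tied to the points \<open>lam j\<close>; \<open>U\<close> has no localisation,
  just its Bessel and norm bounds.\<close>

locale localized_dual_system =
  fixes J :: "'i set" and lam :: "'i \<Rightarrow> 'z::euclidean_space"
    and H U :: "'i \<Rightarrow> 'z \<Rightarrow> complex" and v :: "'z \<Rightarrow> real"
    and p :: "'z \<Rightarrow> real" and c :: 'z
    and B B' C \<kappa> :: real and D :: nat
  assumes J_countable: "countable J"
    and H_measurable: "j \<in> J \<Longrightarrow> H j \<in> borel_measurable borel"
    and U_measurable: "j \<in> J \<Longrightarrow> U j \<in> borel_measurable borel"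
    and v_integrable: "integrable lborel v"
    and v_nonneg: "0 \<le> v z"
    and H_translate: "j \<in> J \<Longrightarrow> (cmod (H j z))\<^sup>2 = v (z - lam j)"
    and H_bessel: "(\<integral>\<^sup>+j. ennreal ((cmod (H j z))\<^sup>2) \<partial>count_space J) \<le> ennreal B"
    and U_bessel: "(\<integral>\<^sup>+j. ennreal ((cmod (U j z))\<^sup>2) \<partial>count_space J) \<le> ennreal B'"
    and U_norm: "j \<in> J \<Longrightarrow> (\<integral>\<^sup>+z. ennreal ((cmod (U j z))\<^sup>2) \<partial>lborel) \<le> ennreal C"
    and reproducing: "((\<lambda>j. H j z * cnj (U j z)) has_sum 1) J"
    and B_nonneg: "0 \<le> B" "0 \<le> B'" "0 \<le> C"
    and p_measurable [measurable]: "p \<in> borel_measurable borel"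
    and p_nonneg: "0 \<le> p x"
    and p_triangle: "p (x + y) \<le> p x + p y"
    and p_minus: "p (- x) = p x"
    and p_volume: "0 \<le> t \<Longrightarrow> emeasure lborel {x. p x \<le> t} = ennreal (\<kappa> * t ^ D)"
    and \<kappa>_pos: "0 < \<kappa>" and D_pos: "0 < D"
begin

text \<open>Indices are counted, hence repeated points with multiplicity; the value is in
  \<open>ennreal\<close> because finiteness is established only later.\<close>

definition cnt :: "'z set \<Rightarrow> ennreal" where
  "cnt A = emeasure (count_space J) {j \<in> J. lam j \<in> A}"

lemma v_measurable [measurable]: "v \<in> borel_measurable borel"
  using borel_measurable_integrable[OF v_integrable] by simp

lemma p_ge: "p x - p k \<le> p (x + k)"
  using p_triangle[of "x + k" "- k"] by (simp add: p_minus)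

text \<open>Replacing \<open>z\<close> by \<open>w + lam j\<close> makes the profile independent of
  \<open>j\<close>, so the inner sum becomes a number of indices for each displacement
  \<open>w\<close>.\<close>

lemma tonelli_count:
  assumes R: "\<And>j. j \<in> J \<Longrightarrow> {z. R j z} \<in> sets borel"
  shows "(\<integral>\<^sup>+z. (\<integral>\<^sup>+j. indicator {z. R j z} z * ennreal (v (z - lam j)) \<partial>count_space J) \<partial>lborel)
    = (\<integral>\<^sup>+w. ennreal (v w) * emeasure (count_space J) {j \<in> J. R j (w + lam j)} \<partial>lborel)"
proof -
  have meas: "(\<lambda>z. indicator {z. R j z} z * ennreal (v (z - lam j))) \<in> borel_measurable borel"
    "(\<lambda>w. indicator {z. R j z} (w + lam j) * ennreal (v w)) \<in> borel_measurable borel" if "j \<in> J" for j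
  proof -
    note [measurable] = R[OF that]
    show "(\<lambda>z. indicator {z. R j z} z * ennreal (v (z - lam j))) \<in> borel_measurable borel" by measurable
    show "(\<lambda>w. indicator {z. R j z} (w + lam j) * ennreal (v w)) \<in> borel_measurable borel" by measurable
  qed
  have "(\<integral>\<^sup>+z. (\<integral>\<^sup>+j. indicator {z. R j z} z * ennreal (v (z - lam j)) \<partial>count_space J) \<partial>lborel)
      = (\<integral>\<^sup>+j. (\<integral>\<^sup>+z. indicator {z. R j z} z * ennreal (v (z - lam j)) \<partial>lborel) \<partial>count_space J)"
    using meas(1) by (intro nn_integral_count_space_nn_integral J_countable) simp
  also have "\<dots> = (\<integral>\<^sup>+j. (\<integral>\<^sup>+w. indicator {z. R j z} (w + lam j) * ennreal (v w) \<partial>lborel) \<partial>count_space J)"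
  proof (rule nn_integral_cong)
    fix j assume "j \<in> space (count_space J)"
    then have "j \<in> J" by simp
    from nn_integral_lborel_translate[OF meas(1)[OF this], of "- lam j"]
    show "(\<integral>\<^sup>+z. indicator {z. R j z} z * ennreal (v (z - lam j)) \<partial>lborel)
        = (\<integral>\<^sup>+w. indicator {z. R j z} (w + lam j) * ennreal (v w) \<partial>lborel)"
      by simp
  qed
  also have "\<dots> = (\<integral>\<^sup>+w. (\<integral>\<^sup>+j. indicator {z. R j z} (w + lam j) * ennreal (v w) \<partial>count_space J) \<partial>lborel)"
    using meas(2) by (intro nn_integral_count_space_nn_integral[symmetric] J_countable) simp
  also have "\<dots> = (\<integral>\<^sup>+w. ennreal (v w) * emeasure (count_space J) {j \<in> J. R j (w + lam j)} \<partial>lborel)"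
  proof (intro nn_integral_cong)
    fix w
    have "(\<integral>\<^sup>+j. indicator {z. R j z} (w + lam j) * ennreal (v w) \<partial>count_space J)
        = (\<integral>\<^sup>+j. ennreal (v w) * indicator {j \<in> J. R j (w + lam j)} j \<partial>count_space J)"
      by (intro nn_integral_cong) (auto simp: indicator_def)
    also have "\<dots> = ennreal (v w) * emeasure (count_space J) {j \<in> J. R j (w + lam j)}"
      by (rule nn_integral_cmult_indicator) auto
    finally show "(\<integral>\<^sup>+j. indicator {z. R j z} (w + lam j) * ennreal (v w) \<partial>count_space J)
        = ennreal (v w) * emeasure (count_space J) {j \<in> J. R j (w + lam j)}" .
  qed
  finally show ?thesis .
qed

text \<open>Otherwise \<open>v\<close>, and with it every \<open>H j\<close>, vanishes almost
  everywhere. As \<open>J\<close> is countable, the reproducing sum would then be 0 instead of 1 at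
  almost every \<open>z\<close>.\<close>

lemma v_mass_in_some_ball: "\<exists>\<rho>\<ge>0. 0 < (\<integral>\<^sup>+w. indicator {w. p w \<le> \<rho>} w * ennreal (v w) \<partial>lborel)"
proof (rule ccontr)
  assume "\<not> (\<exists>\<rho>\<ge>0. 0 < (\<integral>\<^sup>+w. indicator {w. p w \<le> \<rho>} w * ennreal (v w) \<partial>lborel))"
  then have zero: "(\<integral>\<^sup>+w. indicator {w. p w \<le> \<rho>} w * ennreal (v w) \<partial>lborel) = 0" if "\<rho> \<ge> 0" for \<rho>
    using that by (metis not_gr_zero)
  have "AE w in lborel. indicator {w. p w \<le> real n} w * ennreal (v w) = 0" for n :: nat
    using zero[OF of_nat_0_le_iff[of n]] by (subst (asm) nn_integral_0_iff_AE) auto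
  then have "AE w in lborel. \<forall>n::nat. indicator {w. p w \<le> real n} w * ennreal (v w) = 0"
    unfolding AE_all_countable by (rule allI)
  then have "AE w in lborel. ennreal (v w) = 0"
  proof (rule eventually_mono)
    fix w assume *: "\<forall>n::nat. indicator {w. p w \<le> real n} w * ennreal (v w) = 0"
    obtain n :: nat where "p w \<le> real n" using real_arch_simple by blast
    with *[rule_format, of n] show "ennreal (v w) = 0" by simp
  qed
  then have v0: "(\<integral>\<^sup>+w. ennreal (v w) \<partial>lborel) = 0"
    by (subst nn_integral_0_iff_AE) auto
  have "AE z in lborel. H j z = 0" if "j \<in> J" for j
  proof -
    have "(\<integral>\<^sup>+z. ennreal (v (z - lam j)) \<partial>lborel) = 0"
      using nn_integral_lborel_translate[of "\<lambda>w. ennreal (v w)" "lam j"] v0 by simp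
    then have "AE z in lborel. ennreal (v (z - lam j)) = 0"
      by (subst (asm) nn_integral_0_iff_AE) auto
    then show ?thesis
    proof (rule eventually_mono)
      fix z assume "ennreal (v (z - lam j)) = 0"
      then have "(cmod (H j z))\<^sup>2 = 0" using v_nonneg[of "z - lam j"] H_translate[OF that, of z] by (simp add: ennreal_eq_0_iff)
      then show "H j z = 0" by simp
    qed
  qed
  then have "AE z in lborel. \<forall>j\<in>J. H j z = 0"
    by (simp add: AE_ball_countable[OF J_countable])
  then have "AE z::'z in lborel. False"
  proof (rule eventually_mono)
    fix z assume "\<forall>j\<in>J. H j z = 0"
    then have "((\<lambda>j. H j z * cnj (U j z)) has_sum 0) J"
      by (intro has_sum_0) simp
    with reproducing[of z] have "(1::complex) = 0" by (rule has_sum_unique)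
    then show False by simp
  qed
  then have "emeasure lborel (UNIV :: 'z set) = 0"
    by (simp add: eventually_False trivial_limit_def[symmetric] ae_filter_eq_bot_iff)
  then show False by simp
qed

text \<open>Integrate the Bessel bound over a neighbourhood of \<^term>\<open>A\<close>.\<close>
lemma count_bound:
  "\<exists>\<rho>\<ge>0. \<exists>q\<ge>0. \<forall>A A' a. A' \<in> sets borel \<longrightarrow> emeasure lborel A' \<le> ennreal a \<longrightarrow> 0 \<le> a \<longrightarrow>
     (\<forall>x k. x \<in> A \<longrightarrow> p k \<le> \<rho> \<longrightarrow> x + k \<in> A') \<longrightarrow> cnt A \<le> ennreal (q * a)"
proof -
  obtain \<rho> where \<rho>: "\<rho> \<ge> 0" "0 < (\<integral>\<^sup>+w. indicator {w. p w \<le> \<rho>} w * ennreal (v w) \<partial>lborel)"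
    using v_mass_in_some_ball by (elim exE conjE)
  define m where "m = (\<integral>\<^sup>+w. indicator {w. p w \<le> \<rho>} w * ennreal (v w) \<partial>lborel)"
  have "m \<le> (\<integral>\<^sup>+w. ennreal (v w) \<partial>lborel)"
    unfolding m_def by (intro nn_integral_mono) (auto simp: indicator_def)
  also have "\<dots> < \<infinity>"
    using v_integrable v_nonneg by (simp add: integrable_iff_bounded)
  finally have m_fin: "m < \<infinity>" .
  define m' where "m' = enn2real m"
  have m': "m = ennreal m'" "m' > 0"
    using m_fin \<rho>(2) by (simp_all add: m'_def m_def[symmetric] ennreal_enn2real enn2real_positive_iff)
  have "cnt A \<le> ennreal (B / m' * a)"
    if A': "A' \<in> sets borel" "emeasure lborel A' \<le> ennreal a" "0 \<le> a"
      and cover: "\<And>x k. x \<in> A \<Longrightarrow> p k \<le> \<rho> \<Longrightarrow> x + k \<in> A'" for A A' a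
  proof -
    note [measurable] = A'(1)
    let ?W = "\<lambda>j. \<integral>\<^sup>+w. indicator A' (w + lam j) * ennreal (v w) \<partial>lborel"
    let ?Z = "\<lambda>j. \<integral>\<^sup>+z. indicator A' z * ennreal (v (z - lam j)) \<partial>lborel"
    \<comment> \<open>Every index with \<open>lam j\<close> in \<open>A\<close> finds the ball of
      mass \<open>m\<close> around its point inside \<open>A'\<close>, while at each
      \<open>z\<close> the Bessel bound caps the total by \<open>B\<close>; hence the constant
      \<open>B / m'\<close>.\<close>
    have "cnt A * m = (\<integral>\<^sup>+j. m * indicator {j \<in> J. lam j \<in> A} j \<partial>count_space J)"
      unfolding cnt_def by (subst nn_integral_cmult_indicator) (auto simp: mult.commute)
    also have "\<dots> \<le> (\<integral>\<^sup>+j. ?W j \<partial>count_space J)"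
    proof (intro nn_integral_mono)
      fix j
      show "m * indicator {j \<in> J. lam j \<in> A} j \<le> ?W j"
      proof (cases "j \<in> J \<and> lam j \<in> A")
        case True
        then have "m \<le> ?W j"
          unfolding m_def using cover[of "lam j"]
          by (intro nn_integral_mono) (auto simp: indicator_def add.commute)
        with True show ?thesis by simp
      qed auto
    qed
    also have "\<dots> = (\<integral>\<^sup>+j. ?Z j \<partial>count_space J)"
    proof (rule nn_integral_cong)
      fix j
      show "?W j = ?Z j"
        using nn_integral_lborel_translate[of "\<lambda>z. indicator A' z * ennreal (v (z - lam j))" "- lam j"] by simp
    qed
    also have "\<dots> = (\<integral>\<^sup>+z. (\<integral>\<^sup>+j. indicator A' z * ennreal (v (z - lam j)) \<partial>count_space J) \<partial>lborel)"
      by (intro nn_integral_count_space_nn_integral[symmetric] J_countable) measurable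
    also have "\<dots> \<le> (\<integral>\<^sup>+z. ennreal B * indicator A' z \<partial>lborel)"
    proof (intro nn_integral_mono)
      fix z
      have "(\<integral>\<^sup>+j. indicator A' z * ennreal (v (z - lam j)) \<partial>count_space J) = indicator A' z * (\<integral>\<^sup>+j. ennreal (v (z - lam j)) \<partial>count_space J)"
        by (rule nn_integral_cmult) simp
      also have "(\<integral>\<^sup>+j. ennreal (v (z - lam j)) \<partial>count_space J) = (\<integral>\<^sup>+j. ennreal ((cmod (H j z))\<^sup>2) \<partial>count_space J)"
        by (intro nn_integral_cong) (simp add: H_translate)
      also have "indicator A' z * \<dots> \<le> ennreal B * indicator A' z"
        using H_bessel[of z] by (auto simp: indicator_def)
      finally show "(\<integral>\<^sup>+j. indicator A' z * ennreal (v (z - lam j)) \<partial>count_space J) \<le> ennreal B * indicator A' z" .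
    qed
    also have "\<dots> = ennreal B * emeasure lborel A'"
      by (rule nn_integral_cmult_indicator) simp
    also have "\<dots> \<le> ennreal B * ennreal a" using A'(2) by (rule mult_left_mono) simp
    also have "\<dots> = ennreal (B / m' * a) * m"
      using A'(3) B_nonneg m' by (simp add: ennreal_mult[symmetric])
    finally show ?thesis
      using m' by (simp add: ennreal_mult_le_mult_iff mult.commute)
  qed
  moreover have "0 \<le> B / m'" using B_nonneg m' by simp
  ultimately show ?thesis
    using \<rho>(1) by (intro exI[of _ \<rho>] exI[of _ "B / m'"] conjI) simp_all
qed

lemma p_volume_center: "0 \<le> t \<Longrightarrow> emeasure lborel {x. p (x - y) \<le> t} = ennreal (\<kappa> * t ^ D)"
  and p_ball_measurable [measurable]: "{x. p (x - y) \<le> t} \<in> sets borel"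
proof -
  show "{x. p (x - y) \<le> t} \<in> sets borel" for t by measurable
  have [measurable]: "{x. p x \<le> t} \<in> sets borel" by measurable
  assume t: "0 \<le> t"
  have "emeasure lborel {x. p (x - y) \<le> t} = (\<integral>\<^sup>+x. indicator {x. p x \<le> t} (x - y) \<partial>lborel)"
  proof -
    have "(\<integral>\<^sup>+x. indicator {x. p x \<le> t} (x - y) \<partial>lborel) = (\<integral>\<^sup>+x. indicator {x. p (x - y) \<le> t} x \<partial>lborel)"
      by (rule nn_integral_cong) (simp add: indicator_def)
    also have "\<dots> = emeasure lborel {x. p (x - y) \<le> t}" by (rule nn_integral_indicator) measurable
    finally show ?thesis ..
  qed
  also have "\<dots> = (\<integral>\<^sup>+x. indicator {x. p x \<le> t} x \<partial>lborel)"
    by (rule nn_integral_lborel_translate) measurable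
  also have "\<dots> = ennreal (\<kappa> * t ^ D)" using p_volume[OF t] by simp
  finally show "emeasure lborel {x. p (x - y) \<le> t} = ennreal (\<kappa> * t ^ D)" .
qed

section \<open>Boundary layers of large parallelepipeds\<close>

definition E :: "nat \<Rightarrow> 'z set" where "E n = {x. p (x - c) \<le> real n / 2}"

definition vol :: "nat \<Rightarrow> real" where "vol n = \<kappa> * (real n / 2) ^ D"

definition inside :: "nat \<Rightarrow> 'i set" where "inside n = {j \<in> J. lam j \<in> E n}"

lemma E_measurable [measurable]: "E n \<in> sets borel"
  unfolding E_def by measurable

lemma emeasure_E: "emeasure lborel (E n) = ennreal (vol n)"
  unfolding E_def vol_def by (rule p_volume_center) simp

lemma measure_E: "measure lborel (E n) = vol n"
  using emeasure_E[of n] \<kappa>_pos by (simp add: measure_def vol_def)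

lemma vol_nonneg: "0 \<le> vol n"
  using \<kappa>_pos by (simp add: vol_def)

text \<open>A negative inner radius means the full ball; \<open>max 0 s\<close> covers this case
  because \<open>0 ^ D = 0\<close>.\<close>

lemma emeasure_annulus:
  assumes "0 \<le> t" "s \<le> t"
  shows "emeasure lborel {x. s < p (x - c) \<and> p (x - c) \<le> t} = ennreal (\<kappa> * (t ^ D - (max 0 s) ^ D))"
proof (cases "s < 0")
  case True
  then have "{x. s < p (x - c) \<and> p (x - c) \<le> t} = {x. p (x - c) \<le> t}"
    using p_nonneg by (auto intro: less_le_trans)
  moreover have "max 0 s = 0" using True by simp
  ultimately show ?thesis using p_volume_center[OF assms(1)] D_pos by (simp add: power_0_left)
next
  case False
  then have s: "0 \<le> s" by simp
  have "{x. s < p (x - c) \<and> p (x - c) \<le> t} = {x. p (x - c) \<le> t} - {x. p (x - c) \<le> s}" by auto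
  also have "emeasure lborel \<dots> = emeasure lborel {x. p (x - c) \<le> t} - emeasure lborel {x. p (x - c) \<le> s}"
    using assms by (intro emeasure_Diff) (auto simp: p_volume_center[OF s])
  also have "\<dots> = ennreal (\<kappa> * t ^ D - \<kappa> * s ^ D)"
    unfolding p_volume_center[OF s] p_volume_center[OF assms(1)]
    using s \<kappa>_pos by (intro ennreal_minus) simp
  finally show ?thesis using s by (simp add: right_diff_distrib max_def)
qed

text \<open>The covariant half of the weighted error estimate: \<open>v (z - lam j)\<close> is the
  squared modulus of \<open>H j z\<close>, totalled over the pairs separated by the boundary of
  \<open>E n\<close>.\<close>

definition crossing :: "nat \<Rightarrow> ennreal" where
  "crossing n = (\<integral>\<^sup>+z. (\<integral>\<^sup>+j. indicator {z. lam j \<in> E n \<longleftrightarrow> z \<notin> E n} z * ennreal (v (z - lam j)) \<partial>count_space J) \<partial>lborel)"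

text \<open>Two bounds are kept because neither suffices alone. The layer of width about
  \<open>p w + \<rho>\<close> is small relative to \<open>vol n\<close> for fixed \<open>w\<close>
  but not uniformly in \<open>w\<close>; the cover by two enlarged parallelepipeds is uniform but
  not small. The minimum gives pointwise convergence and a dominating constant.\<close>

lemma crossing_count_bound:
  assumes \<rho>: "0 \<le> \<rho>" and q: "0 \<le> q"
    and cb: "\<And>A A' a. A' \<in> sets borel \<Longrightarrow> emeasure lborel A' \<le> ennreal a \<Longrightarrow> 0 \<le> a \<Longrightarrow>
       (\<And>x k. x \<in> A \<Longrightarrow> p k \<le> \<rho> \<Longrightarrow> x + k \<in> A') \<Longrightarrow> cnt A \<le> ennreal (q * a)"
  defines "b n w \<equiv> \<kappa> * min (2 * (real n / 2 + \<rho>) ^ D)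
      ((real n / 2 + p w + \<rho>) ^ D - (max 0 (real n / 2 - p w - \<rho>)) ^ D)"
  shows "emeasure (count_space J) {j \<in> J. lam j \<in> E n \<longleftrightarrow> w + lam j \<notin> E n} \<le> ennreal (q * b n w)"
proof -
  let ?a1 = "(real n / 2 + p w + \<rho>) ^ D - (max 0 (real n / 2 - p w - \<rho>)) ^ D"
  let ?a2 = "2 * (real n / 2 + \<rho>) ^ D"
  have w: "0 \<le> p w" by (rule p_nonneg)
  define X where "X = {j \<in> J. lam j \<in> E n \<longleftrightarrow> w + lam j \<notin> E n}"
  have "emeasure (count_space J) X \<le> ennreal (q * (\<kappa> * ?a1))"
  proof -
    define S where "S = {x. real n / 2 - p w < p (x - c) \<and> p (x - c) \<le> real n / 2 + p w}"
    have "lam j \<in> S" if "j \<in> X" for j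
    proof -
      have 1: "p (w + lam j - c) \<le> p w + p (lam j - c)" "p (lam j - c) \<le> p (w + lam j - c) + p w"
        using p_triangle[of w "lam j - c"] p_triangle[of "w + lam j - c" "- w"] p_minus[of w]
        by (simp_all add: algebra_simps)
      then show ?thesis using that w by (auto simp: X_def E_def S_def)
    qed
    then have "emeasure (count_space J) X \<le> cnt S"
      unfolding cnt_def by (intro emeasure_mono) (auto simp: X_def)
    also have "\<dots> \<le> ennreal (q * (\<kappa> * ?a1))"
    proof (rule cb[where A' = "{x. real n / 2 - p w - \<rho> < p (x - c) \<and> p (x - c) \<le> real n / 2 + p w + \<rho>}"])
      show "{x. real n / 2 - p w - \<rho> < p (x - c) \<and> p (x - c) \<le> real n / 2 + p w + \<rho>} \<in> sets borel" by measurable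
      show "emeasure lborel {x. real n / 2 - p w - \<rho> < p (x - c) \<and> p (x - c) \<le> real n / 2 + p w + \<rho>}
          \<le> ennreal (\<kappa> * ?a1)"
        using \<rho> w by (subst emeasure_annulus) auto
      show "0 \<le> \<kappa> * ?a1"
        using \<kappa>_pos \<rho> w by (intro mult_nonneg_nonneg) (auto intro!: power_mono)
      fix x k assume "x \<in> S" "p k \<le> \<rho>"
      then show "x + k \<in> {x. real n / 2 - p w - \<rho> < p (x - c) \<and> p (x - c) \<le> real n / 2 + p w + \<rho>}"
        using p_triangle[of "x - c" k] p_ge[of "x - c" k] by (auto simp: S_def algebra_simps)
    qed
    finally show ?thesis .
  qed
  moreover have "emeasure (count_space J) X \<le> ennreal (q * (\<kappa> * ?a2))"
  proof -
    \<comment> \<open>A crossing index has its point in \<open>E n\<close> or in \<open>E n\<close>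
      shifted by \<open>-w\<close>; both sets are enlarged by \<open>\<rho>\<close>.\<close>
    let ?A' = "{x. p (x - c) \<le> real n / 2 + \<rho>} \<union> {x. p (x - (c - w)) \<le> real n / 2 + \<rho>}"
    have "emeasure (count_space J) X \<le> cnt (E n \<union> {x. p (x - (c - w)) \<le> real n / 2})"
      unfolding cnt_def by (intro emeasure_mono) (auto simp: X_def E_def algebra_simps)
    also have "\<dots> \<le> ennreal (q * (\<kappa> * ?a2))"
    proof (rule cb[where A' = ?A'])
      have t: "0 \<le> real n / 2 + \<rho>" using \<rho> by simp
      show "?A' \<in> sets borel" by measurable
      have "emeasure lborel ?A' \<le> emeasure lborel {x. p (x - c) \<le> real n / 2 + \<rho>} + emeasure lborel {x. p (x - (c - w)) \<le> real n / 2 + \<rho>}"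
        by (rule emeasure_subadditive) auto
      also have "\<dots> = ennreal (\<kappa> * (real n / 2 + \<rho>) ^ D) + ennreal (\<kappa> * (real n / 2 + \<rho>) ^ D)"
        by (simp only: p_volume_center[OF t])
      also have "\<dots> = ennreal (\<kappa> * ?a2)"
        using t \<kappa>_pos by (subst ennreal_plus[symmetric]) (auto simp: algebra_simps)
      finally show "emeasure lborel ?A' \<le> ennreal (\<kappa> * ?a2)" .
      show "0 \<le> \<kappa> * ?a2" using t \<kappa>_pos by simp
      fix x k assume "x \<in> E n \<union> {x. p (x - (c - w)) \<le> real n / 2}" "p k \<le> \<rho>"
      then show "x + k \<in> ?A'"
        using p_triangle[of "x - c" k] p_triangle[of "x - (c - w)" k] by (auto simp: E_def algebra_simps)
    qed
    finally show ?thesis .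
  qed
  ultimately show ?thesis
    unfolding X_def[symmetric] b_def by (simp add: min_def)
qed

text \<open>After \<open>tonelli_count\<close> the quotient is at most an integral against
  \<open>v\<close> over displacements \<open>w\<close>, whose integrand is bounded by a constant
  times \<open>v w\<close> and tends to 0 pointwise. The count of interior indices comes from the
  same density bound.\<close>

lemma crossing_negligible: "(\<lambda>n. crossing n / ennreal (vol n)) \<longlonglongrightarrow> 0"
  and inside_count: "\<exists>K\<ge>0. \<forall>n>0. finite (inside n) \<and> real (card (inside n)) \<le> K * vol n"
proof -
  obtain \<rho> q where \<rho>q_nonneg: "0 \<le> \<rho>" "0 \<le> q" and bound:
    "\<forall>A A' a. A' \<in> sets borel \<longrightarrow> emeasure lborel A' \<le> ennreal a \<longrightarrow> 0 \<le> a \<longrightarrow>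
       (\<forall>x k. x \<in> A \<longrightarrow> p k \<le> \<rho> \<longrightarrow> x + k \<in> A') \<longrightarrow> cnt A \<le> ennreal (q * a)"
    using count_bound by (elim exE conjE)
  have bound': "cnt A \<le> ennreal (q * a)"
    if "A' \<in> sets borel" "emeasure lborel A' \<le> ennreal a" "0 \<le> a"
      "\<And>x k. x \<in> A \<Longrightarrow> p k \<le> \<rho> \<Longrightarrow> x + k \<in> A'" for A A' a
    using bound that by simp
  note \<rho>q = \<rho>q_nonneg bound'
  \<comment> \<open>For \<open>n >= 1\<close> the enlargement by \<open>\<rho>\<close> is absorbed
    into a constant factor.\<close>
  have scale: "(real n / 2 + \<rho>) ^ D \<le> (1 + 2 * \<rho>) ^ D * (real n / 2) ^ D" if "n > 0" for n
  proof -
    have "2 * \<rho> * 1 \<le> 2 * \<rho> * real n" using that \<rho>q(1) by (intro mult_left_mono) auto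
    then have "real n / 2 + \<rho> \<le> (1 + 2 * \<rho>) * (real n / 2)" by (simp add: algebra_simps)
    then have "(real n / 2 + \<rho>) ^ D \<le> ((1 + 2 * \<rho>) * (real n / 2)) ^ D"
      using \<rho>q(1) by (intro power_mono) auto
    then show ?thesis by (simp only: power_mult_distrib)
  qed
  show "\<exists>K\<ge>0. \<forall>n>0. finite (inside n) \<and> real (card (inside n)) \<le> K * vol n"
  proof (intro exI[of _ "q * (1 + 2 * \<rho>) ^ D"] conjI allI impI)
    show "0 \<le> q * (1 + 2 * \<rho>) ^ D" using \<rho>q by simp
    fix n :: nat assume n: "n > 0"
    have t: "0 \<le> real n / 2 + \<rho>" using \<rho>q(1) by simp
    have c: "cnt (E n) \<le> ennreal (q * (\<kappa> * (real n / 2 + \<rho>) ^ D))"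
    proof (rule \<rho>q(3)[where A' = "{x. p (x - c) \<le> real n / 2 + \<rho>}"])
      fix x k assume "x \<in> E n" "p k \<le> \<rho>"
      then show "x + k \<in> {x. p (x - c) \<le> real n / 2 + \<rho>}"
        using p_triangle[of "x - c" k] by (auto simp: E_def algebra_simps)
    qed (use t \<kappa>_pos in \<open>auto simp: p_volume_center[OF t]\<close>)
    have cnt: "cnt (E n) = emeasure (count_space J) (inside n)" by (simp add: cnt_def inside_def)
    have sub: "inside n \<subseteq> J" by (auto simp: inside_def)
    show fin: "finite (inside n)"
    proof (rule ccontr)
      assume "infinite (inside n)"
      then have "cnt (E n) = \<infinity>" unfolding cnt by (rule emeasure_count_space_infinite[OF sub])
      with c show False by (simp add: top_unique)
    qed
    have "ennreal (real (card (inside n))) \<le> ennreal (q * (\<kappa> * (real n / 2 + \<rho>) ^ D))"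
      using c unfolding cnt emeasure_count_space_finite[OF sub fin] by (simp add: ennreal_of_nat_eq_real_of_nat)
    then have "real (card (inside n)) \<le> q * (\<kappa> * (real n / 2 + \<rho>) ^ D)"
      using t \<rho>q(2) \<kappa>_pos by (subst (asm) ennreal_le_iff) auto
    also have "\<dots> \<le> q * (\<kappa> * ((1 + 2 * \<rho>) ^ D * (real n / 2) ^ D))"
      using \<rho>q(2) \<kappa>_pos scale[OF n] by (intro mult_left_mono) auto
    finally show "real (card (inside n)) \<le> q * (1 + 2 * \<rho>) ^ D * vol n"
      by (simp add: vol_def algebra_simps)
  qed
  define b where "b n w = \<kappa> * min (2 * (real n / 2 + \<rho>) ^ D)
      ((real n / 2 + p w + \<rho>) ^ D - (max 0 (real n / 2 - p w - \<rho>)) ^ D)" for n w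
  have b_meas [measurable]: "b n \<in> borel_measurable borel" for n unfolding b_def by measurable
  have b_nonneg: "0 \<le> b n w" for n w
    unfolding b_def using \<kappa>_pos \<rho>q(1) p_nonneg[of w]
    by (intro mult_nonneg_nonneg) (auto intro!: power_mono)
  have b_dom: "b n w / vol n \<le> 2 * (1 + 2 * \<rho>) ^ D" for n w
  proof (cases "n = 0")
    \<comment> \<open>Here \<open>vol 0 = 0\<close>, and division by zero yields 0.\<close>
    case True then show ?thesis using D_pos \<rho>q(1) by (simp add: vol_def power_0_left)
  next
    case False
    then have "n > 0" by simp
    then have vp: "vol n > 0" using \<kappa>_pos by (simp add: vol_def)
    have "b n w \<le> \<kappa> * (2 * (real n / 2 + \<rho>) ^ D)"
      unfolding b_def using \<kappa>_pos by (intro mult_left_mono) auto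
    also have "\<dots> \<le> \<kappa> * (2 * ((1 + 2 * \<rho>) ^ D * (real n / 2) ^ D))"
      using \<kappa>_pos scale[OF \<open>n > 0\<close>] by (intro mult_left_mono) auto
    also have "\<dots> = 2 * (1 + 2 * \<rho>) ^ D * vol n" by (simp add: vol_def)
    finally show ?thesis using vp by (simp add: pos_divide_le_eq)
  qed
  have b_lim: "(\<lambda>n. b n w / vol n) \<longlonglongrightarrow> 0" for w
  proof (rule tendsto_sandwich)
    \<comment> \<open>Dividing the radii by \<open>n / 2\<close> turns the layer into
      \<open>1 - s / n\<close> to \<open>1 + s / n\<close>; the factor 2 comes from the half side
      length.\<close>
    define s where "s = 2 * (p w + \<rho>)"
    have s: "s \<ge> 0" using p_nonneg[of w] \<rho>q(1) by (simp add: s_def)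
    show "\<forall>\<^sub>F n in sequentially. 0 \<le> b n w / vol n"
      by (rule always_eventually) (simp add: b_nonneg vol_nonneg)
    show "\<forall>\<^sub>F n in sequentially. b n w / vol n \<le> (1 + s * (1 / real n)) ^ D - (max 0 (1 - s * (1 / real n))) ^ D"
      using eventually_gt_at_top[of 0]
    proof eventually_elim
      case (elim n)
      then have vp: "vol n > 0" using \<kappa>_pos by (simp add: vol_def)
      have 1: "real n / 2 + p w + \<rho> = (real n / 2) * (1 + s * (1 / real n))"
        using elim by (simp add: s_def field_simps)
      have 3: "real n / 2 - p w - \<rho> = (real n / 2) * (1 - s * (1 / real n))"
        using elim by (simp add: s_def field_simps)
      have 2: "max 0 (real n / 2 - p w - \<rho>) = (real n / 2) * max 0 (1 - s * (1 / real n))"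
        by (subst 3) (simp add: max_mult_distrib_left)
      have "b n w \<le> \<kappa> * ((real n / 2 + p w + \<rho>) ^ D - (max 0 (real n / 2 - p w - \<rho>)) ^ D)"
        unfolding b_def using \<kappa>_pos by (intro mult_left_mono) auto
      also have "\<dots> = vol n * ((1 + s * (1 / real n)) ^ D - (max 0 (1 - s * (1 / real n))) ^ D)"
        unfolding 1 2 power_mult_distrib vol_def by (simp add: algebra_simps)
      finally show ?case using vp by (simp add: pos_divide_le_eq mult.commute)
    qed
    have "(\<lambda>n. (1 + s * (1 / real n)) ^ D - (max 0 (1 - s * (1 / real n))) ^ D) \<longlonglongrightarrow> (1 + s * 0) ^ D - (max 0 (1 - s * 0)) ^ D"
      by (intro tendsto_intros lim_1_over_n)
    then show "(\<lambda>n. (1 + s * (1 / real n)) ^ D - (max 0 (1 - s * (1 / real n))) ^ D) \<longlonglongrightarrow> 0" by simp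
  qed simp
  have "(\<lambda>n. \<integral>\<^sup>+w. ennreal (v w * (q * (b n w / vol n))) \<partial>lborel) \<longlonglongrightarrow> (\<integral>\<^sup>+w. 0 \<partial>(lborel :: 'z measure))"
  proof (rule nn_integral_dominated_convergence[where w = "\<lambda>w. ennreal (v w * (q * (2 * (1 + 2 * \<rho>) ^ D)))"])
    show "AE w in lborel. ennreal (v w * (q * (b n w / vol n))) \<le> ennreal (v w * (q * (2 * (1 + 2 * \<rho>) ^ D)))" for n
      using v_nonneg \<rho>q(2) b_dom by (intro AE_I2 ennreal_leI mult_left_mono) auto
    show "AE w in lborel. (\<lambda>n. ennreal (v w * (q * (b n w / vol n)))) \<longlonglongrightarrow> 0"
    proof (rule AE_I2)
      fix w :: 'z
      have "(\<lambda>n. v w * (q * (b n w / vol n))) \<longlonglongrightarrow> v w * (q * 0)" by (intro tendsto_intros b_lim)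
      from tendsto_ennrealI[OF this] show "(\<lambda>n. ennreal (v w * (q * (b n w / vol n)))) \<longlonglongrightarrow> 0" by simp
    qed
    have "integrable lborel (\<lambda>w. v w * (q * (2 * (1 + 2 * \<rho>) ^ D)))"
      using v_integrable by (rule integrable_mult_left)
    then have "(\<integral>\<^sup>+w. ennreal (v w * (q * (2 * (1 + 2 * \<rho>) ^ D))) \<partial>lborel)
        = ennreal (LINT w|lborel. v w * (q * (2 * (1 + 2 * \<rho>) ^ D)))"
      using v_nonneg \<rho>q_nonneg by (intro nn_integral_eq_integral AE_I2) auto
    then show "(\<integral>\<^sup>+w. ennreal (v w * (q * (2 * (1 + 2 * \<rho>) ^ D))) \<partial>lborel) < \<infinity>"
      by simp
  qed measurable
  then have lim: "(\<lambda>n. \<integral>\<^sup>+w. ennreal (v w * (q * (b n w / vol n))) \<partial>lborel) \<longlonglongrightarrow> 0" by simp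
  have "crossing n / ennreal (vol n) \<le> (\<integral>\<^sup>+w. ennreal (v w * (q * (b n w / vol n))) \<partial>lborel)" if n: "n > 0" for n
  proof -
    have vp: "vol n > 0" using n \<kappa>_pos by (simp add: vol_def)
    have "crossing n = (\<integral>\<^sup>+w. ennreal (v w) * emeasure (count_space J) {j \<in> J. lam j \<in> E n \<longleftrightarrow> w + lam j \<notin> E n} \<partial>lborel)"
      unfolding crossing_def
    proof (rule tonelli_count)
      show "{z. lam j \<in> E n \<longleftrightarrow> z \<notin> E n} \<in> sets borel" for j
        using E_measurable[of n] by (cases "lam j \<in> E n") (auto simp: Collect_neg_eq)
    qed
    also have "\<dots> \<le> (\<integral>\<^sup>+w. ennreal (vol n) * ennreal (v w * (q * (b n w / vol n))) \<partial>lborel)"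
    proof (rule nn_integral_mono)
      fix w
      have "ennreal (v w) * emeasure (count_space J) {j \<in> J. lam j \<in> E n \<longleftrightarrow> w + lam j \<notin> E n} \<le> ennreal (v w) * ennreal (q * b n w)"
        unfolding b_def by (intro mult_left_mono crossing_count_bound \<rho>q) simp_all
      also have "\<dots> = ennreal (vol n) * ennreal (v w * (q * (b n w / vol n)))"
        using v_nonneg[of w] \<rho>q(2) b_nonneg[of n w] vp by (simp add: ennreal_mult[symmetric])
      finally show "ennreal (v w) * emeasure (count_space J) {j \<in> J. lam j \<in> E n \<longleftrightarrow> w + lam j \<notin> E n}
          \<le> ennreal (vol n) * ennreal (v w * (q * (b n w / vol n)))" .
    qed
    also have "\<dots> = ennreal (vol n) * (\<integral>\<^sup>+w. ennreal (v w * (q * (b n w / vol n))) \<partial>lborel)"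
      by (rule nn_integral_cmult) measurable
    finally show ?thesis using vp by (simp add: divide_le_posI_ennreal)
  qed
  then show "(\<lambda>n. crossing n / ennreal (vol n)) \<longlonglongrightarrow> 0"
    by (intro tendsto_sandwich[OF _ _ tendsto_const lim] eventually_mono[OF eventually_gt_at_top[of 0]]) auto
qed

section \<open>Error estimate and trace asymptotics\<close>

definition T :: "'i \<Rightarrow> 'z \<Rightarrow> complex" where "T j z = H j z * cnj (U j z)"

lemma H_square_integrable: "j \<in> J \<Longrightarrow> integrable lborel (\<lambda>z. (cmod (H j z))\<^sup>2)"
  using integrable_lborel_translate[OF v_integrable, of "lam j"] by (simp add: H_translate)

lemma U_square_integrable: "j \<in> J \<Longrightarrow> integrable lborel (\<lambda>z. (cmod (U j z))\<^sup>2)"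
proof (rule integrableI_bounded)
  assume j: "j \<in> J"
  note [measurable] = U_measurable[OF j]
  show "(\<lambda>z. (cmod (U j z))\<^sup>2) \<in> borel_measurable lborel" by measurable
  show "(\<integral>\<^sup>+z. ennreal (norm ((cmod (U j z))\<^sup>2)) \<partial>lborel) < \<infinity>"
    using order.strict_trans1[OF U_norm[OF j] ennreal_less_top] by simp
qed

lemma T_integrable: "j \<in> J \<Longrightarrow> integrable lborel (T j)"
  unfolding T_def using H_measurable U_measurable H_square_integrable U_square_integrable
  by (intro integrable_mult_cnj_sq) simp_all

definition error :: "nat \<Rightarrow> 'z \<Rightarrow> complex" where
  "error n z = (\<Sum>j\<in>inside n. T j z) - indicator (E n) z"

text \<open>Outside \<open>E n\<close> the error is the sum over the interior indices; inside, the
  reproducing identity makes it minus the sum over the others. In both cases exactly the indices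
  separated from \<open>z\<close> occur.\<close>

lemma error_le_crossing_sum:
  assumes fin: "finite (inside n)"
  shows "ennreal (cmod (error n z))
    \<le> (\<integral>\<^sup>+j. indicator {z. lam j \<in> E n \<longleftrightarrow> z \<notin> E n} z * ennreal (cmod (T j z)) \<partial>count_space J)"
proof -
  have sub: "inside n \<subseteq> J" by (auto simp: inside_def)
  show ?thesis
  proof (cases "z \<in> E n")
    case False
    have "ennreal (cmod (error n z)) \<le> ennreal (\<Sum>j\<in>inside n. cmod (T j z))"
      using False by (simp add: error_def norm_sum ennreal_leI)
    also have "\<dots> = (\<Sum>j\<in>inside n. indicator {z. lam j \<in> E n \<longleftrightarrow> z \<notin> E n} z * ennreal (cmod (T j z)))"
      using False by (simp add: inside_def)
    also have "\<dots> = (\<integral>\<^sup>+j. indicator {z. lam j \<in> E n \<longleftrightarrow> z \<notin> E n} z * ennreal (cmod (T j z)) \<partial>count_space J)"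
      using fin sub False by (intro nn_integral_count_space'[symmetric]) (auto simp: inside_def)
    finally show ?thesis .
  next
    case True
    have "((\<lambda>j. T j z) has_sum (1 - (\<Sum>j\<in>inside n. T j z))) (J - inside n)"
      using reproducing[of z] has_sum_finite[OF fin, of "\<lambda>j. T j z"] sub
      unfolding T_def by (intro has_sum_Diff)
    then have "ennreal (cmod (1 - (\<Sum>j\<in>inside n. T j z))) \<le> (\<integral>\<^sup>+j. ennreal (cmod (T j z)) \<partial>count_space (J - inside n))"
      by (rule norm_has_sum_le_nn_integral)
    also have "\<dots> = (\<integral>\<^sup>+j. ennreal (cmod (T j z)) * indicator (J - inside n) j \<partial>count_space J)"
    proof -
      let ?g = "\<lambda>j. ennreal (cmod (T j z))"
      have "(\<integral>\<^sup>+j. ?g j \<partial>count_space (J - inside n)) = (\<integral>\<^sup>+j. ?g j * indicator (J - inside n) j \<partial>count_space UNIV)"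
        by (rule nn_integral_count_space_indicator) (simp add: NO_MATCH_def)
      also have "\<dots> = (\<integral>\<^sup>+j. ?g j * indicator (J - inside n) j * indicator J j \<partial>count_space UNIV)"
        by (intro nn_integral_cong) (auto simp: indicator_def)
      also have "\<dots> = (\<integral>\<^sup>+j. ?g j * indicator (J - inside n) j \<partial>count_space J)"
        by (rule nn_integral_count_space_indicator[symmetric]) (simp add: NO_MATCH_def)
      finally show ?thesis .
    qed
    also have "\<dots> = (\<integral>\<^sup>+j. indicator {z. lam j \<in> E n \<longleftrightarrow> z \<notin> E n} z * ennreal (cmod (T j z)) \<partial>count_space J)"
      using True by (intro nn_integral_cong) (auto simp: inside_def indicator_def)
    finally show ?thesis using True by (simp add: error_def norm_minus_commute)
  qed
qed

text \<open>From \<open>2 |H U| <= s |H|^2 + |U|^2 / s\<close>. The dual half is bounded in two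
  ways: for \<open>z\<close> in \<open>E n\<close> the Bessel bound at \<open>z\<close> integrates
  to \<open>B' * vol n\<close>, and for \<open>z\<close> outside only interior indices are separated
  from it, each contributing at most \<open>C\<close>.\<close>

lemma nn_integral_error_le:
  assumes fin: "finite (inside n)" and s: "s > 0"
  shows "(\<integral>\<^sup>+z. ennreal (cmod (error n z)) \<partial>lborel)
    \<le> ennreal (s / 2) * crossing n + ennreal ((B' * vol n + C * real (card (inside n))) / (2 * s))"
proof -
  let ?x = "\<lambda>j. {z. lam j \<in> E n \<longleftrightarrow> z \<notin> E n}"
  let ?IU = "\<lambda>z. \<integral>\<^sup>+j. indicator (?x j) z * ennreal ((cmod (U j z))\<^sup>2) \<partial>count_space J"
  let ?IH = "\<lambda>z. \<integral>\<^sup>+j. indicator (?x j) z * ennreal (v (z - lam j)) \<partial>count_space J"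
  let ?SU = "\<lambda>z. \<Sum>j\<in>inside n. ennreal ((cmod (U j z))\<^sup>2)"
  have sub: "inside n \<subseteq> J" by (auto simp: inside_def)
  have x_meas: "?x j \<in> sets borel" for j
    using E_measurable[of n] by (cases "lam j \<in> E n") (auto simp: Collect_neg_eq)
  have pointwise: "ennreal (cmod (T j z)) \<le> ennreal (s / 2) * ennreal (v (z - lam j)) + ennreal (1 / (2 * s)) * ennreal ((cmod (U j z))\<^sup>2)"
    if "j \<in> J" for j z
  proof -
    have "0 \<le> (s * cmod (H j z) - cmod (U j z))\<^sup>2" by simp
    also have "\<dots> = s\<^sup>2 * (cmod (H j z))\<^sup>2 + (cmod (U j z))\<^sup>2 - 2 * s * cmod (T j z)"
      by (simp add: T_def norm_mult power2_diff power_mult_distrib)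
    finally have "2 * s * cmod (T j z) \<le> s\<^sup>2 * v (z - lam j) + (cmod (U j z))\<^sup>2"
      by (simp add: H_translate[OF that])
    then have "cmod (T j z) \<le> s / 2 * v (z - lam j) + 1 / (2 * s) * (cmod (U j z))\<^sup>2"
      using s by (simp add: field_simps power2_eq_square)
    then show ?thesis
      using s v_nonneg by (simp add: ennreal_mult[symmetric] ennreal_plus[symmetric] ennreal_leI del: ennreal_plus)
  qed
  have U_part: "(\<integral>\<^sup>+z. ?IU z \<partial>lborel)
      \<le> ennreal (B' * vol n + C * real (card (inside n)))"
  proof -
    have "?IU z
        \<le> ennreal B' * indicator (E n) z + ?SU z" for z
    proof (cases "z \<in> E n")
      case True
      have "?IU z \<le> (\<integral>\<^sup>+j. ennreal ((cmod (U j z))\<^sup>2) \<partial>count_space J)"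
        by (intro nn_integral_mono) (auto simp: indicator_def)
      also have "\<dots> \<le> ennreal B'" by (rule U_bessel)
      finally show ?thesis using True by (simp add: add_increasing2)
    next
      case False
      have "?IU z
          = (\<Sum>j\<in>inside n. indicator (?x j) z * ennreal ((cmod (U j z))\<^sup>2))"
        using fin sub False by (intro nn_integral_count_space') (auto simp: inside_def)
      also have "\<dots> \<le> ?SU z"
        by (intro sum_mono) (auto simp: indicator_def)
      finally show ?thesis using False by simp
    qed
    then have "(\<integral>\<^sup>+z. ?IU z \<partial>lborel)
        \<le> (\<integral>\<^sup>+z. ennreal B' * indicator (E n) z + ?SU z \<partial>lborel)"
      by (intro nn_integral_mono)
    also have "\<dots> = (\<integral>\<^sup>+z. ennreal B' * indicator (E n) z \<partial>lborel) + (\<integral>\<^sup>+z. ?SU z \<partial>lborel)"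
    proof (rule nn_integral_add)
      show "?SU \<in> borel_measurable lborel"
      proof (rule borel_measurable_sum)
        fix j assume "j \<in> inside n"
        then have [measurable]: "U j \<in> borel_measurable borel" using sub U_measurable by auto
        show "(\<lambda>z. ennreal ((cmod (U j z))\<^sup>2)) \<in> borel_measurable lborel" by measurable
      qed
    qed measurable
    also have "(\<integral>\<^sup>+z. ennreal B' * indicator (E n) z \<partial>lborel) = ennreal (B' * vol n)"
      using B_nonneg vol_nonneg by (subst nn_integral_cmult_indicator) (auto simp: emeasure_E ennreal_mult)
    also have "(\<integral>\<^sup>+z. ?SU z \<partial>lborel) = (\<Sum>j\<in>inside n. \<integral>\<^sup>+z. ennreal ((cmod (U j z))\<^sup>2) \<partial>lborel)"
    proof (rule nn_integral_sum)
      fix j assume "j \<in> inside n"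
      then have [measurable]: "U j \<in> borel_measurable borel" using sub U_measurable by auto
      show "(\<lambda>z. ennreal ((cmod (U j z))\<^sup>2)) \<in> borel_measurable lborel" by measurable
    qed
    also have "\<dots> \<le> (\<Sum>j\<in>inside n. ennreal C)"
      using sub by (intro sum_mono U_norm) auto
    also have "\<dots> = ennreal (C * real (card (inside n)))"
      using B_nonneg by (simp add: ennreal_mult ennreal_of_nat_eq_real_of_nat mult.commute)
    finally show ?thesis
      using B_nonneg vol_nonneg by (simp add: ennreal_plus add_left_mono)
  qed
  \<comment> \<open>Sums over the countable index set are integrals over
    \<open>count_space J\<close>, so measurability in \<open>z\<close> follows from joint
    measurability on the product.\<close>
  have H_meas: "?IH \<in> borel_measurable lborel"
    and U_meas: "?IU \<in> borel_measurable lborel"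
    if "J \<noteq> {}"
  proof -
    have r: "range (from_nat_into J) = J" using that J_countable by (rule range_from_nat_into)
    have *: "(\<lambda>z. \<integral>\<^sup>+j. f j z \<partial>count_space J) \<in> borel_measurable lborel"
      if f: "\<And>j. j \<in> J \<Longrightarrow> f j \<in> borel_measurable lborel" for f :: "'i \<Rightarrow> 'z \<Rightarrow> ennreal"
    proof (rule sigma_finite_measure.borel_measurable_nn_integral)
      show "sigma_finite_measure (count_space J)"
        using J_countable by (rule sigma_finite_measure_count_space_countable)
      have "(\<lambda>(j, z). f j z) \<in> borel_measurable (count_space J \<Otimes>\<^sub>M lborel)"
        using f by (intro measurable_pair_measure_countable1 J_countable) simp
      from measurable_pair_swap[OF this]
      show "(\<lambda>(z, j). f j z) \<in> borel_measurable (lborel \<Otimes>\<^sub>M count_space J)" by simp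
    qed
    show "?IH \<in> borel_measurable lborel"
    proof (rule *)
      fix j
      note [measurable] = x_meas[of j]
      show "(\<lambda>z. indicator (?x j) z * ennreal (v (z - lam j))) \<in> borel_measurable lborel" by measurable
    qed
    show "?IU \<in> borel_measurable lborel"
    proof (rule *)
      fix j assume "j \<in> J"
      note [measurable] = x_meas[of j] U_measurable[OF this]
      show "(\<lambda>z. indicator (?x j) z * ennreal ((cmod (U j z))\<^sup>2)) \<in> borel_measurable lborel" by measurable
    qed
  qed
  \<comment> \<open>An empty index set would give the reproducing sum 0 instead of 1.\<close>
  have "J \<noteq> {}"
    using reproducing[of undefined] has_sum_unique[OF reproducing[of undefined] has_sum_0] by fastforce
  note H_meas = H_meas[OF this] and U_meas = U_meas[OF this]
  have "(\<integral>\<^sup>+z. ennreal (cmod (error n z)) \<partial>lborel)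
      \<le> (\<integral>\<^sup>+z. ennreal (s / 2) * ?IH z
          + ennreal (1 / (2 * s)) * ?IU z \<partial>lborel)"
  proof (rule nn_integral_mono)
    fix z
    have "ennreal (cmod (error n z)) \<le> (\<integral>\<^sup>+j. indicator (?x j) z * ennreal (cmod (T j z)) \<partial>count_space J)"
      by (rule error_le_crossing_sum[OF fin])
    also have "\<dots> \<le> (\<integral>\<^sup>+j. ennreal (s / 2) * (indicator (?x j) z * ennreal (v (z - lam j)))
        + ennreal (1 / (2 * s)) * (indicator (?x j) z * ennreal ((cmod (U j z))\<^sup>2)) \<partial>count_space J)"
      using pointwise by (intro nn_integral_mono) (auto simp: indicator_def)
    also have "\<dots> = ennreal (s / 2) * ?IH z
          + ennreal (1 / (2 * s)) * ?IU z"
      by (simp add: nn_integral_add nn_integral_cmult)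
    finally show "ennreal (cmod (error n z)) \<le> ennreal (s / 2) * ?IH z
          + ennreal (1 / (2 * s)) * ?IU z" .
  qed
  also have "\<dots> = ennreal (s / 2) * crossing n
      + ennreal (1 / (2 * s)) * (\<integral>\<^sup>+z. ?IU z \<partial>lborel)"
    unfolding crossing_def using H_meas U_meas
    by (subst nn_integral_add) (simp_all only: nn_integral_cmult borel_measurable_times_ennreal borel_measurable_const)
  also have "\<dots> \<le> ennreal (s / 2) * crossing n + ennreal (1 / (2 * s)) * ennreal (B' * vol n + C * real (card (inside n)))"
    by (intro add_left_mono mult_left_mono U_part) simp
  also have "ennreal (1 / (2 * s)) * ennreal (B' * vol n + C * real (card (inside n))) = ennreal ((B' * vol n + C * real (card (inside n))) / (2 * s))"
    using s B_nonneg vol_nonneg by (subst ennreal_mult[symmetric]) auto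
  finally show ?thesis .
qed

theorem dual_trace_asymptotics:
  "(\<lambda>n. (\<Sum>j\<in>inside n. integral\<^sup>L lborel (T j)) / of_real (vol n)) \<longlonglongrightarrow> 1"
proof -
  let ?S = "\<lambda>n. \<Sum>j\<in>inside n. integral\<^sup>L lborel (T j)"
  obtain K where K: "K \<ge> 0" "\<And>n. n > 0 \<Longrightarrow> finite (inside n)" "\<And>n. n > 0 \<Longrightarrow> real (card (inside n)) \<le> K * vol n"
    using inside_count by auto
  \<comment> \<open>Bounds the dual half per unit volume: \<open>B'\<close> for points of
    \<open>E n\<close>, and \<open>C * K\<close> for the at most \<open>K * vol n\<close> interior
    indices.\<close>
  define L where "L = B' + C * K"
  have L: "L \<ge> 0" using K(1) B_nonneg by (simp add: L_def)
  have bound: "ennreal (cmod (?S n / of_real (vol n) - 1))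
      \<le> ennreal (s / 2) * (crossing n / ennreal (vol n)) + ennreal (L / (2 * s))"
    if n: "n > 0" and s: "s > 0" for n s
  proof -
    have vp: "vol n > 0" using n \<kappa>_pos by (simp add: vol_def)
    have sub: "inside n \<subseteq> J" by (auto simp: inside_def)
    have int_sum: "integrable lborel (\<lambda>z. \<Sum>j\<in>inside n. T j z)"
      using sub by (intro Bochner_Integration.integrable_sum T_integrable) auto
    have ind_eq: "indicator (E n) = (\<lambda>z. complex_of_real (indicator (E n) z))"
      by (simp add: fun_eq_iff indicator_def)
    have int_ind: "integrable lborel (indicator (E n) :: 'z \<Rightarrow> complex)"
      unfolding ind_eq by (intro integrable_of_real integrable_real_indicator) (simp_all add: emeasure_E)
    have "integral\<^sup>L lborel (error n) = (LINT z|lborel. (\<Sum>j\<in>inside n. T j z)) - integral\<^sup>L lborel (indicator (E n))"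
      unfolding error_def by (rule Bochner_Integration.integral_diff[OF int_sum int_ind])
    also have "(LINT z|lborel. (\<Sum>j\<in>inside n. T j z)) = ?S n"
      using sub by (intro Bochner_Integration.integral_sum T_integrable) auto
    also have "integral\<^sup>L lborel (indicator (E n) :: 'z \<Rightarrow> complex) = of_real (vol n)"
      unfolding ind_eq integral_complex_of_real using measure_E[of n] by simp
    finally have eq: "?S n - of_real (vol n) = integral\<^sup>L lborel (error n)" ..
    have "ennreal (cmod (?S n - of_real (vol n))) \<le> (\<integral>\<^sup>+z. ennreal (cmod (error n z)) \<partial>lborel)"
      unfolding eq using int_sum int_ind
      by (intro integral_norm_bound_ennreal) (simp add: error_def[abs_def])
    also have "\<dots> \<le> ennreal (s / 2) * crossing n + ennreal ((B' * vol n + C * real (card (inside n))) / (2 * s))"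
      by (rule nn_integral_error_le[OF K(2)[OF n] s])
    also have "\<dots> \<le> ennreal (s / 2) * crossing n + ennreal (L * vol n / (2 * s))"
    proof (intro add_left_mono ennreal_leI divide_right_mono)
      have "C * real (card (inside n)) \<le> C * (K * vol n)" using K(3)[OF n] B_nonneg by (intro mult_left_mono) auto
      then show "B' * vol n + C * real (card (inside n)) \<le> L * vol n" by (simp add: L_def algebra_simps)
    qed (use s in simp)
    finally have "ennreal (cmod (?S n - of_real (vol n))) / ennreal (vol n)
        \<le> (ennreal (s / 2) * crossing n + ennreal (L * vol n / (2 * s))) / ennreal (vol n)"
      by (rule divide_right_mono_ennreal)
    also have "\<dots> = ennreal (s / 2) * (crossing n / ennreal (vol n)) + ennreal (L / (2 * s))"
      using vp s L by (simp add: add_divide_distrib_ennreal ennreal_times_divide divide_ennreal)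
    also have "ennreal (cmod (?S n - of_real (vol n))) / ennreal (vol n)
        = ennreal (cmod (?S n / of_real (vol n) - 1))"
    proof -
      have "?S n / of_real (vol n) - 1
          = (?S n - of_real (vol n)) / of_real (vol n)"
        using vp by (simp add: diff_divide_distrib)
      then show ?thesis using vp by (simp add: norm_divide divide_ennreal)
    qed
    finally show ?thesis .
  qed
  have "(\<lambda>n. ?S n / of_real (vol n) - 1) \<longlonglongrightarrow> 0"
  proof (rule tendstoI)
    fix e :: real assume e: "e > 0"
    \<comment> \<open>The weight keeps the dual term below \<open>e / 2\<close> for all positive
      \<open>n\<close>, before \<open>n\<close> is made large for the crossing term; the
      \<open>+ 1\<close> keeps it positive when \<open>L = 0\<close>.\<close>
    define s where "s = 2 * (L + 1) / e"
    have s: "s > 0" using e L by (simp add: s_def)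
    have "L / (2 * s) < e / 2"
    proof -
      have "L / (2 * s) = (e / 2) * (L / (2 * (L + 1)))" using e L by (simp add: s_def field_simps)
      also have "\<dots> < (e / 2) * 1" using e L by (intro mult_strict_left_mono) auto
      finally show ?thesis by simp
    qed
    have "(\<lambda>n. ennreal (s / 2) * (crossing n / ennreal (vol n))) \<longlonglongrightarrow> ennreal (s / 2) * 0"
      by (intro ennreal_tendsto_cmult crossing_negligible) simp
    then have "\<forall>\<^sub>F n in sequentially. ennreal (s / 2) * (crossing n / ennreal (vol n)) < ennreal (e / 2)"
      using e by (intro order_tendstoD(2)) auto
    then show "\<forall>\<^sub>F n in sequentially. dist (?S n / of_real (vol n) - 1) 0 < e"
      using eventually_gt_at_top[of 0]
    proof eventually_elim
      case (elim n)
      have "ennreal (cmod (?S n / of_real (vol n) - 1))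
          \<le> ennreal (s / 2) * (crossing n / ennreal (vol n)) + ennreal (L / (2 * s))"
        using bound[OF elim(2) s] .
      also have "\<dots> \<le> ennreal (e / 2) + ennreal (L / (2 * s))"
        using elim(1) by (intro add_right_mono) auto
      also have "\<dots> = ennreal (e / 2 + L / (2 * s))"
        using e L s by (intro ennreal_plus[symmetric]) auto
      finally have "cmod (?S n / of_real (vol n) - 1) \<le> e / 2 + L / (2 * s)"
        using e L s by (subst (asm) ennreal_le_iff) auto
      then show ?case using \<open>L / (2 * s) < e / 2\<close> by simp
    qed
  qed
  then show ?thesis by (simp only: LIM_zero_iff)
qed

end

section \<open>Ultrafilters and cubes\<close>

lemma free_ultrafilter_le_sequentially:
  assumes "free_ultrafilter p"
  shows "p \<le> sequentially"
  unfolding le_filter_def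
proof (intro allI impI)
  fix P assume "eventually P sequentially"
  then obtain n0 where n0: "\<And>n. n \<ge> n0 \<Longrightarrow> P n" by (auto simp: eventually_sequentially)
  have "eventually (\<lambda>n. n \<notin> {..<n0}) p"
    using assms unfolding free_ultrafilter_def by blast
  then show "eventually P p" by (rule eventually_mono) (simp add: n0)
qed

text \<open>Compactness gives a cluster point of the image filter, and an ultrafilter decides every
  preimage, so the cluster point is a limit.\<close>

lemma free_ultrafilter_bounded_limit:
  fixes f :: "nat \<Rightarrow> real"
  assumes p: "free_ultrafilter p" and bound: "eventually (\<lambda>n. \<bar>f n\<bar> \<le> K) p"
  shows "\<exists>L. (f \<longlongrightarrow> L) p"
proof -
  have "filtermap f p \<noteq> bot"
    using p unfolding free_ultrafilter_def by (simp add: filtermap_bot_iff)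
  moreover have "eventually (\<lambda>x. x \<in> {-K..K}) (filtermap f p)"
    unfolding eventually_filtermap using bound by (rule eventually_mono) (simp add: abs_le_iff)
  ultimately obtain x where x: "inf (nhds x) (filtermap f p) \<noteq> bot"
    using compact_Icc[of "-K" K] unfolding compact_filter by blast
  have "(f \<longlongrightarrow> x) p"
  proof (rule topological_tendstoI)
    fix S assume S: "open S" "x \<in> S"
    have "eventually (\<lambda>n. f n \<in> S) p \<or> eventually (\<lambda>n. f n \<notin> S) p"
      using p[unfolded free_ultrafilter_def, THEN conjunct2, THEN conjunct1, rule_format, of "{n. f n \<in> S}"] by simp
    moreover have False if "eventually (\<lambda>n. f n \<notin> S) p"
    proof -
      have "eventually (\<lambda>y. y \<in> S) (nhds x)" using S by (rule eventually_nhds_in_open)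
      moreover have "eventually (\<lambda>y. y \<notin> S) (filtermap f p)" using that by (simp add: eventually_filtermap)
      ultimately have "eventually (\<lambda>_. False) (inf (nhds x) (filtermap f p))"
        unfolding eventually_inf by (intro exI[of _ "\<lambda>y. y \<in> S"] exI[of _ "\<lambda>y. y \<notin> S"]) simp
      with x show False by (simp add: trivial_limit_def)
    qed
    ultimately show "eventually (\<lambda>n. f n \<in> S) p" by blast
  qed
  then show ?thesis ..
qed

text \<open>The norm whose closed balls of radius \<open>n / 2\<close> are the linear images of the
  cubes of side \<open>n\<close>; it lets boundary layers be described by radii.\<close>

definition cube_gauge :: "('m::finite tf \<Rightarrow> 'm tf) \<Rightarrow> 'm tf \<Rightarrow> real" where
  "cube_gauge M x = infnorm (inv M x)"

lemma infnorm_le_iff: "infnorm (x :: 'a::euclidean_space) \<le> t \<longleftrightarrow> (\<forall>b\<in>Basis. \<bar>x \<bullet> b\<bar> \<le> t)"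
  unfolding infnorm_Max by (subst Max_le_iff) auto

text \<open>The standard basis of the product type consists of the time axes and the frequency axes,
  so \<open>infnorm\<close> is the maximum over both groups of coordinates.\<close>

lemma cube_infnorm: "cube n c = {x :: 'm::finite tf. infnorm (x - c) \<le> real n / 2}"
proof -
  have "x \<in> cube n c \<longleftrightarrow> infnorm (x - c) \<le> real n / 2" for x :: "'m tf"
  proof -
    have B: "(Basis :: 'm tf set) = (\<lambda>j. (axis j 1, 0)) ` UNIV \<union> (\<lambda>j. (0, axis j 1)) ` UNIV"
      unfolding Basis_prod_def Basis_vec_def by auto
    have "infnorm (x - c) \<le> real n / 2 \<longleftrightarrow>
        (\<forall>j. \<bar>(x - c) \<bullet> (axis j 1, 0)\<bar> \<le> real n / 2) \<and> (\<forall>j. \<bar>(x - c) \<bullet> (0, axis j 1)\<bar> \<le> real n / 2)"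
      unfolding infnorm_le_iff B ball_Un by simp
    also have "\<dots> \<longleftrightarrow> (\<forall>j. \<bar>fst x $ j - fst c $ j\<bar> \<le> real n / 2) \<and> (\<forall>j. \<bar>snd x $ j - snd c $ j\<bar> \<le> real n / 2)"
      unfolding inner_prod_def by (simp add: inner_axis)
    finally show ?thesis unfolding cube_def mem_Collect_eq all_conj_distrib ..
  qed
  then show ?thesis by blast
qed

lemma linear_inv_of_bij:
  assumes "linear M" "bij M"
  shows "linear (inv M)"
proof (rule linearI)
  have inv1: "inv M (M y) = y" for y using assms(2) by (simp add: bij_is_inj inv_f_f)
  have inv2: "M (inv M x) = x" for x using assms(2) by (simp add: bij_is_surj surj_f_inv_f)
  show "inv M (x + y) = inv M x + inv M y" for x y
    using inv1[of "inv M x + inv M y"] by (simp add: linear_add[OF assms(1)] inv2)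
  show "inv M (r *\<^sub>R x) = r *\<^sub>R inv M x" for r x
    using inv1[of "r *\<^sub>R inv M x"] by (simp add: linear_scale[OF assms(1)] inv2)
qed

lemma image_cube_eq:
  assumes "linear M" "bij M"
  shows "M ` cube n c = {x. cube_gauge M (x - M c) \<le> real n / 2}"
proof -
  note lin = linear_inv_of_bij[OF assms]
  have inv1: "inv M (M y) = y" for y using assms(2) by (simp add: bij_is_inj inv_f_f)
  have inv2: "M (inv M x) = x" for x using assms(2) by (simp add: bij_is_surj surj_f_inv_f)
  have "x \<in> M ` cube n c \<longleftrightarrow> inv M x \<in> cube n c" for x
    using inv1 inv2 by (metis image_iff)
  then have "x \<in> M ` cube n c \<longleftrightarrow> cube_gauge M (x - M c) \<le> real n / 2" for x
    by (simp add: cube_infnorm cube_gauge_def linear_diff[OF lin] inv1)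
  then show ?thesis by blast
qed

lemma cube_gauge_measurable:
  assumes "linear M" "bij M"
  shows "cube_gauge M \<in> borel_measurable borel"
proof -
  have "continuous_on UNIV (inv M)"
    using linear_inv_of_bij[OF assms] by (intro linear_continuous_on) (simp add: linear_conv_bounded_linear)
  then have "continuous_on UNIV (cube_gauge M)"
    unfolding cube_gauge_def by (rule continuous_on_infnorm)
  then show ?thesis by (rule borel_measurable_continuous_onI)
qed

text \<open>Homogeneity reduces everything to the unit ball, so no determinant is computed. If its
  volume were 0, all balls would be null and their countable union would be the whole space.\<close>

lemma cube_gauge_volume:
  fixes M :: "'m::finite tf \<Rightarrow> 'm tf"
  assumes M: "linear M" "bij M"
  shows "\<exists>\<kappa>>0. \<forall>t\<ge>0. emeasure lborel {x. cube_gauge M x \<le> t} = ennreal (\<kappa> * t ^ DIM('m tf))"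
proof -
  note lin = linear_inv_of_bij[OF M]
  note [measurable] = cube_gauge_measurable[OF M]
  have inv2: "M (inv M x) = x" for x using M(2) by (simp add: bij_is_surj surj_f_inv_f)
  have ball_meas: "{x. cube_gauge M x \<le> t} \<in> sets lborel" for t
  proof -
    have "{x \<in> space borel. cube_gauge M x \<le> t} \<in> sets borel" by measurable
    then show ?thesis by simp
  qed
  have scale: "cube_gauge M (t *\<^sub>R x) = \<bar>t\<bar> * cube_gauge M x" for t x
    by (simp add: cube_gauge_def linear_scale[OF lin] infnorm_mul)
  have D: "0 < DIM('m tf)" by (rule DIM_positive)
  have "bounded {x. cube_gauge M x \<le> 1}"
  proof -
    have "bounded {y :: 'm tf. infnorm y \<le> 1}"
    proof (rule boundedI)
      fix y :: "'m tf" assume "y \<in> {y. infnorm y \<le> 1}"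
      then have "sqrt DIM('m tf) * infnorm y \<le> sqrt DIM('m tf) * 1" by (intro mult_left_mono) auto
      with norm_le_infnorm[of y] show "norm y \<le> sqrt DIM('m tf)" by linarith
    qed
    then have "bounded (M ` {y. infnorm y \<le> 1})"
      using M(1) by (intro bounded_linear_image) (simp_all add: linear_conv_bounded_linear)
    moreover have "{x. cube_gauge M x \<le> 1} \<subseteq> M ` {y. infnorm y \<le> 1}"
      unfolding cube_gauge_def using inv2 by (metis (mono_tags, lifting) image_iff mem_Collect_eq subsetI)
    ultimately show ?thesis by (rule bounded_subset)
  qed
  then have fin: "emeasure lborel {x. cube_gauge M x \<le> 1} < \<infinity>" by (rule emeasure_bounded_finite)
  define \<kappa> where "\<kappa> = measure lborel {x. cube_gauge M x \<le> 1}"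
  have unit: "emeasure lborel {x. cube_gauge M x \<le> 1} = ennreal \<kappa>"
    unfolding \<kappa>_def using fin by (intro emeasure_eq_ennreal_measure) simp
  have vol: "emeasure lborel {x. cube_gauge M x \<le> t} = ennreal (\<kappa> * t ^ DIM('m tf))" if "t \<ge> 0" for t
  proof (cases "t = 0")
    \<comment> \<open>The dilation argument requires a nonzero factor, so radius 0 is treated
      separately; the ball is then a single point.\<close>
    case True
    have "cube_gauge M x \<le> 0 \<longleftrightarrow> x = 0" for x
    proof
      assume "cube_gauge M x \<le> 0"
      then have "inv M x = 0" using infnorm_pos_lt[of "inv M x"] by (auto simp: cube_gauge_def)
      then have "M (inv M x) = 0" using linear_0[OF M(1)] by simp
      then show "x = 0" by (simp add: inv2)
    qed (simp add: cube_gauge_def linear_0[OF lin] infnorm_0)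
    then have "{x. cube_gauge M x \<le> t} = {0}" using True by simp
    then show ?thesis using True D by (simp add: power_0_left)
  next
    case False
    with that have t: "t > 0" by simp
    have "emeasure lborel {x. cube_gauge M x \<le> t} = (\<integral>\<^sup>+x. indicator {x. cube_gauge M x \<le> t} x \<partial>lborel)"
      by (rule nn_integral_indicator[symmetric]) (rule ball_meas)
    also have "\<dots> = ennreal (\<bar>t\<bar> ^ DIM('m tf)) * (\<integral>\<^sup>+x. indicator {x. cube_gauge M x \<le> t} (0 + t *\<^sub>R x) \<partial>lborel)"
      using t ball_meas by (intro nn_integral_lborel_affine borel_measurable_indicator) auto
    also have "(\<integral>\<^sup>+x. indicator {x. cube_gauge M x \<le> t} (0 + t *\<^sub>R x) \<partial>lborel) = (\<integral>\<^sup>+x. indicator {x. cube_gauge M x \<le> 1} x \<partial>lborel)"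
      using t by (intro nn_integral_cong) (simp add: indicator_def scale)
    also have "\<dots> = ennreal \<kappa>"
      using nn_integral_indicator[OF ball_meas[of 1]] unit by simp
    finally show ?thesis using t by (simp add: ennreal_mult[symmetric] \<kappa>_def mult.commute)
  qed
  have "\<kappa> \<noteq> 0"
  proof
    assume "\<kappa> = 0"
    then have "{x. cube_gauge M x \<le> real n} \<in> null_sets lborel" for n
      using vol[of "real n"] ball_meas[of "real n"] by (intro null_setsI) auto
    then have "(\<Union>n. {x. cube_gauge M x \<le> real n}) \<in> null_sets lborel" by (intro null_sets_UN) auto
    moreover have "(\<Union>n. {x. cube_gauge M x \<le> real n}) = UNIV" using real_arch_simple by auto
    ultimately show False by (simp add: null_sets_def)
  qed
  then have "\<kappa> > 0" by (simp add: \<kappa>_def less_le)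
  with vol show ?thesis by blast
qed

section \<open>Gabor superframes\<close>

lemma nn_integral_count_space_infsum:
  fixes f :: "'i \<Rightarrow> real"
  assumes "f summable_on J" "\<And>j. j \<in> J \<Longrightarrow> 0 \<le> f j"
  shows "(\<integral>\<^sup>+j. ennreal (f j) \<partial>count_space J) = ennreal (\<Sum>\<^sub>\<infinity>j\<in>J. f j)"
proof -
  have "(\<lambda>j. norm (f j)) summable_on J"
    using assms by (simp cong: summable_on_cong)
  then have abs: "Infinite_Set_Sum.abs_summable_on f J" by (simp only: abs_summable_equivalent)
  have "(\<integral>\<^sup>+j. ennreal (f j) \<partial>count_space J) = ennreal (infsetsum f J)"
    by (rule nn_integral_conv_infsetsum[OF abs assms(2)])
  then show ?thesis by (simp only: infsetsum_infsum[OF abs])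
qed

text \<open>The family \<^term>\<open>u\<close> is an arbitrary Bessel dual of the Gabor system, so the result
  applies to each summand of a superframe.\<close>
lemma gabor_dual_trace_asymptotics:
  fixes lam :: "'i \<Rightarrow> 'm::finite tf" and u :: "'i \<Rightarrow> real^'m \<Rightarrow> complex" and c :: "'m tf"
  defines "n2 \<equiv> \<lambda>f :: real^'m \<Rightarrow> complex. LINT x|lborel. (cmod (f x))\<^sup>2"
  assumes J: "countable J" and M: "linear M" "bij M" and g: "L2 g"
    and u: "\<And>j. j \<in> J \<Longrightarrow> L2 (u j)" "\<And>j. j \<in> J \<Longrightarrow> n2 (u j) \<le> C"
    and h_def: "\<And>j. h j = gabor_atom g (ph j) (lam j)"
    and h_bessel: "\<And>f. L2 f \<Longrightarrow> (\<lambda>j. (cmod (l2_inner f (h j)))\<^sup>2) summable_on J"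
      "\<And>f. L2 f \<Longrightarrow> (\<Sum>\<^sub>\<infinity>j\<in>J. (cmod (l2_inner f (h j)))\<^sup>2) \<le> B * n2 f"
    and u_bessel: "\<And>f. L2 f \<Longrightarrow> (\<lambda>j. (cmod (l2_inner (u j) f))\<^sup>2) summable_on J"
      "\<And>f. L2 f \<Longrightarrow> (\<Sum>\<^sub>\<infinity>j\<in>J. (cmod (l2_inner (u j) f))\<^sup>2) \<le> B' * n2 f"
    and repro: "\<And>f. L2 f \<Longrightarrow> ((\<lambda>j. l2_inner f (h j) * l2_inner (u j) f) has_sum l2_inner f f) J"
    and nonneg: "0 \<le> C" "0 \<le> B" "0 \<le> B'"
  defines "JE \<equiv> \<lambda>n. {j \<in> J. lam j \<in> M ` cube n c}"
  shows "(\<lambda>n. (\<Sum>j\<in>JE n. l2_inner (h j) (u j)) / of_real (measure lborel (M ` cube n c))) \<longlonglongrightarrow> 1"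
    "\<exists>K\<ge>0. \<forall>n>0. finite (JE n) \<and> real (card (JE n)) \<le> K * measure lborel (M ` cube n c)"
    "\<forall>n>0. measure lborel (M ` cube n c) > 0"
proof -
  obtain \<kappa> where \<kappa>: "\<kappa> > 0" "\<And>t. t \<ge> 0 \<Longrightarrow> emeasure lborel {x. cube_gauge M x \<le> t} = ennreal (\<kappa> * t ^ DIM('m tf))"
    using cube_gauge_volume[OF M] by (elim exE conjE) simp
  have hL2: "L2 (h j)" for j unfolding h_def using g by (rule L2_gabor_atom)
  have atomL2: "L2 (gabor_atom window 0 z)" for z :: "'m tf" by (rule L2_gabor_atom[OF L2_window])
  have atom_norm: "n2 (gabor_atom window 0 z) = 1" for z :: "'m tf"
    unfolding n2_def integral_norm_sq_gabor_atom[OF L2_window] by (rule integral_window)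
  interpret S: localized_dual_system J lam "\<lambda>j. stft (h j)" "\<lambda>j. stft (u j)" "\<lambda>z. (cmod (stft g z))\<^sup>2"
    "cube_gauge M" "M c" B B' C \<kappa> "DIM('m tf)"
  proof
    show "countable J" by (rule J)
    show "stft (h j) \<in> borel_measurable borel" for j by (rule stft_measurable[OF hL2])
    show "stft (u j) \<in> borel_measurable borel" if "j \<in> J" for j by (rule stft_measurable[OF u(1)[OF that]])
    show "integrable lborel (\<lambda>z. (cmod (stft g z))\<^sup>2)" by (rule moyal_norm(1)[OF g])
    show "0 \<le> (cmod (stft g z))\<^sup>2" for z by simp
    show "(cmod (stft (h j) z))\<^sup>2 = (cmod (stft g (z - lam j)))\<^sup>2" for j z
      by (simp only: h_def stft_gabor_atom[OF g])
    show "(\<integral>\<^sup>+j. ennreal ((cmod (stft (h j) z))\<^sup>2) \<partial>count_space J) \<le> ennreal B" for z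
    proof -
      let ?e = "gabor_atom window 0 z :: real^'m \<Rightarrow> complex"
      \<comment> \<open>At fixed \<open>z\<close> these values are, up to conjugation, the frame
        coefficients of the atom \<open>?e\<close>; its norm 1 makes the Bessel constant independent
        of \<open>z\<close>.\<close>
      have "cmod (stft (h j) z) = cmod (l2_inner ?e (h j))" for j
        unfolding stft_def by (subst l2_inner_cnj) simp
      then have "(\<integral>\<^sup>+j. ennreal ((cmod (stft (h j) z))\<^sup>2) \<partial>count_space J) = ennreal (\<Sum>\<^sub>\<infinity>j\<in>J. (cmod (l2_inner ?e (h j)))\<^sup>2)"
        using nn_integral_count_space_infsum[OF h_bessel(1)[OF atomL2]] by simp
      also have "\<dots> \<le> ennreal (B * n2 ?e)" by (intro ennreal_leI h_bessel(2) atomL2)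
      finally show ?thesis by (simp add: atom_norm)
    qed
    show "(\<integral>\<^sup>+j. ennreal ((cmod (stft (u j) z))\<^sup>2) \<partial>count_space J) \<le> ennreal B'" for z
    proof -
      let ?e = "gabor_atom window 0 z :: real^'m \<Rightarrow> complex"
      have "(\<integral>\<^sup>+j. ennreal ((cmod (stft (u j) z))\<^sup>2) \<partial>count_space J) = ennreal (\<Sum>\<^sub>\<infinity>j\<in>J. (cmod (l2_inner (u j) ?e))\<^sup>2)"
        unfolding stft_def by (rule nn_integral_count_space_infsum[OF u_bessel(1)[OF atomL2]]) simp
      also have "\<dots> \<le> ennreal (B' * n2 ?e)" by (intro ennreal_leI u_bessel(2) atomL2)
      finally show ?thesis by (simp add: atom_norm)
    qed
    show "(\<integral>\<^sup>+z. ennreal ((cmod (stft (u j) z))\<^sup>2) \<partial>lborel) \<le> ennreal C" if "j \<in> J" for j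
      unfolding moyal_nn_integral[OF u(1)[OF that]] using u(2)[OF that] by (intro ennreal_leI) (simp add: n2_def)
    show "((\<lambda>j. stft (h j) z * cnj (stft (u j) z)) has_sum 1) J" for z
    proof -
      let ?e = "gabor_atom window 0 z :: real^'m \<Rightarrow> complex"
      have e1: "l2_inner ?e ?e = 1" using atom_norm[of z] by (simp add: l2_inner_self n2_def)
      \<comment> \<open>The reproducing identity at the atom, conjugated to match the order of the
        factors; its value is the squared norm 1.\<close>
      have "((\<lambda>j. cnj (l2_inner ?e (h j) * l2_inner (u j) ?e)) has_sum cnj (l2_inner ?e ?e)) J"
        unfolding has_sum_cnj_iff by (rule repro[OF atomL2])
      moreover have "cnj (l2_inner ?e (h j) * l2_inner (u j) ?e) = stft (h j) z * cnj (stft (u j) z)" for j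
        unfolding stft_def complex_cnj_mult by (simp only: l2_inner_cnj[of "h j" ?e])
      ultimately show ?thesis by (simp add: e1)
    qed
    show "cube_gauge M \<in> borel_measurable borel" by (rule cube_gauge_measurable[OF M])
    show "0 \<le> cube_gauge M x" for x by (simp add: cube_gauge_def infnorm_pos_le)
    show "cube_gauge M (x + y) \<le> cube_gauge M x + cube_gauge M y" for x y
      by (simp add: cube_gauge_def linear_add[OF linear_inv_of_bij[OF M]] infnorm_triangle)
    show "cube_gauge M (- x) = cube_gauge M x" for x
      by (simp add: cube_gauge_def linear_neg[OF linear_inv_of_bij[OF M]] infnorm_neg)
    show "emeasure lborel {x. cube_gauge M x \<le> t} = ennreal (\<kappa> * t ^ DIM('m tf))" if "0 \<le> t" for t
      using \<kappa>(2)[OF that] .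
    show "0 < DIM('m tf)" by (rule DIM_positive)
  qed (use nonneg \<kappa>(1) in auto)
  have E: "S.E n = M ` cube n c" for n
    unfolding S.E_def image_cube_eq[OF M] ..
  have JE: "JE n = S.inside n" for n
    unfolding S.inside_def JE_def E ..
  have V: "measure lborel (M ` cube n c) = S.vol n" for n
    unfolding E[symmetric] by (rule S.measure_E)
  have T: "integral\<^sup>L lborel (S.T j) = l2_inner (h j) (u j)" if "j \<in> J" for j
    unfolding S.T_def by (rule moyal[OF hL2 u(1)[OF that]])
  have "(\<Sum>j\<in>JE n. l2_inner (h j) (u j)) = (\<Sum>j\<in>S.inside n. integral\<^sup>L lborel (S.T j))" for n
    unfolding JE by (intro sum.cong refl T[symmetric]) (auto simp: S.inside_def)
  then show "(\<lambda>n. (\<Sum>j\<in>JE n. l2_inner (h j) (u j)) / of_real (measure lborel (M ` cube n c))) \<longlonglongrightarrow> 1"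
    unfolding V using S.dual_trace_asymptotics by simp
  show "\<exists>K\<ge>0. \<forall>n>0. finite (JE n) \<and> real (card (JE n)) \<le> K * measure lborel (M ` cube n c)"
    unfolding JE V by (rule S.inside_count)
  show "\<forall>n>0. measure lborel (M ` cube n c) > 0"
    unfolding V S.vol_def using \<kappa>(1) by simp
qed

text \<open>Factor \<open>S / N1\<close> as \<open>(S / V) (V / N) (N / N1)\<close>. Inverting the
  density needs it to be nonzero, which follows from \<open>|S| <= C N\<close> together with
  \<open>S / V\<close> tending to 1.\<close>

lemma trace_ratio_limit:
  fixes S :: "nat \<Rightarrow> complex" and N N1 :: "nat \<Rightarrow> nat" and V :: "nat \<Rightarrow> real"
  assumes p: "free_ultrafilter p"
    and S: "(\<lambda>n. S n / of_real (V n)) \<longlonglongrightarrow> 1"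
    and N_le: "\<And>n. n > 0 \<Longrightarrow> real (N n) \<le> K * V n"
    and V: "\<And>n. n > 0 \<Longrightarrow> V n > 0"
    and S_le: "\<And>n. cmod (S n) \<le> C * real (N n)"
    and ratio: "(\<lambda>n. real (N n) / real (N1 n)) \<longlonglongrightarrow> 1"
  shows "((\<lambda>n. S n / of_nat (N1 n)) \<longlongrightarrow> of_real (1 / plim p (\<lambda>n. real (N n) / V n))) p"
proof -
  have p_seq: "p \<le> sequentially" using p by (rule free_ultrafilter_le_sequentially)
  have p_bot: "p \<noteq> bot" using p by (simp add: free_ultrafilter_def)
  have pos: "\<forall>\<^sub>F n in p. n > 0" using eventually_gt_at_top[of 0] p_seq by (rule filter_leD[rotated])
  have "\<forall>\<^sub>F n in p. \<bar>real (N n) / V n\<bar> \<le> K"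
    using pos
  proof (rule eventually_mono)
    fix n :: nat assume n: "n > 0"
    show "\<bar>real (N n) / V n\<bar> \<le> K"
      using N_le[OF n] V[OF n] by (simp add: pos_divide_le_eq)
  qed
  from free_ultrafilter_bounded_limit[OF p this]
  obtain L where L: "((\<lambda>n. real (N n) / V n) \<longlongrightarrow> L) p" ..
  have lim: "plim p (\<lambda>n. real (N n) / V n) = L"
    unfolding plim_def by (rule tendsto_Lim[OF p_bot L])
  have S_p: "((\<lambda>n. S n / of_real (V n)) \<longlongrightarrow> 1) p" using S p_seq by (rule tendsto_mono[rotated])
  have r_p: "((\<lambda>n. real (N n) / real (N1 n)) \<longlongrightarrow> 1) p" using ratio p_seq by (rule tendsto_mono[rotated])
  have "cmod 1 \<le> C * L"
  proof (rule tendsto_le[OF p_bot])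
    show "((\<lambda>n. C * (real (N n) / V n)) \<longlongrightarrow> C * L) p" by (intro tendsto_intros L)
    show "((\<lambda>n. cmod (S n / of_real (V n))) \<longlongrightarrow> cmod 1) p" by (intro tendsto_intros S_p)
    show "\<forall>\<^sub>F n in p. cmod (S n / of_real (V n)) \<le> C * (real (N n) / V n)"
      using pos
    proof (rule eventually_mono)
      fix n :: nat assume "n > 0"
      then have "V n > 0" by (rule V)
      then show "cmod (S n / of_real (V n)) \<le> C * (real (N n) / V n)"
        using S_le[of n] by (simp add: norm_divide divide_right_mono)
    qed
  qed
  then have L0: "L \<noteq> 0" by auto
  have "((\<lambda>n. S n / of_real (V n) * of_real (inverse (real (N n) / V n)) * of_real (real (N n) / real (N1 n)))
      \<longlongrightarrow> 1 * of_real (inverse L) * of_real 1) p"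
    by (intro tendsto_intros S_p L L0 r_p)
  moreover have "\<forall>\<^sub>F n in p. S n / of_real (V n) * of_real (inverse (real (N n) / V n)) * of_real (real (N n) / real (N1 n))
      = S n / of_nat (N1 n)"
  proof -
    \<comment> \<open>A ratio tending to 1 is eventually positive, which excludes zero counts, where
      the cancellation would fail under \<open>x / 0 = 0\<close>.\<close>
    have "\<forall>\<^sub>F n in p. real (N n) / real (N1 n) > 0" using r_p by (rule order_tendstoD(1)) simp
    with pos show ?thesis
    proof eventually_elim
      case (elim n)
      then have "V n > 0" "N n > 0" "N1 n > 0" using V by (auto simp: zero_less_divide_iff)
      then show ?case by (simp add: field_simps)
    qed
  qed
  ultimately have "((\<lambda>n. S n / of_nat (N1 n)) \<longlongrightarrow> 1 * of_real (inverse L) * of_real 1) p"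
    by (rule Lim_transform_eventually)
  then show ?thesis by (simp add: lim inverse_eq_divide)
qed

text \<open>The terms over the intersection cancel. The size of the symmetric difference is written
  through the three cardinalities controlled by the limit hypotheses.\<close>

lemma sum_diff_sets_le:
  fixes t :: "'i \<Rightarrow> complex"
  assumes fin: "finite X" "finite Y" and t: "\<And>i. i \<in> X \<union> Y \<Longrightarrow> cmod (t i) \<le> C"
  shows "cmod (sum t X - sum t Y) \<le> C * (real (card X) + real (card Y) - 2 * real (card (X \<inter> Y)))"
proof -
  have X: "sum t X = sum t (X - Y) + sum t (X \<inter> Y)" "card X = card (X - Y) + card (X \<inter> Y)"
    using sum.Int_Diff[OF fin(1), of t Y] card_Int_Diff[OF fin(1), of Y] by (simp_all only: add.commute)
  have Y: "sum t Y = sum t (Y - X) + sum t (X \<inter> Y)" "card Y = card (Y - X) + card (X \<inter> Y)"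
    using sum.Int_Diff[OF fin(2), of t X] card_Int_Diff[OF fin(2), of X] by (simp_all only: add.commute Int_commute)
  have "cmod (sum t X - sum t Y) \<le> cmod (sum t (X - Y)) + cmod (sum t (Y - X))"
    unfolding X(1) Y(1) using norm_triangle_ineq4[of "sum t (X - Y)" "sum t (Y - X)"] by simp
  also have "\<dots> \<le> real (card (X - Y)) * C + real (card (Y - X)) * C"
    using t by (intro add_mono sum_norm_bound) auto
  also have "\<dots> = C * (real (card X) + real (card Y) - 2 * real (card (X \<inter> Y)))"
    unfolding X(2) Y(2) by (simp add: algebra_simps)
  finally show ?thesis .
qed

text \<open>Test vectors that isolate one component of the superframe and of its dual.\<close>

definition embed_summand :: "nat \<Rightarrow> (real^'m::finite \<Rightarrow> complex) \<Rightarrow> nat \<Rightarrow> real^'m \<Rightarrow> complex" where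
  "embed_summand k f = (\<lambda>l. if l = k then f else (\<lambda>x. 0))"

lemma embed_summand_in: "k \<in> {1..d} \<Longrightarrow> L2 f \<Longrightarrow> embed_summand k f \<in> L2_sum_space d"
  by (auto simp: embed_summand_def L2_sum_space_def L2_zero)

lemma embed_summand_inner:
  assumes "k \<in> {1..d}"
  shows "L2_sum_inner d (embed_summand k f) G = l2_inner f (G k)" "L2_sum_inner d G (embed_summand k f) = l2_inner (G k) f"
proof -
  have "L2_sum_inner d (embed_summand k f) G = (\<Sum>l=1..d. if l = k then l2_inner f (G k) else 0)"
    unfolding L2_sum_inner_def by (intro sum.cong refl) (simp add: embed_summand_def l2_inner_def)
  then show "L2_sum_inner d (embed_summand k f) G = l2_inner f (G k)" using assms by simp
  have "L2_sum_inner d G (embed_summand k f) = (\<Sum>l=1..d. if l = k then l2_inner (G k) f else 0)"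
    unfolding L2_sum_inner_def by (intro sum.cong refl) (simp add: embed_summand_def l2_inner_def)
  then show "L2_sum_inner d G (embed_summand k f) = l2_inner (G k) f" using assms by simp
qed

lemma embed_summand_nsq: "k \<in> {1..d} \<Longrightarrow> L2sum.nsq d (embed_summand k f) = (LINT x|lborel. (cmod (f x))\<^sup>2)"
  by (simp only: L2sum.nsq_def embed_summand_inner(1)) (simp add: embed_summand_def l2_inner_self)

theorem theorem9p10:
  fixes d :: nat
    and g :: "nat \<Rightarrow> real^'m \<Rightarrow> complex"
    and I :: "nat \<Rightarrow> 'i set"
    and Lam :: "nat \<Rightarrow> 'i \<Rightarrow> 'm tf"
    and ph :: "nat \<Rightarrow> 'i \<Rightarrow> real"
    and a :: "nat \<Rightarrow> 'i \<Rightarrow> 'i"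
    and M :: "nat \<Rightarrow> 'm tf \<Rightarrow> 'm tf"
    and Ob :: "'m tf"
    and N :: "'m tf \<Rightarrow> real"
    and r :: "real \<Rightarrow> real"
  assumes d: "d \<ge> 1"
    and g_L2: "\<forall>k\<in>{1..d}. L2 (g k)"
    and I_countable: "\<forall>k\<in>{1..d}. countable (I k)"
    and gabor_frames: "\<forall>k\<in>{1..d}.
          is_frame {f. L2 f} l2_inner (I k) (\<lambda>i. gabor_atom (g k) (ph k i) (Lam k i))"
    and a_bij: "\<forall>k\<in>{1..d}. bij_betw (a k) (I 1) (I k)"
    and a1: "\<forall>i\<in>I 1. a 1 i = i"
    and F_frame: "is_frame (L2_sum_space d) (L2_sum_inner d) (I 1)
          (\<lambda>i. \<lambda>k. if k \<in> {1..d} then gabor_atom (g k) (ph k (a k i)) (Lam k (a k i)) else (\<lambda>x. 0))"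
    and M_lin: "\<forall>k\<in>{1..d}. linear (M k) \<and> bij (M k)"
    and lim1: "\<forall>k\<in>{1..d}.
          (\<lambda>n. real (card {i\<in>I 1. Lam k (a k i) \<in> M k ` cube n Ob \<and> Lam 1 i \<in> M 1 ` cube n Ob})
               / real (count_in (I 1) (Lam 1) (M 1 ` cube n Ob))) \<longlonglongrightarrow> 1"
    and lim2: "\<forall>k\<in>{1..d}.
          (\<lambda>n. real (count_in (I k) (Lam k) (M k ` cube n Ob))
               / real (count_in (I 1) (Lam 1) (M 1 ` cube n Ob))) \<longlonglongrightarrow> 1"
    and N_norm: "is_norm N"
    and r_nonneg: "\<forall>t\<ge>0. r t \<ge> 0"
    and r_bound: "\<forall>k\<in>{1..d}. \<forall>i\<in>I 1. \<forall>j\<in>I 1.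
          N (Lam 1 i - Lam 1 j) \<le> r (N (Lam k (a k i) - Lam k (a k j)))"
  shows "\<forall>p. free_ultrafilter p \<longrightarrow>
      frame_measure (L2_sum_space d) (L2_sum_inner d) (I 1)
          (\<lambda>i. \<lambda>k. if k \<in> {1..d} then gabor_atom (g k) (ph k (a k i)) (Lam k (a k i)) else (\<lambda>x. 0))
          (Lam 1) (M 1) Ob p
        = complex_of_real (\<Sum>k=1..d. 1 / udensity (I k) (Lam k) p (M k) Ob)
      \<and> (\<Sum>k=1..d. 1 / udensity (I k) (Lam k) p (M k) Ob) \<le> 1"
proof (intro allI impI)
  fix p assume p: "free_ultrafilter p"
  have p_seq: "p \<le> sequentially" using p by (rule free_ultrafilter_le_sequentially)
  have p_bot: "p \<noteq> bot" using p by (simp add: free_ultrafilter_def)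
  have one: "1 \<in> {1..d}" using d by simp
  define h where "h = (\<lambda>i k. if k \<in> {1..d} then gabor_atom (g k) (ph k (a k i)) (Lam k (a k i)) else (\<lambda>x. 0))"
  have h_comp: "h i k = gabor_atom (g k) (ph k (a k i)) (Lam k (a k i))" if "k \<in> {1..d}" for i k
    using that by (simp add: h_def)
  from F_frame obtain A B where AB: "0 < A" "A \<le> B" and fr: "\<forall>f\<in>L2_sum_space d.
        (\<lambda>i. (cmod (L2_sum_inner d f (h i)))\<^sup>2) summable_on I 1 \<and>
        A * Re (L2_sum_inner d f f) \<le> (\<Sum>\<^sub>\<infinity>i\<in>I 1. (cmod (L2_sum_inner d f (h i)))\<^sup>2) \<and>
        (\<Sum>\<^sub>\<infinity>i\<in>I 1. (cmod (L2_sum_inner d f (h i)))\<^sup>2) \<le> B * Re (L2_sum_inner d f f)"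
    unfolding is_frame_def h_def by (elim conjE exE)
  have h_in: "h i \<in> L2_sum_space d" if "i \<in> I 1" for i
    using F_frame that unfolding is_frame_def h_def by (elim conjE) (rule bspec)
  interpret Fr: frame_carrier "L2_sum_space d" "L2_sum_inner d" L2_sum_lincomb "I 1" h A B
  proof (intro frame_carrier.intro L2sum.pre_hilbert_carrier_axioms frame_carrier_axioms.intro)
    show "pre_hilbert_carrier.carrier_complete (L2_sum_space d :: (nat \<Rightarrow> real^'m \<Rightarrow> complex) set)
        (L2_sum_inner d) L2_sum_lincomb"
      by (rule L2_sum_complete)
  qed (use h_in AB fr in \<open>simp_all add: L2sum.nsq_def\<close>)
  define u where "u = Fr.dual"
  have u_in: "u i \<in> L2_sum_space d" if "i \<in> I 1" for i
    unfolding u_def by (rule Fr.dual(1)[OF that])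
  have u_comp: "L2 (u i k)" if "i \<in> I 1" "k \<in> {1..d}" for i k
    using u_in[OF that(1)] that(2) by (auto simp: L2_sum_space_def)
  let ?n2 = "\<lambda>f :: real^'m \<Rightarrow> complex. LINT x|lborel. (cmod (f x))\<^sup>2"
  \<comment> \<open>Translation, modulation and phase preserve norms, so all superframe vectors have
    the same squared norm \<open>G\<close>; the bounds \<open>C\<close> and \<open>C0\<close> are
    therefore independent of the index.\<close>
  define G where "G = (\<Sum>k=1..d. ?n2 (g k))"
  have n2_nonneg: "0 \<le> ?n2 f" for f by (rule Bochner_Integration.integral_nonneg) simp
  have G: "0 \<le> G" unfolding G_def by (intro sum_nonneg n2_nonneg)
  have nsq: "L2sum.nsq d F = (\<Sum>k=1..d. ?n2 (F k))" for F
    by (simp only: L2sum.nsq_def L2_sum_inner_self Re_complex_of_real)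
  have h_nsq: "L2sum.nsq d (h i) = G" for i
    unfolding nsq G_def using g_L2 by (intro sum.cong refl) (simp add: h_comp integral_norm_sq_gabor_atom)
  define C where "C = G / A\<^sup>2"
  have C: "0 \<le> C" using G by (simp add: C_def)
  have comp_le: "?n2 (F k) \<le> L2sum.nsq d F" if "k \<in> {1..d}" for F k
    unfolding nsq by (rule member_le_sum[OF that]) (use n2_nonneg in auto)
  have u_norm: "?n2 (u i k) \<le> C" if "i \<in> I 1" "k \<in> {1..d}" for i k
    using comp_le[OF that(2), of "u i"] Fr.dual_bound[OF that(1)] by (simp only: u_def h_nsq C_def)
  have h_norm: "?n2 (h i k) \<le> G" if "k \<in> {1..d}" for i k
    using comp_le[OF that, of "h i"] by (simp only: h_nsq)
  have hL2: "L2 (h i k)" if "k \<in> {1..d}" for i k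
    using g_L2 that by (simp add: h_comp L2_gabor_atom)
  define t where "t k i = l2_inner (h i k) (u i k)" for k i
  define C0 where "C0 = sqrt G * sqrt C"
  have C0: "0 \<le> C0" using G C by (simp add: C0_def)
  have t_le: "cmod (t k i) \<le> C0" if "i \<in> I 1" "k \<in> {1..d}" for i k
  proof -
    have "cmod (t k i) \<le> sqrt (?n2 (h i k)) * sqrt (?n2 (u i k))"
      unfolding t_def by (rule L2_cauchy_schwarz[OF hL2[OF that(2)] u_comp[OF that]])
    also have "\<dots> \<le> C0"
      unfolding C0_def using h_norm[OF that(2)] u_norm[OF that] G n2_nonneg by (intro mult_mono) simp_all
    finally show ?thesis .
  qed
  define JE where "JE k n = {i \<in> I 1. Lam k (a k i) \<in> M k ` cube n Ob}" for k n
  define V where "V k n = measure lborel (M k ` cube n Ob)" for k n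
  \<comment> \<open>The component systems inherit their constants: \<open>B\<close> from the
    superframe, \<open>1 / A\<close> from its canonical dual, and \<open>C\<close> for the norms.
    The points of the \<open>k\<close>-th system are indexed by \<open>I 1\<close> through
    \<open>a k\<close>.\<close>
  have asym: "(\<lambda>n. (\<Sum>i\<in>JE k n. t k i) / of_real (V k n)) \<longlonglongrightarrow> 1"
    "\<exists>K\<ge>0. \<forall>n>0. finite (JE k n) \<and> real (card (JE k n)) \<le> K * V k n"
    "\<forall>n>0. V k n > 0"
    if k: "k \<in> {1..d}" for k
  proof -
    have e_nsq: "Re (L2_sum_inner d (embed_summand k f) (embed_summand k f)) = ?n2 f" for f :: "real^'m \<Rightarrow> complex"
      using embed_summand_nsq[OF k, of f] by (simp only: L2sum.nsq_def)
    note prem = gabor_dual_trace_asymptotics[where J = "I 1" and M = "M k" and g = "g k" and u = "\<lambda>i. u i k" and C = C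
        and h = "\<lambda>i. h i k" and ph = "\<lambda>i. ph k (a k i)" and lam = "\<lambda>i. Lam k (a k i)" and B = B and B' = "1 / A" and c = Ob]
    have A1: "countable (I 1)" using I_countable one by blast
    have A2: "linear (M k)" "bij (M k)" using M_lin k by auto
    have A3: "L2 (g k)" using g_L2 k by blast
    have A4: "(\<lambda>i. (cmod (l2_inner f (h i k)))\<^sup>2) summable_on I 1"
      "(\<Sum>\<^sub>\<infinity>i\<in>I 1. (cmod (l2_inner f (h i k)))\<^sup>2) \<le> B * ?n2 f" if "L2 f" for f
      using fr[rule_format, OF embed_summand_in[OF k that]] unfolding embed_summand_inner[OF k] e_nsq[unfolded embed_summand_inner[OF k]]
      by (simp_all add: embed_summand_def l2_inner_self)
    have A5: "(\<lambda>i. (cmod (l2_inner (u i k) f))\<^sup>2) summable_on I 1"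
      "(\<Sum>\<^sub>\<infinity>i\<in>I 1. (cmod (l2_inner (u i k) f))\<^sup>2) \<le> 1 / A * ?n2 f" if "L2 f" for f
      using Fr.dual_bessel[OF embed_summand_in[OF k that]] unfolding embed_summand_inner[OF k] embed_summand_nsq[OF k] u_def
      by simp_all
    have A6: "((\<lambda>i. l2_inner f (h i k) * l2_inner (u i k) f) has_sum l2_inner f f) (I 1)" if "L2 f" for f
      using Fr.dual_reproducing[OF embed_summand_in[OF k that]] unfolding embed_summand_inner[OF k] u_def
      by (simp add: embed_summand_def)
    have A7: "0 \<le> B" "0 \<le> 1 / A" using AB by simp_all
    note prem = prem[OF A1 A2 A3 u_comp[OF _ k] u_norm[OF _ k] h_comp[OF k] A4 A5 A6 C A7]
    show "(\<lambda>n. (\<Sum>i\<in>JE k n. t k i) / of_real (V k n)) \<longlonglongrightarrow> 1"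
      using prem(1) unfolding JE_def V_def t_def .
    show "\<exists>K\<ge>0. \<forall>n>0. finite (JE k n) \<and> real (card (JE k n)) \<le> K * V k n"
      using prem(2) unfolding JE_def V_def .
    show "\<forall>n>0. V k n > 0"
      using prem(3) unfolding V_def .
  qed
  define Jn where "Jn n = {i \<in> I 1. Lam 1 i \<in> M 1 ` cube n Ob}" for n
  \<comment> \<open>As \<open>a 1\<close> is the identity on \<open>I 1\<close>, the averaging set
    is the case \<open>k = 1\<close>, from which it gets its finiteness.\<close>
  have Jn: "Jn n = JE 1 n" for n unfolding Jn_def JE_def using a1 by auto
  have cnt1: "count_in (I 1) (Lam 1) (M 1 ` cube n Ob) = card (Jn n)" for n
    by (simp add: count_in_def Jn_def)
  \<comment> \<open>The bijection \<open>a k\<close> matches the counts over \<open>I k\<close> in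
    the density with counts over \<open>I 1\<close> in the average, multiplicities included.\<close>
  have cntk: "count_in (I k) (Lam k) (M k ` cube n Ob) = card (JE k n)" if k: "k \<in> {1..d}" for k n
  proof -
    have bij: "bij_betw (a k) (I 1) (I k)" using a_bij k by blast
    have "{i \<in> I k. P i} = a k ` {i \<in> I 1. P (a k i)}" for P
      unfolding bij_betw_imp_surj_on[OF bij, symmetric] by auto
    then have "{i \<in> I k. Lam k i \<in> M k ` cube n Ob} = a k ` JE k n"
      unfolding JE_def .
    moreover have "inj_on (a k) (JE k n)"
      using bij by (auto simp: bij_betw_def JE_def intro: inj_on_subset)
    ultimately show ?thesis by (simp add: count_in_def card_image)
  qed
  have fin: "finite (JE k n)" if "k \<in> {1..d}" "n > 0" for k n
    using asym(2)[OF that(1)] that(2) by blast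
  have r2: "(\<lambda>n. real (card (JE k n)) / real (card (Jn n))) \<longlonglongrightarrow> 1" if k: "k \<in> {1..d}" for k
    using lim2[rule_format, OF k] unfolding cnt1 cntk[OF k] .
  have r1: "(\<lambda>n. real (card (JE k n \<inter> Jn n)) / real (card (Jn n))) \<longlonglongrightarrow> 1" if k: "k \<in> {1..d}" for k
  proof -
    have "{i \<in> I 1. Lam k (a k i) \<in> M k ` cube n Ob \<and> Lam 1 i \<in> M 1 ` cube n Ob} = JE k n \<inter> Jn n" for n
      by (auto simp: JE_def Jn_def)
    then show ?thesis using lim1[rule_format, OF k] unfolding cnt1 by simp
  qed
  have comp_lim: "((\<lambda>n. (\<Sum>i\<in>Jn n. t k i) / of_nat (card (Jn n))) \<longlongrightarrow>
      of_real (1 / udensity (I k) (Lam k) p (M k) Ob)) p" if k: "k \<in> {1..d}" for k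
  proof -
    obtain K where K: "\<And>n. n > 0 \<Longrightarrow> real (card (JE k n)) \<le> K * V k n"
      using asym(2)[OF k] by blast
    have ud: "udensity (I k) (Lam k) p (M k) Ob = plim p (\<lambda>n. real (card (JE k n)) / V k n)"
      unfolding udensity_def cntk[OF k] V_def ..
    have main: "((\<lambda>n. (\<Sum>i\<in>JE k n. t k i) / of_nat (card (Jn n))) \<longlongrightarrow>
        of_real (1 / plim p (\<lambda>n. real (card (JE k n)) / V k n))) p"
    proof (rule trace_ratio_limit[OF p asym(1)[OF k] K _ _ r2[OF k]])
      show "V k n > 0" if "n > 0" for n using asym(3)[OF k] that by blast
      show "cmod (\<Sum>i\<in>JE k n. t k i) \<le> C0 * real (card (JE k n))" for n
        using sum_norm_bound[of "JE k n" "t k" C0] t_le[OF _ k] by (simp add: JE_def mult.commute)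
    qed
    \<comment> \<open>By \<open>r1\<close> and \<open>r2\<close> the symmetric difference of
      \<open>Jn n\<close> and \<open>JE k n\<close> has relative size tending to
      \<open>1 + 1 - 2 = 0\<close>, and its terms are bounded by \<open>C0\<close>.\<close>
    have "(\<lambda>n. (\<Sum>i\<in>Jn n. t k i) / of_nat (card (Jn n)) - (\<Sum>i\<in>JE k n. t k i) / of_nat (card (Jn n))) \<longlonglongrightarrow> 0"
    proof (rule Lim_null_comparison)
      let ?q = "\<lambda>m n. real (m n) / real (card (Jn n))"
      let ?Q = "\<lambda>n. ?q (\<lambda>n. card (Jn n)) n + ?q (\<lambda>n. card (JE k n)) n - 2 * ?q (\<lambda>n. card (JE k n \<inter> Jn n)) n"
      show "\<forall>\<^sub>F n in sequentially. norm ((\<Sum>i\<in>Jn n. t k i) / of_nat (card (Jn n)) - (\<Sum>i\<in>JE k n. t k i) / of_nat (card (Jn n)))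
          \<le> C0 * ?Q n"
        using eventually_gt_at_top[of 0]
      proof eventually_elim
        case (elim n)
        have "norm ((\<Sum>i\<in>Jn n. t k i) / of_nat (card (Jn n)) - (\<Sum>i\<in>JE k n. t k i) / of_nat (card (Jn n)))
            = cmod ((\<Sum>i\<in>Jn n. t k i) - (\<Sum>i\<in>JE k n. t k i)) / real (card (Jn n))"
          by (simp add: diff_divide_distrib[symmetric] norm_divide)
        also have "\<dots> \<le> (C0 * (real (card (Jn n)) + real (card (JE k n)) - 2 * real (card (Jn n \<inter> JE k n)))) / real (card (Jn n))"
        proof (intro divide_right_mono sum_diff_sets_le)
          show "finite (Jn n)" unfolding Jn using fin[OF one elim] .
          show "finite (JE k n)" using fin[OF k elim] .
          show "cmod (t k i) \<le> C0" if "i \<in> Jn n \<union> JE k n" for i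
            using that t_le[OF _ k] by (auto simp: Jn_def JE_def)
        qed simp
        also have "\<dots> = C0 * ?Q n"
        proof -
          have "C0 * (x + y - 2 * z) / w = C0 * (x / w + y / w - 2 * (z / w))" for x y z w :: real
            by (simp add: algebra_simps add_divide_distrib diff_divide_distrib)
          then show ?thesis by (simp only: Int_commute)
        qed
        finally show ?case .
      qed
      have "(\<lambda>n. ?q (\<lambda>n. card (Jn n)) n) \<longlonglongrightarrow> 1" using r2[OF one] unfolding Jn .
      then have "(\<lambda>n. C0 * ?Q n)
          \<longlonglongrightarrow> C0 * (1 + 1 - 2 * 1)"
        by (intro tendsto_intros r1[OF k] r2[OF k])
      then show "(\<lambda>n. C0 * ?Q n) \<longlonglongrightarrow> 0"
        by simp
    qed
    then have "((\<lambda>n. (\<Sum>i\<in>Jn n. t k i) / of_nat (card (Jn n)) - (\<Sum>i\<in>JE k n. t k i) / of_nat (card (Jn n))) \<longlongrightarrow> 0) p"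
      using p_seq by (rule tendsto_mono[rotated])
    from tendsto_add[OF this main] show ?thesis unfolding ud by simp
  qed
  let ?m = "\<lambda>n. (1 / of_nat (card (Jn n))) * (\<Sum>i\<in>Jn n. L2_sum_inner d (h i) (u i))"
  define D where "D = (\<Sum>k=1..d. 1 / udensity (I k) (Lam k) p (M k) Ob)"
  have m_eq: "?m n = (\<Sum>k=1..d. (\<Sum>i\<in>Jn n. t k i) / of_nat (card (Jn n)))" for n
    unfolding L2_sum_inner_def t_def[symmetric] sum.swap[of _ "{1..d}"] sum_divide_distrib[symmetric] by simp
  have m_lim: "(?m \<longlongrightarrow> of_real D) p"
    unfolding m_eq D_def of_real_sum by (intro tendsto_sum comp_lim)
  have "frame_measure (L2_sum_space d) (L2_sum_inner d) (I 1) h (Lam 1) (M 1) Ob p = of_real D"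
    unfolding frame_measure_def plim_def Jn_def[symmetric]
    using tendsto_Lim[OF p_bot m_lim] by (simp only: u_def Fr.dual_def)
  moreover have "D \<le> 1"
  proof (rule tendsto_upperbound[OF _ _ p_bot])
    show "((\<lambda>n. Re (?m n)) \<longlongrightarrow> D) p" using tendsto_Re[OF m_lim] by simp
    have "Re (?m n) \<le> 1" for n
    \<comment> \<open>For cardinality 0 the prefactor \<open>1 / 0\<close> is 0, so the bound is
      immediate.\<close>
    proof (cases "card (Jn n) = 0")
      case False
      have "Re (\<Sum>i\<in>Jn n. L2_sum_inner d (h i) (u i)) = (\<Sum>i\<in>Jn n. Re (L2_sum_inner d (h i) (u i)))"
        by (rule Re_sum)
      also have "\<dots> \<le> (\<Sum>i\<in>Jn n. 1)"
        by (intro sum_mono) (use Fr.dual_diagonal(2) in \<open>auto simp: u_def Jn_def\<close>)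
      finally have le: "Re (\<Sum>i\<in>Jn n. L2_sum_inner d (h i) (u i)) \<le> real (card (Jn n))" by simp
      have "?m n = (\<Sum>i\<in>Jn n. L2_sum_inner d (h i) (u i)) / complex_of_real (real (card (Jn n)))" by simp
      then have "Re (?m n) = Re (\<Sum>i\<in>Jn n. L2_sum_inner d (h i) (u i)) / real (card (Jn n))"
        by (simp only: Re_divide_of_real)
      with le False show ?thesis by (simp add: divide_le_eq)
    qed simp
    then show "\<forall>\<^sub>F n in p. Re (?m n) \<le> 1" by simp
  qed
  ultimately show "frame_measure (L2_sum_space d) (L2_sum_inner d) (I 1)
          (\<lambda>i. \<lambda>k. if k \<in> {1..d} then gabor_atom (g k) (ph k (a k i)) (Lam k (a k i)) else (\<lambda>x. 0))
          (Lam 1) (M 1) Ob p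
        = complex_of_real (\<Sum>k=1..d. 1 / udensity (I k) (Lam k) p (M k) Ob)
      \<and> (\<Sum>k=1..d. 1 / udensity (I k) (Lam k) p (M k) Ob) \<le> 1"
    unfolding D_def h_def by (rule conjI)
qed

end
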